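(* Let $p\ge1$, $k\in\{1,\dots,p\}$ and $\alpha\ge0$. The following are equivalent: (i) A Wishart semigroup with state space $D_p(k)$ and drift parameter $\alpha$ exists. (ii) If $k\in\{1,\dots,p-1\}$ then $\alpha=k$; if $k=p$ then $\alpha\ge p-1$.
   Context: $D_p(k)$ is the (closed) set of positive semidefinite $p\times p$ matrices of rank $\le k$; $D_p(p)=\bar{\mathcal S}_p^+$. For $u\in\bar{\mathcal S}_p^+$, $f_u(x)=\exp(-\operatorname{tr}(ux))$. A Wishart semigroup on a closed set $D\subseteq\bar{\mathcal S}_p^+$ with drift parameter $\alpha\ge0$ is a positive, strongly continuous contraction semigroup $(P_t)_{t\ge0}$ on $C_0(D)$ such that for all $u\in\mathcal S_p^+$, $t\ge0$, $x\in D$: $P_tf_u(x)=\det(I+2tu)^{-\alpha/2}\exp(-\operatorname{tr}(x(u^{-1}+2tI)^{-1}))$. *)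

theory Defs
  imports "HOL-Analysis.Analysis"
begin

definition psd :: "real^'n^'n \<Rightarrow> bool" where
  "psd A \<longleftrightarrow> transpose A = A \<and> (\<forall>v. 0 \<le> v \<bullet> (A *v v))"

definition pd :: "real^'n^'n \<Rightarrow> bool" where
  "pd A \<longleftrightarrow> transpose A = A \<and> (\<forall>v. v \<noteq> 0 \<longrightarrow> 0 < v \<bullet> (A *v v))"

definition Dpk :: "nat \<Rightarrow> (real^'n^'n) set" where
  "Dpk k = {A. psd A \<and> rank A \<le> k}"

text \<open>C_0(D): continuous real functions on D vanishing at infinity; elements
  are represented extensionally as functions that are 0 outside D.\<close>
definition C0 :: "'a::real_normed_vector set \<Rightarrow> ('a \<Rightarrow> real) set" where
  "C0 D = {f. continuous_on D f \<and> (\<forall>x. x \<notin> D \<longrightarrow> f x = 0) \<and>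
              (\<forall>e>0. \<exists>r. \<forall>x\<in>D. r \<le> norm x \<longrightarrow> \<bar>f x\<bar> < e)}"

definition pos_sc_contraction_semigroup ::
  "'a::real_normed_vector set \<Rightarrow> (real \<Rightarrow> ('a \<Rightarrow> real) \<Rightarrow> ('a \<Rightarrow> real)) \<Rightarrow> bool" where
  "pos_sc_contraction_semigroup D P \<longleftrightarrow>
     (\<forall>t\<ge>0. \<forall>f\<in>C0 D. P t f \<in> C0 D)
   \<and> (\<forall>t\<ge>0. \<forall>f\<in>C0 D. \<forall>g\<in>C0 D. \<forall>a::real.
        P t (\<lambda>x. a * f x + g x) = (\<lambda>x. a * P t f x + P t g x))
   \<and> (\<forall>t\<ge>0. \<forall>f\<in>C0 D. (\<forall>x\<in>D. 0 \<le> f x) \<longrightarrow> (\<forall>x\<in>D. 0 \<le> P t f x))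
   \<and> (\<forall>t\<ge>0. \<forall>f\<in>C0 D. \<forall>c. (\<forall>x\<in>D. \<bar>f x\<bar> \<le> c) \<longrightarrow> (\<forall>x\<in>D. \<bar>P t f x\<bar> \<le> c))
   \<and> (\<forall>f\<in>C0 D. P 0 f = f)
   \<and> (\<forall>s\<ge>0. \<forall>t\<ge>0. \<forall>f\<in>C0 D. P (s + t) f = P s (P t f))
   \<and> (\<forall>f\<in>C0 D. \<forall>e>0. \<exists>\<delta>>0. \<forall>t. 0 \<le> t \<and> t < \<delta> \<longrightarrow> (\<forall>x\<in>D. \<bar>P t f x - f x\<bar> \<le> e))"

definition fexp :: "(real^'n^'n) set \<Rightarrow> real^'n^'n \<Rightarrow> real^'n^'n \<Rightarrow> real" where
  "fexp D u = (\<lambda>x. if x \<in> D then exp (- trace (u ** x)) else 0)"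

definition wishart_semigroup ::
  "(real^'n^'n) set \<Rightarrow> real \<Rightarrow> (real \<Rightarrow> (real^'n^'n \<Rightarrow> real) \<Rightarrow> (real^'n^'n \<Rightarrow> real)) \<Rightarrow> bool" where
  "wishart_semigroup D \<alpha> P \<longleftrightarrow> 0 \<le> \<alpha> \<and> pos_sc_contraction_semigroup D P \<and>
     (\<forall>u t x. pd u \<longrightarrow> 0 \<le> t \<longrightarrow> x \<in> D \<longrightarrow>
        P t (fexp D u) x =
          det (mat 1 + (2 * t) *\<^sub>R u) powr (- \<alpha> / 2) *
          exp (- trace (x ** matrix_inv (matrix_inv u + (2 * t) *\<^sub>R mat 1))))"

end

theory Submission
  imports Defs "HOL-Probability.Probability"
begin

text \<open>
  Write \<open>f\<^sub>u(x) = exp (- u \<bullet> x)\<close> with the Frobenius inner product, which is \<open>tr (u x)\<close> on symmetric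
  matrices. The linear span of the \<open>f\<^sub>u\<close> is dense in \<open>C\<^sub>0\<close> by Stone-Weierstrass, so everything about
  the semigroup can be checked on these functions.

  Existence: in terms of \<open>w = u\<^sup>-\<^sup>1\<close> the semigroup replaces \<open>w\<close> by \<open>w + 2 t I\<close>, hence it is the
  composition over the coordinates \<open>i\<close> of operators replacing \<open>w\<close> by \<open>w + 2 t e\<^sub>i e\<^sub>i\<^sup>T\<close>. Such an operator
  is realised by writing \<open>x = q q\<^sup>T\<close> and moving only row \<open>i\<close> of \<open>q\<close>. If \<open>q\<close> has \<open>k\<close> columns and
  \<open>\<alpha> = k\<close>, Gaussian noise does this. In full rank, \<open>q\<close> is chosen such that one column is supported
  in row \<open>i\<close>; its entry moves as the square root of a squared Bessel process of
  dimension \<open>\<alpha> - (p - 1) \<ge> 0\<close> and the other \<open>p - 1\<close> entries of the row receive Gaussian noise.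

  Necessity: at the projection \<open>\<pi>\<close> to the coordinates in \<open>K\<close> the generator maps a nonnegative cubic
  polynomial, which vanishes at \<open>\<pi>\<close> and agrees to second order with the principal minor
  on \<open>K \<union> {m}\<close>, to \<open>\<alpha> - card K\<close> up to a positive factor. The positive minimum principle
  gives \<open>\<alpha> \<ge> card K\<close>. On matrices of rank at most \<open>card K\<close> the same polynomial is bounded by a
  multiple of \<open>norm (x - \<pi>) ^ 4\<close>, whose generator vanishes at \<open>\<pi>\<close>, so there \<open>\<alpha> \<le> card K\<close>.
\<close>

section \<open>Positive semidefinite matrices\<close>

text \<open>Necessity meets the obstacle that the semigroup is known only on exponentials with
  positive definite parameter, while polynomials do not lie in C_0. A polynomial is therefore
  multiplied by a decaying exponential, and such products are reached by differentiating f_u in u,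
  which is legitimate because the generator is closed. On f_u the generator multiplies by -\<alpha>
  tr(u) + 2 tr(u^2 x). This is quadratic in u, so products of three or more linear forms vanishing
  at pi are invisible there: the entry x_mm contributes \<alpha>, each square x_am^2 contributes 1.
  The weight contributes nothing at pi because pi e_m = 0.

  In the existence part the threshold p - 1 has a concrete source. A column of q with entries
  outside row i couples its moving entry to u by a linear term, which Gaussian noise reproduces at
  the price of exactly one dimension. A column supported in row i enters only through the square of
  its entry, so it can carry any remaining real dimension that is not negative.\<close>

definition outer :: "real^'n \<Rightarrow> real^'n^'n" where
  "outer v = (\<chi> i j. v $ i * v $ j)"

lemma outer_nth [simp]: "outer v $ i $ j = v $ i * v $ j"
  by (simp add: outer_def)

lemma outer_mult_vec: "outer a *v v = (a \<bullet> v) *\<^sub>R a"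
  by (simp add: vec_eq_iff matrix_vector_mult_def inner_vec_def sum_distrib_left
      sum_distrib_right algebra_simps)

lemma transpose_outer [simp]: "transpose (outer v) = outer v"
  by (simp add: transpose_def vec_eq_iff mult.commute)

lemma inner_outer: "u \<bullet> outer w = w \<bullet> (u *v w)"
  by (simp add: inner_vec_def matrix_vector_mult_def sum_distrib_left algebra_simps)

lemma norm_outer: "norm (outer w) = (norm w)\<^sup>2"
proof -
  have "(norm (outer w))\<^sup>2 = (w \<bullet> w)\<^sup>2"
    by (simp only: power2_norm_eq_inner inner_outer outer_mult_vec)
      (simp add: power2_eq_square)
  then show ?thesis
    by (metis dot_square_norm norm_ge_zero power2_eq_iff_nonneg zero_le_power2)
qed

lemma inner_axis_mult_axis: "axis i 1 \<bullet> (u *v axis j 1) = (u :: real^'n^'m) $ i $ j"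
  by (simp add: matrix_vector_mult_basis inner_axis_axis column_def inner_axis')

lemma matrix_mult_axis_nth: "(u *v axis j 1) $ i = (u :: real^'n^'m) $ i $ j"
  by (simp add: matrix_vector_mult_basis column_def)

lemma sym_nth: "transpose x = x \<Longrightarrow> x $ i $ j = x $ j $ i"
  by (metis transpose_def vec_lambda_beta)

lemma sym_inner: "transpose (x :: real^'n^'n) = x \<Longrightarrow> v \<bullet> (x *v w) = w \<bullet> (x *v v)"
  by (metis dot_lmul_matrix inner_commute transpose_matrix_vector)

lemma trace_mult_eq_inner: "transpose x = x \<Longrightarrow> trace (u ** x) = u \<bullet> (x :: real^'n^'n)"
  by (simp add: trace_def matrix_matrix_mult_def inner_vec_def sym_nth)

lemma psdD: "psd x \<Longrightarrow> transpose x = x" "psd x \<Longrightarrow> 0 \<le> v \<bullet> (x *v v)"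
  by (auto simp: psd_def)

lemma pdD: "pd x \<Longrightarrow> transpose x = x" "pd x \<Longrightarrow> v \<noteq> 0 \<Longrightarrow> 0 < v \<bullet> (x *v v)"
  by (auto simp: pd_def)

lemma transpose_add: "transpose (a + b) = transpose a + transpose (b :: real^'n^'m)"
  and transpose_diff: "transpose (a - b) = transpose a - transpose (b :: real^'n^'m)"
  by (simp_all add: transpose_def vec_eq_iff)

lemma pd_imp_psd: "pd x \<Longrightarrow> psd x"
  by (metis inner_zero_left less_eq_real_def pd_def psd_def)

lemma psd_outer [simp]: "psd (outer v)"
  by (simp add: psd_def outer_mult_vec inner_commute)

lemma psd_zero [simp]: "psd 0"
  by (simp add: psd_def transpose_def vec_eq_iff)

lemma psd_add: "psd x \<Longrightarrow> psd y \<Longrightarrow> psd (x + y)"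
  by (simp add: psd_def transpose_add matrix_vector_mult_add_rdistrib inner_add_right)

lemma psd_scaleR: "psd x \<Longrightarrow> 0 \<le> c \<Longrightarrow> psd (c *\<^sub>R x)"
  by (simp add: psd_def transpose_scalar scaleR_matrix_vector_assoc[symmetric])

lemma psd_sum: "(\<And>i. i \<in> I \<Longrightarrow> psd (x i)) \<Longrightarrow> psd (sum x I)"
  by (induction I rule: infinite_finite_induct) (auto intro: psd_add)

lemma pd_add_psd: "pd x \<Longrightarrow> psd y \<Longrightarrow> pd (x + y)"
  by (auto simp: psd_def pd_def transpose_add matrix_vector_mult_add_rdistrib inner_add_right
      intro: add_pos_nonneg)

lemma pd_scaleR: "pd x \<Longrightarrow> 0 < c \<Longrightarrow> pd (c *\<^sub>R x)"
  by (simp add: pd_def transpose_scalar scaleR_matrix_vector_assoc[symmetric])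

lemma pd_mat_1 [simp]: "pd (mat 1)"
  by (simp add: pd_def)

lemma psd_diag_nonneg: "psd x \<Longrightarrow> 0 \<le> x $ i $ i"
  by (metis inner_axis_mult_axis psdD(2))

lemma psd_row_eq_0:
  assumes "psd x" "x $ i $ i = 0"
  shows "x $ i $ j = 0"
proof (rule ccontr)
  assume nz: "x $ i $ j \<noteq> 0"
  \<comment> \<open>The form at s e_i + e_j is affine in \<open>s\<close> because
    \<open>x $ i $ i = 0\<close>; this \<open>s\<close> makes its value -1.\<close>
  define s where "s = - (x $ j $ j + 1) / (2 * x $ i $ j)"
  have "0 \<le> (s *\<^sub>R axis i 1 + axis j 1) \<bullet> (x *v (s *\<^sub>R axis i 1 + axis j 1))"
    using assms(1) by (rule psdD)
  also have "\<dots> = 2 * s * x $ i $ j + x $ j $ j"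
    using sym_nth[OF psdD(1)[OF assms(1)], of i j] assms(2)
    by (simp add: inner_add_left inner_add_right matrix_vector_right_distrib
        matrix_vector_mult_scaleR inner_axis_mult_axis algebra_simps)
  also have "\<dots> = -1" using nz by (simp add: s_def field_simps)
  finally show False by simp
qed

text \<open>One elimination step of the Cholesky algorithm. The form of \<open>x - outer w\<close>
  at \<open>v\<close> is the form of \<open>x\<close> at \<open>v\<close> minus its component along
  \<open>axis i 1\<close> with respect to \<open>x\<close>, hence nonnegative.\<close>

lemma psd_pivot:
  fixes x :: "real^'n^'n"
  assumes "psd x" "0 < x $ i $ i"
  defines "w \<equiv> (1 / sqrt (x $ i $ i)) *\<^sub>R (x *v axis i 1)"
  shows "psd (x - outer w)" and "(x - outer w) *v axis i 1 = 0"
proof -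
  have sy: "transpose x = x" using assms(1) by (rule psdD)
  have d: "sqrt (x $ i $ i) * sqrt (x $ i $ i) = x $ i $ i" using assms(2) by simp
  have o: "outer w *v v = (((x *v axis i 1) \<bullet> v) / x $ i $ i) *\<^sub>R (x *v axis i 1)" for v
    using assms(2) by (simp add: outer_mult_vec w_def field_simps)
  show "psd (x - outer w)"
    unfolding psd_def
  proof (intro conjI allI)
    show "transpose (x - outer w) = x - outer w" using sy by (simp add: transpose_diff)
    fix v
    define c where "c = (x *v axis i 1) \<bullet> v / x $ i $ i"
    have e1: "v \<bullet> (x *v axis i 1) = c * x $ i $ i" using assms(2) by (simp add: c_def inner_commute)
    have "axis i 1 \<bullet> (x *v v) = c * x $ i $ i" using e1 sym_inner[OF sy] by metis
    then have "(v - c *\<^sub>R axis i 1) \<bullet> (x *v (v - c *\<^sub>R axis i 1)) = v \<bullet> (x *v v) - c * (c * x $ i $ i)"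
      using e1 by (simp add: inner_diff_left inner_diff_right matrix_vector_mult_diff_distrib
        matrix_vector_mult_scaleR inner_axis_mult_axis)
    also have "\<dots> = v \<bullet> ((x - outer w) *v v)"
      using e1 by (simp add: matrix_vector_mult_diff_rdistrib inner_diff_right o c_def[symmetric])
    finally show "0 \<le> v \<bullet> ((x - outer w) *v v)" using psdD(2)[OF assms(1)] by metis
  qed
  have "(x *v axis i 1) \<bullet> axis i 1 = x $ i $ i"
    by (metis inner_axis_mult_axis inner_commute)
  then show "(x - outer w) *v axis i 1 = 0"
    using assms(2) by (simp add: matrix_vector_mult_diff_rdistrib o)
qed

text \<open>Partial Cholesky factorisation: only the rows in \<open>J\<close> are eliminated. With
  \<open>J = UNIV - {i}\<close> the remainder is concentrated at the entry (i, i), which yields a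
  column supported in row i.\<close>

lemma psd_cholesky:
  fixes x :: "real^'n^'n"
  assumes "finite J" "psd x"
  shows "\<exists>w. psd (x - (\<Sum>j\<in>J. outer (w j))) \<and> (\<forall>j\<in>J. \<forall>l. (x - (\<Sum>j\<in>J. outer (w j))) $ j $ l = 0)"
  using assms(1)
proof (induction J)
  case empty
  then show ?case using assms(2) by simp
next
  case (insert j J)
  then obtain w where w: "psd (x - (\<Sum>j\<in>J. outer (w j)))"
    and wz: "\<And>j l. j \<in> J \<Longrightarrow> (x - (\<Sum>j\<in>J. outer (w j))) $ j $ l = 0" by blast
  define y where "y = x - (\<Sum>j\<in>J. outer (w j))"
  \<comment> \<open>At a zero pivot row \<open>j\<close> of \<open>y\<close> vanishes already by
    \<open>psd_row_eq_0\<close>, so nothing has to be subtracted.\<close>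
  define z where "z = (if y $ j $ j = 0 then 0 else (1 / sqrt (y $ j $ j)) *\<^sub>R (y *v axis j 1))"
  have py: "psd y" using w by (simp add: y_def)
  have yz: "y $ a $ l = 0" if "a \<in> J" for a l using wz that by (simp add: y_def)
  have 1: "psd (y - outer z) \<and> (\<forall>l. (y - outer z) $ j $ l = 0)"
  proof (cases "y $ j $ j = 0")
    case True
    have "outer 0 = (0 :: real^'n^'n)" by (simp add: vec_eq_iff)
    with True show ?thesis using py psd_row_eq_0[OF py True] by (simp add: z_def)
  next
    case False
    then have "0 < y $ j $ j" using psd_diag_nonneg[OF py, of j] by simp
    note p = psd_pivot[OF py this]
    have z: "z = (1 / sqrt (y $ j $ j)) *\<^sub>R (y *v axis j 1)" using False by (simp add: z_def)
    note p' = p[folded z]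
    have "(y - outer z) $ j $ l = 0" for l
      using sym_nth[OF psdD(1)[OF p'(1)], of j l] p'(2) matrix_mult_axis_nth[of "y - outer z" j l]
      by (simp only: zero_index)
    with p'(1) show ?thesis by blast
  qed
  \<comment> \<open>\<open>z\<close> is a multiple of column \<open>j\<close> of \<open>y\<close>
    and so vanishes on \<open>J\<close>; the rows cleared earlier stay cleared.\<close>
  have 2: "(y - outer z) $ a $ l = 0" if "a \<in> J" for a l
    using yz[OF that] by (simp add: z_def matrix_mult_axis_nth)
  define w' where "w' = w(j := z)"
  have "(\<Sum>i\<in>insert j J. outer (w' i)) = outer z + (\<Sum>i\<in>J. outer (w i))"
    using insert.hyps by (simp add: w'_def) (rule sum.cong, auto)
  then have "x - (\<Sum>i\<in>insert j J. outer (w' i)) = y - outer z" by (simp add: y_def)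
  then show ?case using 1 2 by (intro exI[of _ w']) auto
qed

text \<open>Each pivot lowers the rank by at least one, so \<open>card K\<close> pivots exhaust
  \<open>x\<close>.\<close>

lemma psd_rank_decomposition:
  fixes x :: "real^'n^'n"
  assumes "finite K" "psd x" "rank x \<le> card K"
  shows "\<exists>w. x = (\<Sum>l\<in>K. outer (w l))"
  using assms
proof (induction K arbitrary: x)
  case empty
  then show ?case by (simp add: rank_eq_0)
next
  case (insert j K)
  show ?case
  proof (cases "\<exists>i. x $ i $ i \<noteq> 0")
    case False
    have "outer 0 = (0 :: real^'n^'n)" by (simp add: vec_eq_iff)
    moreover have "x = 0" using False psd_row_eq_0[OF insert.prems(1)] by (simp add: vec_eq_iff)
    ultimately show ?thesis by (intro exI[of _ "\<lambda>_. 0"]) simp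
  next
    case True
    then obtain i where i: "0 < x $ i $ i"
      using psd_diag_nonneg[OF insert.prems(1)] by (metis less_eq_real_def)
    define z where "z = (1 / sqrt (x $ i $ i)) *\<^sub>R (x *v axis i 1)"
    note p = psd_pivot[OF insert.prems(1) i, folded z_def]
    have zr: "z = x *v ((1 / sqrt (x $ i $ i)) *\<^sub>R axis i 1)" by (simp add: z_def matrix_vector_mult_scaleR)
    have eq: "(x - outer z) *v v = x *v (v - (z \<bullet> v) *\<^sub>R ((1 / sqrt (x $ i $ i)) *\<^sub>R axis i 1))" for v
      by (simp only: matrix_vector_mult_diff_distrib matrix_vector_mult_diff_rdistrib
          outer_mult_vec matrix_vector_mult_scaleR[of x "z \<bullet> v"] zr[symmetric])
    have sub: "range ((*v) (x - outer z)) \<subseteq> range ((*v) x)" using eq by auto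
    \<comment> \<open>Column \<open>i\<close> of the difference is zero, so by symmetry its range is
      orthogonal to \<open>axis i 1\<close>, whereas \<open>x *v axis i 1\<close> pairs with
      \<open>axis i 1\<close> to \<open>x $ i $ i > 0\<close>. The inclusion of ranges is therefore
      strict.\<close>
    have "x *v axis i 1 \<notin> range ((*v) (x - outer z))"
    proof
      assume "x *v axis i 1 \<in> range ((*v) (x - outer z))"
      then obtain v where v: "x *v axis i 1 = (x - outer z) *v v" by auto
      have "axis i 1 \<bullet> (x *v axis i 1) = v \<bullet> ((x - outer z) *v axis i 1)"
        unfolding v using sym_inner[OF psdD(1)[OF p(1)]] by blast
      then show False using i p(2) by (simp add: inner_axis_mult_axis)
    qed
    then have "range ((*v) (x - outer z)) \<subset> range ((*v) x)" using sub by blast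
    moreover have "span (range ((*v) (y :: real^'n^'n))) = range ((*v) y)" for y
      by (simp add: span_eq_iff linear_subspace_image)
    ultimately have "span (range ((*v) (x - outer z))) \<subset> span (range ((*v) x))"
      by metis
    then have "dim (range ((*v) (x - outer z))) < dim (range ((*v) x))"
      by (rule dim_psubset)
    then have "rank (x - outer z) < rank x" by (simp add: rank_dim_range)
    then have "rank (x - outer z) \<le> card K" using insert by simp
    from insert.IH[OF p(1) this] obtain w where w: "x - outer z = (\<Sum>l\<in>K. outer (w l))" by blast
    have "(\<Sum>l\<in>insert j K. outer ((w(j := z)) l)) = outer z + (\<Sum>l\<in>K. outer (w l))"
      using insert.hyps by simp (rule sum.cong, auto)
    also have "\<dots> = x" using w by (simp add: algebra_simps)
    finally show ?thesis by metis
  qed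
qed

lemma sum_mult_vec: "(\<Sum>i\<in>I. (A i :: real^'n^'m)) *v v = (\<Sum>i\<in>I. A i *v v)"
  by (induction I rule: infinite_finite_induct) (auto simp: matrix_vector_mult_add_rdistrib)

lemma rank_sum_outer_le:
  assumes "finite K"
  shows "rank (\<Sum>l\<in>K. outer (w l :: real^'n)) \<le> card K"
proof -
  have "range ((*v) (\<Sum>l\<in>K. outer (w l))) \<subseteq> span (w ` K)"
    unfolding sum_mult_vec outer_mult_vec
    by (intro image_subsetI span_sum span_scale span_base imageI)
  then have "rank (\<Sum>l\<in>K. outer (w l)) \<le> dim (w ` K)"
    by (metis rank_dim_range dim_span dim_subset)
  also have "\<dots> \<le> card K" using assms by (metis card_image_le dim_le_card' finite_imageI order_trans)
  finally show ?thesis .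
qed

lemma psd_decomposition:
  assumes "psd (x :: real^'n^'n)"
  obtains w :: "'n \<Rightarrow> real^'n" where "x = (\<Sum>l\<in>UNIV. outer (w l))"
  using psd_rank_decomposition[of "UNIV :: 'n set" x] assms rank_bound[of x] by auto

text \<open>The constant is the minimum of the form over the compact unit sphere.\<close>

lemma pd_coercive:
  fixes u :: "real^'n^'n"
  assumes "pd u"
  obtains c where "0 < c" "\<And>w. c * (norm w)\<^sup>2 \<le> w \<bullet> (u *v w)"
proof -
  have "\<exists>x\<in>sphere 0 1. \<forall>y\<in>sphere 0 1. x \<bullet> (u *v x) \<le> y \<bullet> (u *v y)"
    by (intro continuous_attains_inf continuous_intros compact_sphere
        linear_continuous_on linear_conv_bounded_linear[THEN iffD1])
      (auto intro: exI[of _ "axis i 1" for i])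
  then obtain x where x: "norm x = 1" and le: "\<And>y. norm y = 1 \<Longrightarrow> x \<bullet> (u *v x) \<le> y \<bullet> (u *v y)"
    by auto
  have "0 < x \<bullet> (u *v x)" using assms x by (intro pdD(2)) auto
  moreover have "x \<bullet> (u *v x) * (norm w)\<^sup>2 \<le> w \<bullet> (u *v w)" for w
  proof (cases "w = 0")
    case False
    have "x \<bullet> (u *v x) \<le> (w /\<^sub>R norm w) \<bullet> (u *v (w /\<^sub>R norm w))" using False by (intro le) simp
    also have "\<dots> = w \<bullet> (u *v w) / (norm w)\<^sup>2"
      by (simp add: matrix_vector_mult_scaleR power2_eq_square field_simps)
    finally show ?thesis using False by (simp add: field_simps)
  qed simp
  ultimately show thesis using that by blast
qed

text \<open>Splitting \<open>x\<close> into outer products reduces the bound to coercivity of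
  \<open>u\<close>. It provides the exponential decay on the cone behind the later uniform
  estimates.\<close>

lemma pd_inner_psd_ge:
  fixes u :: "real^'n^'n"
  assumes "pd u"
  obtains c where "0 < c" "\<And>x. psd x \<Longrightarrow> c * norm x \<le> u \<bullet> x"
proof -
  from pd_coercive[OF assms] obtain c where c: "0 < c" "\<And>w. c * (norm w)\<^sup>2 \<le> w \<bullet> (u *v w)" by blast
  have "c * norm x \<le> u \<bullet> x" if x: "psd x" for x
  proof -
    from psd_decomposition[OF x] obtain w :: "'n \<Rightarrow> real^'n" where w: "x = (\<Sum>l\<in>UNIV. outer (w l))" by blast
    have "c * norm x \<le> c * (\<Sum>l\<in>UNIV. (norm (w l))\<^sup>2)"
      using c(1) norm_sum[of "\<lambda>l. outer (w l)" UNIV] by (simp add: w norm_outer)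
    also have "\<dots> \<le> (\<Sum>l\<in>UNIV. w l \<bullet> (u *v w l))"
      unfolding sum_distrib_left by (intro sum_mono c(2))
    also have "\<dots> = u \<bullet> x" by (simp add: w inner_sum_right inner_outer)
    finally show ?thesis .
  qed
  with c(1) show thesis using that by blast
qed

lemma pd_perturb:
  fixes u v :: "real^'n^'n"
  assumes "pd u" "transpose v = v"
  obtains d where "0 < d" "\<And>s. \<bar>s\<bar> < d \<Longrightarrow> pd (u + s *\<^sub>R v)"
proof -
  from pd_coercive[OF assms(1)] obtain c where c: "0 < c" "\<And>w. c * (norm w)\<^sup>2 \<le> w \<bullet> (u *v w)" by blast
  \<comment> \<open>The summand 1 keeps the quotient positive when \<open>v = 0\<close>.\<close>
  define d where "d = c / (norm v + 1)"
  have "pd (u + s *\<^sub>R v)" if s: "\<bar>s\<bar> < d" for s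
    unfolding pd_def
  proof (intro conjI allI impI)
    show "transpose (u + s *\<^sub>R v) = u + s *\<^sub>R v"
      using assms by (simp add: transpose_add transpose_scalar pdD)
    fix w :: "real^'n" assume w: "w \<noteq> 0"
    have "\<bar>w \<bullet> (v *v w)\<bar> \<le> norm v * (norm w)\<^sup>2"
      using Cauchy_Schwarz_ineq2[of v "outer w"] by (simp add: inner_outer norm_outer)
    then have "\<bar>s * (w \<bullet> (v *v w))\<bar> \<le> \<bar>s\<bar> * (norm v * (norm w)\<^sup>2)"
      unfolding abs_mult by (intro mult_left_mono) auto
    also have "\<dots> \<le> \<bar>s\<bar> * ((norm v + 1) * (norm w)\<^sup>2)" by (intro mult_left_mono mult_right_mono) auto
    also have "\<dots> < c * (norm w)\<^sup>2"
    proof -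
      have "\<bar>s\<bar> * (norm v + 1) < c" using s by (simp add: d_def pos_less_divide_eq add_nonneg_pos)
      then have "\<bar>s\<bar> * (norm v + 1) * (norm w)\<^sup>2 < c * (norm w)\<^sup>2"
        using w by (intro mult_strict_right_mono) auto
      then show ?thesis by (simp only: mult.assoc)
    qed
    also have "\<dots> \<le> w \<bullet> (u *v w)" by (rule c(2))
    finally show "0 < w \<bullet> ((u + s *\<^sub>R v) *v w)"
      by (simp add: matrix_vector_mult_add_rdistrib inner_add_right scaleR_matrix_vector_assoc[symmetric])
  qed
  moreover have "0 < d" using c(1) by (simp add: d_def add_nonneg_pos)
  ultimately show thesis using that by blast
qed

section \<open>Inverses and determinants of positive definite matrices\<close>

lemma pd_invertible: "pd u \<Longrightarrow> invertible u"
  unfolding invertible_left_inverse matrix_left_invertible_ker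
  by (metis inner_zero_right less_irrefl pdD(2))

lemma matrix_inv_cancel:
  assumes "invertible u"
  shows "u ** matrix_inv u = mat 1" "matrix_inv u ** u = mat 1"
  using assms someI_ex[of "\<lambda>A'. u ** A' = mat 1 \<and> A' ** u = mat 1"]
  unfolding invertible_def matrix_inv_def by auto

lemma matrix_inv_unique:
  fixes u v :: "real^'n^'n"
  assumes "u ** v = mat 1"
  shows "matrix_inv u = v"
proof -
  have "invertible u" using assms invertible_right_inverse by blast
  then have "matrix_inv u ** (u ** v) = v"
    by (simp add: matrix_mul_assoc matrix_inv_cancel)
  then show ?thesis using assms by simp
qed

lemma pd_matrix_inv:
  assumes "pd u" shows "pd (matrix_inv u)" "matrix_inv (matrix_inv u) = u"
proof -
  note c = matrix_inv_cancel[OF pd_invertible[OF assms]]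
  show "matrix_inv (matrix_inv u) = u" using c by (intro matrix_inv_unique)
  have "u ** transpose (matrix_inv u) = mat 1"
    using c(2) by (metis assms matrix_transpose_mul pdD(1) transpose_mat)
  then have "transpose (matrix_inv u) = matrix_inv u" by (metis matrix_inv_unique)
  moreover have "0 < v \<bullet> (matrix_inv u *v v)" if "v \<noteq> 0" for v
  proof -
    have e: "u *v (matrix_inv u *v v) = v" by (simp add: matrix_vector_mul_assoc c)
    with that have "matrix_inv u *v v \<noteq> 0" by (metis matrix_vector_mult_0_right)
    from pdD(2)[OF assms this] show ?thesis by (simp add: e inner_commute)
  qed
  ultimately show "pd (matrix_inv u)" by (simp add: pd_def)
qed

lemma continuous_on_det:
  fixes f :: "'a::topological_space \<Rightarrow> real^'n^'n"
  assumes "continuous_on S f"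
  shows "continuous_on S (\<lambda>x. det (f x))"
  unfolding det_def by (intro continuous_intros assms)

text \<open>All matrices on the segment from the identity to \<open>u\<close> are positive definite,
  hence invertible, so the determinant cannot change sign along it.\<close>

lemma pd_det_pos:
  fixes u :: "real^'n^'n"
  assumes "pd u" shows "0 < det u"
proof (rule ccontr)
  assume neg: "\<not> 0 < det u"
  define f where "f s = det ((1 - s) *\<^sub>R mat 1 + s *\<^sub>R u)" for s :: real
  have "\<exists>s\<ge>0. s \<le> 1 \<and> f s = 0"
    unfolding f_def using neg
    by (intro IVT2' continuous_on_det continuous_intros) auto
  then obtain s where s: "0 \<le> s" "s \<le> 1" "f s = 0" by blast
  have "pd ((1 - s) *\<^sub>R mat 1 + s *\<^sub>R u)"
  proof (cases "s = 1")
    case False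
    then show ?thesis using s assms by (intro pd_add_psd pd_scaleR psd_scaleR pd_imp_psd) auto
  qed (use assms in simp)
  then show False using pd_invertible s(3) by (auto simp: f_def invertible_det_nz)
qed

text \<open>The Sherman-Morrison formula and the matrix determinant lemma. They express an increment
  of \<open>w\<close> in one diagonal direction explicitly through \<open>u\<close>.\<close>

lemma pd_rank_one_update:
  fixes w :: "real^'n^'n"
  assumes "pd w" "0 \<le> c"
  defines "u \<equiv> matrix_inv w"
  shows "matrix_inv (w + c *\<^sub>R outer (axis i 1)) = u - (c / (1 + c * u $ i $ i)) *\<^sub>R outer (u *v axis i 1)"
    and "det (w + c *\<^sub>R outer (axis i 1)) = (1 + c * u $ i $ i) * det w"
proof -
  let ?e = "axis i 1 :: real^'n"
  note cc = matrix_inv_cancel[OF pd_invertible[OF assms(1)], folded u_def]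
  have pu: "pd u" unfolding u_def by (rule pd_matrix_inv[OF assms(1)])
  have "0 \<le> u $ i $ i" by (rule psd_diag_nonneg[OF pd_imp_psd[OF pu]])
  then have nz: "1 + c * u $ i $ i \<noteq> 0" using assms(2)
    by (metis add_nonneg_eq_0_iff mult_nonneg_nonneg zero_le_one zero_neq_one)
  show "matrix_inv (w + c *\<^sub>R outer ?e) = u - (c / (1 + c * u $ i $ i)) *\<^sub>R outer (u *v ?e)"
  proof (rule matrix_inv_unique, subst matrix_eq, intro allI)
    fix v
    define s where "s = ?e \<bullet> (u *v v)"
    define k where "k = c / (1 + c * u $ i $ i)"
    have s: "(u *v ?e) \<bullet> v = s" unfolding s_def by (metis inner_commute sym_inner pdD(1) pu)
    have w1: "w *v (u *v y) = y" for y by (simp add: matrix_vector_mul_assoc cc)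
    have k: "k * (1 + c * u $ i $ i) = c" using nz by (simp add: k_def)
    have uv: "(u - k *\<^sub>R outer (u *v ?e)) *v v = u *v v - (k * s) *\<^sub>R (u *v ?e)"
      by (simp add: matrix_vector_mult_diff_rdistrib scaleR_matrix_vector_assoc[symmetric] outer_mult_vec s)
    have "(w + c *\<^sub>R outer ?e) *v (u *v v - (k * s) *\<^sub>R (u *v ?e))
        = v - (k * s) *\<^sub>R ?e + (c * (s - k * s * u $ i $ i)) *\<^sub>R ?e"
      by (simp add: matrix_vector_mult_add_rdistrib matrix_vector_mult_diff_distrib w1
          matrix_vector_mult_scaleR scaleR_matrix_vector_assoc[symmetric] outer_mult_vec
          inner_diff_right inner_axis_mult_axis s_def[symmetric] algebra_simps)
    also have "\<dots> = v + (s * (c - k * (1 + c * u $ i $ i))) *\<^sub>R ?e"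
      by (simp add: algebra_simps)
    also have "\<dots> = v" by (simp add: k)
    finally show "((w + c *\<^sub>R outer ?e) ** (u - (c / (1 + c * u $ i $ i)) *\<^sub>R outer (u *v ?e))) *v v = mat 1 *v v"
      by (simp add: matrix_vector_mul_assoc[symmetric] k_def[symmetric] uv)
  qed
  \<comment> \<open>The update changes only column \<open>i\<close>, and the new column is
    \<open>w\<close> applied to e_i + c u e_i. Cramer's rule then yields the determinant as
    coordinate \<open>i\<close> of that vector times \<open>det w\<close>.\<close>
  have "w + c *\<^sub>R outer ?e = (\<chi> a j. if j = i then (w *v (?e + c *\<^sub>R (u *v ?e))) $ a else w $ a $ j)"
  proof -
    have "w *v (?e + c *\<^sub>R (u *v ?e)) = w *v ?e + c *\<^sub>R ?e"
      by (simp add: matrix_vector_right_distrib matrix_vector_mult_scaleR matrix_vector_mul_assoc cc)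
    then have "(w *v (?e + c *\<^sub>R (u *v ?e))) $ a = w $ a $ i + c * ?e $ a" for a
      by (simp add: matrix_mult_axis_nth)
    then show ?thesis by (simp add: vec_eq_iff axis_def)
  qed
  then have "det (w + c *\<^sub>R outer ?e) = (?e + c *\<^sub>R (u *v ?e)) $ i * det w"
    by (simp only: cramer_lemma)
  then show "det (w + c *\<^sub>R outer ?e) = (1 + c * u $ i $ i) * det w"
    by (simp add: matrix_mult_axis_nth)
qed

lemma norm_matrix_mult_le: "norm (A ** B) \<le> norm (A :: real^'n^'n) * norm (B :: real^'n^'n)"
proof -
  have nn: "(norm M)\<^sup>2 = (\<Sum>i\<in>UNIV. \<Sum>j\<in>UNIV. (M $ i $ j)\<^sup>2)" for M :: "real^'n^'n"
    unfolding power2_norm_eq_inner by (simp add: inner_vec_def power2_eq_square)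
  have "(norm (A ** B))\<^sup>2 = (\<Sum>i\<in>UNIV. \<Sum>j\<in>UNIV. (\<Sum>k\<in>UNIV. A $ i $ k * B $ k $ j)\<^sup>2)"
    by (simp add: nn matrix_matrix_mult_def)
  also have "\<dots> \<le> (\<Sum>i\<in>UNIV. \<Sum>j\<in>UNIV. (\<Sum>k\<in>UNIV. (A $ i $ k)\<^sup>2) * (\<Sum>k\<in>UNIV. (B $ k $ j)\<^sup>2))"
    by (intro sum_mono Cauchy_Schwarz_ineq_sum)
  also have "\<dots> = (\<Sum>i\<in>UNIV. \<Sum>k\<in>UNIV. (A $ i $ k)\<^sup>2) * (\<Sum>j\<in>UNIV. \<Sum>k\<in>UNIV. (B $ k $ j)\<^sup>2)"
    by (simp add: sum_product)
  also have "(\<Sum>j\<in>UNIV. \<Sum>k\<in>UNIV. (B $ k $ j)\<^sup>2) = (norm B)\<^sup>2"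
    unfolding nn by (rule sum.swap)
  also have "(\<Sum>i\<in>UNIV. \<Sum>k\<in>UNIV. (A $ i $ k)\<^sup>2) * (norm B)\<^sup>2 = (norm A * norm B)\<^sup>2"
    by (simp add: nn power_mult_distrib)
  finally show ?thesis by (simp add: power2_le_iff_abs_le)
qed


section \<open>Closedness of the sets \<open>Dpk k\<close>\<close>

lemma closed_if_closed_Int_cball:
  fixes S :: "'a::real_normed_vector set"
  assumes "\<And>r. closed (S \<inter> cball 0 r)"
  shows "closed S"
  unfolding closed_sequential_limits
proof (intro allI impI, elim conjE)
  fix x l assume x: "\<forall>n. x n \<in> S" and l: "x \<longlonglongrightarrow> l"
  obtain r where r: "\<And>n. norm (x n) \<le> r"
    using convergent_imp_bounded[OF l] by (auto simp: bounded_iff)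
  then have "\<forall>n. x n \<in> S \<inter> cball 0 r" using x by simp
  then show "l \<in> S" using assms[of r] l unfolding closed_sequential_limits by blast
qed

lemma obtain_card_UNIV:
  assumes "k \<le> CARD('n::finite)"
  obtains K :: "'n::finite set" where "card K = k"
  using obtain_subset_with_card_n[OF assms] by metis

text \<open>The vectors of a factor are stored as rows indexed by a subset \<open>K\<close> of the
  index type, so factors for all ranks are square matrices of one type and only the support
  condition depends on \<open>k\<close>.\<close>

lemma Dpk_eq_sum_outer:
  assumes "card (K :: 'n::finite set) = k"
  shows "(Dpk k :: (real^'n^'n) set) = (\<lambda>W. \<Sum>l\<in>UNIV. outer (W $ l)) ` {W. \<forall>l. l \<notin> K \<longrightarrow> W $ l = 0}"
    (is "_ = ?f ` ?W")
proof (intro set_eqI iffI)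
  have eq: "?f W = (\<Sum>l\<in>K. outer (W $ l))" if "W \<in> ?W" for W :: "real^'n^'n"
  proof (rule sum.mono_neutral_right)
    show "\<forall>l\<in>UNIV - K. outer (W $ l) = 0" using that by (simp add: outer_def vec_eq_iff)
  qed simp_all
  fix x :: "real^'n^'n"
  {
    assume "x \<in> Dpk k"
    then obtain w where w: "x = (\<Sum>l\<in>K. outer (w l))"
      using psd_rank_decomposition[of K x] assms by (auto simp: Dpk_def)
    let ?V = "\<chi> l. if l \<in> K then w l else 0"
    have "x = ?f ?V" by (subst eq) (auto simp: w)
    then show "x \<in> ?f ` ?W" by (intro image_eqI[of _ _ ?V]) auto
  next
    assume "x \<in> ?f ` ?W"
    then obtain W where W: "W \<in> ?W" "x = ?f W" by blast
    then have "x = (\<Sum>l\<in>K. outer (W $ l))" using eq by simp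
    then show "x \<in> Dpk k" using rank_sum_outer_le[of K "\<lambda>l. W $ l"] assms
      by (auto simp: Dpk_def intro: psd_sum)
  }
qed

text \<open>The factorisation map is proper: the trace of the product is the squared norm of the
  factor. Hence the part of \<open>Dpk k\<close> in a ball is a continuous image of a compact
  set.\<close>

lemma closed_Dpk:
  assumes "k \<le> CARD('n::finite)"
  shows "closed (Dpk k :: (real^'n^'n) set)"
proof (rule closed_if_closed_Int_cball)
  fix r :: real
  obtain K :: "'n set" where K: "card K = k" using obtain_card_UNIV[OF assms] .
  let ?f = "\<lambda>W :: real^'n^'n. \<Sum>l\<in>UNIV. outer (W $ l)"
  let ?W = "{W :: real^'n^'n. \<forall>l. l \<notin> K \<longrightarrow> W $ l = 0}"
  let ?S = "?W \<inter> {W. norm (?f W) \<le> r}"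
  have co: "continuous_on UNIV ?f"
    unfolding outer_def by (intro continuous_intros)
  have "?W = (\<Inter>l\<in>-K. {W. W $ l = 0})" by auto
  moreover have "closed (\<Inter>l\<in>-K. {W :: real^'n^'n. W $ l = 0})"
    by (intro closed_INT ballI closed_Collect_eq continuous_intros)
  ultimately have "closed ?W" by (simp only:)
  moreover have "closed {W. norm (?f W) \<le> r}"
    by (intro closed_Collect_le continuous_intros co)
  moreover have "bounded ?S"
    unfolding bounded_iff
  proof (intro exI ballI)
    fix W assume "W \<in> ?S"
    then have "norm (?f W) \<le> r" by simp
    have "(norm W)\<^sup>2 = (mat 1 :: real^'n^'n) \<bullet> ?f W"
      unfolding power2_norm_eq_inner inner_sum_right inner_outer matrix_vector_mul_lid
      by (simp add: inner_vec_def)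
    also have "\<dots> \<le> norm (mat 1 :: real^'n^'n) * r"
      using norm_cauchy_schwarz[of "mat 1" "?f W"] \<open>norm (?f W) \<le> r\<close>
      by (meson mult_left_mono norm_ge_zero order_trans)
    finally show "norm W \<le> sqrt (norm (mat 1 :: real^'n^'n) * r)" by (rule real_le_rsqrt)
  qed
  ultimately have "compact ?S" using compact_eq_bounded_closed by blast
  then have "compact (?f ` ?S)" by (rule compact_continuous_image[OF continuous_on_subset[OF co], rotated]) simp
  moreover have "?f ` ?S = Dpk k \<inter> cball 0 r" unfolding Dpk_eq_sum_outer[OF K] by auto
  ultimately show "closed (Dpk k \<inter> cball 0 r :: (real^'n^'n) set)" by (metis compact_imp_closed)
qed

section \<open>Functions vanishing at infinity\<close>

lemma psd_norm_le_trace: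
  assumes "psd (x :: real^'n^'n)"
  shows "norm x \<le> mat 1 \<bullet> x"
proof -
  from psd_decomposition[OF assms] obtain w :: "'n \<Rightarrow> real^'n" where w: "x = (\<Sum>l\<in>UNIV. outer (w l))" by blast
  have "norm x \<le> (\<Sum>l\<in>UNIV. (norm (w l))\<^sup>2)"
    using norm_sum[of "\<lambda>l. outer (w l)" UNIV] by (simp add: w norm_outer)
  also have "\<dots> = mat 1 \<bullet> x"
    by (simp add: w inner_sum_right inner_outer power2_norm_eq_inner)
  finally show ?thesis .
qed

lemma fexp_eq:
  assumes "D \<subseteq> Collect psd"
  shows "fexp D u = (\<lambda>x. if x \<in> D then exp (- (u \<bullet> x)) else 0)"
  using assms by (auto simp: fexp_def fun_eq_iff trace_mult_eq_inner psdD)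

lemma C0_lincomb:
  assumes "f \<in> C0 D" "g \<in> C0 D"
  shows "(\<lambda>x. a * f x + g x) \<in> C0 D"
  unfolding C0_def
proof (intro CollectI conjI allI impI)
  show "continuous_on D (\<lambda>x. a * f x + g x)"
    using assms by (intro continuous_intros) (auto simp: C0_def)
  show "a * f x + g x = 0" if "x \<notin> D" for x using assms that by (simp add: C0_def)
  fix e :: real assume e: "0 < e"
  define e' where "e' = e / (\<bar>a\<bar> + 1)"
  have e': "0 < e'" using e by (simp add: e'_def add_nonneg_pos)
  obtain r where r: "\<And>x. x \<in> D \<Longrightarrow> r \<le> norm x \<Longrightarrow> \<bar>f x\<bar> < e'"
    using assms(1) e' unfolding C0_def by blast
  obtain s where s: "\<And>x. x \<in> D \<Longrightarrow> s \<le> norm x \<Longrightarrow> \<bar>g x\<bar> < e'"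
    using assms(2) e' unfolding C0_def by blast
  show "\<exists>r. \<forall>x\<in>D. r \<le> norm x \<longrightarrow> \<bar>a * f x + g x\<bar> < e"
  proof (intro exI[of _ "max r s"] ballI impI)
    fix x assume x: "x \<in> D" "max r s \<le> norm x"
    then have "\<bar>f x\<bar> < e'" "\<bar>g x\<bar> < e'" using r s by auto
    have "\<bar>a * f x + g x\<bar> \<le> \<bar>a\<bar> * \<bar>f x\<bar> + \<bar>g x\<bar>" by (metis abs_mult abs_triangle_ineq)
    also have "\<dots> \<le> \<bar>a\<bar> * e' + \<bar>g x\<bar>" using \<open>\<bar>f x\<bar> < e'\<close> by (intro add_right_mono mult_left_mono) auto
    also have "\<dots> < \<bar>a\<bar> * e' + e'" using \<open>\<bar>g x\<bar> < e'\<close> by simp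
    also have "\<dots> = (\<bar>a\<bar> + 1) * e'" by (simp add: distrib_right)
    also have "\<dots> = e" by (simp add: e'_def add_nonneg_eq_0_iff)
    finally show "\<bar>a * f x + g x\<bar> < e" .
  qed
qed

lemma C0_zero: "(\<lambda>x. 0) \<in> C0 D"
  by (auto simp: C0_def)

lemma C0_bounded:
  fixes f :: "'a::euclidean_space \<Rightarrow> real"
  assumes "closed D" "f \<in> C0 D"
  obtains B where "0 \<le> B" "\<And>x. \<bar>f x\<bar> \<le> B"
proof -
  obtain r where r: "\<And>x. x \<in> D \<Longrightarrow> r \<le> norm x \<Longrightarrow> \<bar>f x\<bar> < 1"
    using assms(2) zero_less_one unfolding C0_def by blast
  have "compact (D \<inter> cball 0 r)" using assms(1) by (intro closed_Int_compact compact_cball)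
  moreover have "continuous_on (D \<inter> cball 0 r) f"
    using assms(2) continuous_on_subset[of D f "D \<inter> cball 0 r"] by (simp add: C0_def)
  ultimately have "bounded (f ` (D \<inter> cball 0 r))"
    by (intro compact_imp_bounded compact_continuous_image)
  then obtain M where M: "\<And>x. x \<in> D \<Longrightarrow> norm x \<le> r \<Longrightarrow> \<bar>f x\<bar> \<le> M"
    unfolding bounded_iff by force
  have "\<bar>f x\<bar> \<le> max M 1" for x
  proof (cases "x \<in> D")
    case True
    then show ?thesis using r[of x] M[of x] by (cases "norm x \<le> r") auto
  next
    case False
    then show ?thesis using assms(2) by (auto simp: C0_def)
  qed
  then show thesis using that[of "max M 1"] by auto
qed

lemma C0_uniform_limit:
  assumes z: "\<And>x. x \<notin> D \<Longrightarrow> f x = 0"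
    and g: "\<And>e. 0 < e \<Longrightarrow> \<exists>g\<in>C0 D. \<forall>x\<in>D. \<bar>f x - g x\<bar> \<le> e"
  shows "f \<in> C0 D"
  unfolding C0_def
proof (intro CollectI conjI allI impI z)
  show "continuous_on D f"
    unfolding continuous_on_iff
  proof (intro ballI allI impI)
    fix x e assume x: "x \<in> D" and e: "0 < (e :: real)"
    obtain h where h: "h \<in> C0 D" "\<And>x. x \<in> D \<Longrightarrow> \<bar>f x - h x\<bar> \<le> e / 3" using g[of "e/3"] e by auto
    then have "continuous_on D h" by (simp add: C0_def)
    then obtain d where d: "d > 0" "\<And>y. y \<in> D \<Longrightarrow> dist y x < d \<Longrightarrow> dist (h y) (h x) < e / 3"
      unfolding continuous_on_iff using x e by (metis zero_less_divide_iff zero_less_numeral)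
    show "\<exists>d>0. \<forall>x'\<in>D. dist x' x < d \<longrightarrow> dist (f x') (f x) < e"
    proof (intro exI[of _ d] conjI ballI impI)
      fix y assume y: "y \<in> D" "dist y x < d"
      show "dist (f y) (f x) < e" using h(2)[OF x] h(2)[OF y(1)] d(2)[OF y]
        unfolding dist_real_def by linarith
    qed (rule d)
  qed
  fix e :: real assume e: "0 < e"
  obtain h where h: "h \<in> C0 D" "\<And>x. x \<in> D \<Longrightarrow> \<bar>f x - h x\<bar> \<le> e / 2" using g[of "e/2"] e by auto
  then obtain r where r: "\<And>x. x \<in> D \<Longrightarrow> r \<le> norm x \<Longrightarrow> \<bar>h x\<bar> < e / 2"
    using e unfolding C0_def by (blast dest: half_gt_zero)
  have "\<bar>f x\<bar> < e" if "x \<in> D" "r \<le> norm x" for x using h(2)[of x] r[of x] that by linarith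
  then show "\<exists>r. \<forall>x\<in>D. r \<le> norm x \<longrightarrow> \<bar>f x\<bar> < e" by blast
qed

section \<open>Decay of polynomials times exponentials\<close>

lemma poly_exp_bounded:
  assumes "0 < (c :: real)"
  obtains B where "0 < B" "\<And>r. 0 \<le> r \<Longrightarrow> (1 + r) ^ N * exp (- (c * r)) \<le> B"
proof -
  \<comment> \<open>\<open>Suc N\<close> is a positive exponent by which one can divide.
    \<open>K\<close> is made for 1 + r <= K (1 + c r / M); after that 1 + z <= exp z, raised to the
    power \<open>M\<close>, absorbs the polynomial.\<close>
  define M where "M = Suc N"
  define K where "K = 1 + M / c"
  have K: "1 \<le> K" using assms by (simp add: K_def)
  have "(1 + r) ^ N * exp (- (c * r)) \<le> K ^ M" if r: "0 \<le> r" for r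
  proof -
    have "(1 + r) ^ N \<le> (1 + r) ^ M" using r by (intro power_increasing) (auto simp: M_def)
    also have "1 + r \<le> K * (1 + c * r / M)"
    proof -
      have m: "0 < real M" by (simp add: M_def)
      have "K * (1 + c * r / M) = 1 + r + (M / c + c * r / M)"
        using assms m by (simp add: K_def distrib_left distrib_right add_divide_distrib)
      then show ?thesis using assms m r by simp
    qed
    then have "(1 + r) ^ M \<le> (K * (1 + c * r / M)) ^ M" using r by (intro power_mono) auto
    also have "\<dots> = K ^ M * (1 + c * r / M) ^ M" by (simp add: power_mult_distrib)
    also have "\<dots> \<le> K ^ M * exp (c * r / M) ^ M"
      using K assms r by (intro mult_left_mono power_mono) auto
    also have "exp (c * r / M) ^ M = exp (c * r)"
    proof -
      have "real M \<noteq> 0" by (simp add: M_def)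
      then show ?thesis by (simp add: exp_of_nat_mult[symmetric])
    qed
    finally have "(1 + r) ^ N * exp (- (c * r)) \<le> K ^ M * exp (c * r) * exp (- (c * r))"
      by (intro mult_right_mono) auto
    then show ?thesis by (simp add: mult.assoc mult_exp_exp)
  qed
  then show thesis using K by (intro that[of "K ^ M"]) auto
qed

lemma C0_poly_exp:
  fixes u :: "real^'n^'n"
  assumes D: "D \<subseteq> Collect psd" and u: "pd u" and q: "continuous_on D q"
    and b: "\<And>x. x \<in> D \<Longrightarrow> \<bar>q x\<bar> \<le> C * (1 + norm x) ^ N"
  shows "(\<lambda>x. if x \<in> D then q x * exp (- (u \<bullet> x)) else 0) \<in> C0 D"
  unfolding C0_def
proof (intro CollectI conjI allI impI)
  show "continuous_on D (\<lambda>x. if x \<in> D then q x * exp (- (u \<bullet> x)) else 0)"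
    by (rule continuous_on_eq[of D "\<lambda>x. q x * exp (- (u \<bullet> x))"]) (intro continuous_intros q, simp)
  fix e :: real assume e: "0 < e"
  from pd_inner_psd_ge[OF u] obtain c where c: "0 < c" "\<And>x. psd x \<Longrightarrow> c * norm x \<le> u \<bullet> x" by blast
  \<comment> \<open>Exponent \<open>Suc N\<close> instead of \<open>N\<close> leaves a spare factor
    1 + norm x, which turns boundedness into decay and determines the radius below.\<close>
  from poly_exp_bounded[OF c(1), of "Suc N"] obtain B where
    B: "0 < B" "\<And>r. 0 \<le> r \<Longrightarrow> (1 + r) ^ Suc N * exp (- (c * r)) \<le> B" by blast
  show "\<exists>r. \<forall>x\<in>D. r \<le> norm x \<longrightarrow> \<bar>if x \<in> D then q x * exp (- (u \<bullet> x)) else 0\<bar> < e"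
  proof (intro exI[of _ "\<bar>C\<bar> * B / e"] ballI impI)
    fix x assume x: "x \<in> D" "\<bar>C\<bar> * B / e \<le> norm x"
    have "c * norm x \<le> u \<bullet> x" using c(2) D x by auto
    then have "\<bar>q x\<bar> * exp (- (u \<bullet> x)) \<le> (\<bar>C\<bar> * (1 + norm x) ^ N) * exp (- (c * norm x))"
      by (intro mult_mono order_trans[OF b[OF x(1)]]) (auto intro: mult_right_mono)
    also have "(1 + norm x) * \<dots> \<le> \<bar>C\<bar> * B"
      using mult_left_mono[OF B(2)[of "norm x"], of "\<bar>C\<bar>"] by (simp add: ac_simps)
    then have "\<bar>C\<bar> * (1 + norm x) ^ N * exp (- (c * norm x)) \<le> \<bar>C\<bar> * B / (1 + norm x)"
      by (simp add: field_simps add_pos_nonneg)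
    also have "\<dots> < e"
      using x(2) e by (simp add: field_simps add_pos_nonneg)
    finally show "\<bar>if x \<in> D then q x * exp (- (u \<bullet> x)) else 0\<bar> < e"
      using x(1) by (simp add: abs_mult)
  qed
qed auto

lemma fexp_in_C0:
  assumes "D \<subseteq> Collect psd" "pd u"
  shows "fexp D u \<in> C0 D"
  using C0_poly_exp[OF assms, of "\<lambda>_. 1" 1 0]
  by (simp add: fexp_eq[OF assms(1)] cong: if_cong)

lemma abs_exp_minus_one_le: "\<bar>exp z - 1\<bar> \<le> \<bar>z\<bar> * exp \<bar>z :: real\<bar>"
proof -
  have "exp z * (1 - z) \<le> exp z * exp (- z)"
    using exp_ge_add_one_self[of "- z"] by (intro mult_left_mono) auto
  then have 1: "exp z - 1 \<le> z * exp z" by (simp add: mult_exp_exp algebra_simps)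
  have 2: "z \<le> exp z - 1" using exp_ge_add_one_self[of z] by linarith
  show ?thesis
  proof (cases "0 \<le> z")
    case True
    then show ?thesis using 1 2 by simp
  next
    case False
    then have "\<bar>z\<bar> * 1 \<le> \<bar>z\<bar> * exp \<bar>z\<bar>" by (intro mult_left_mono) auto
    moreover have "exp z \<le> 1" using False by simp
    ultimately show ?thesis using 2 False by linarith
  qed
qed

lemma abs_exp_minus_linear_le: "\<bar>exp z - 1 - z\<bar> \<le> z\<^sup>2 * exp \<bar>z :: real\<bar>"
proof -
  have "exp z * (1 - z) \<le> exp z * exp (- z)"
    using exp_ge_add_one_self[of "- z"] by (intro mult_left_mono) auto
  then have "exp z - 1 - z \<le> z * (exp z - 1)" by (simp add: mult_exp_exp algebra_simps)
  also have "\<dots> \<le> \<bar>z\<bar> * (\<bar>z\<bar> * exp \<bar>z\<bar>)"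
    using mult_left_mono[OF abs_exp_minus_one_le[of z], of "\<bar>z\<bar>"] by (simp add: abs_mult[symmetric])
  also have "\<dots> = z\<^sup>2 * exp \<bar>z\<bar>" by (simp add: power2_eq_square)
  finally show ?thesis using exp_ge_add_one_self[of z] by linarith
qed

text \<open>Exponential decay of the weight turns a pointwise derivative with polynomially growing
  error into a uniform one.\<close>

lemma exp_family_uniform_derivative:
  fixes u v x0 :: "real^'n^'n" and U :: "real \<Rightarrow> real^'n^'n"
  assumes u: "pd u" and d0: "0 < d0" and C: "0 \<le> C"
    and U: "\<And>s. 0 < s \<Longrightarrow> s < d0 \<Longrightarrow> norm (U s - u - s *\<^sub>R v) \<le> C * s\<^sup>2"
    and q: "\<And>e. 0 < e \<Longrightarrow> \<exists>d>0. \<forall>s. 0 < s \<and> s < d \<longrightarrow>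
       (\<forall>x. psd x \<longrightarrow> \<bar>q s x - q0 x - s * q1 x\<bar> \<le> e * s * (1 + norm x) ^ N)"
    and b0: "\<And>x. psd x \<Longrightarrow> \<bar>q0 x\<bar> \<le> K * (1 + norm x) ^ N"
    and b1: "\<And>x. psd x \<Longrightarrow> \<bar>q1 x\<bar> \<le> K * (1 + norm x) ^ N"
    and e: "0 < e"
  shows "\<exists>d>0. \<forall>s. 0 < s \<and> s < d \<longrightarrow> (\<forall>x. psd x \<longrightarrow>
     \<bar>q s x * exp (- (U s \<bullet> (x - x0))) - q0 x * exp (- (u \<bullet> (x - x0)))
       - s * ((q1 x - (v \<bullet> (x - x0)) * q0 x) * exp (- (u \<bullet> (x - x0))))\<bar> \<le> e * s)"
proof -
  have K: "0 \<le> K" using b0[of 0] by simp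
  from pd_inner_psd_ge[OF u] obtain c where c: "0 < c" "\<And>x. psd x \<Longrightarrow> c * norm x \<le> u \<bullet> x" by blast
  \<comment> \<open>Half of the decay rate is held back to absorb the factor exp |z| caused by
    moving the exponent. The two extra powers of 1 + norm x come from the second-order
    remainder.\<close>
  have "0 < c / 2" using c by simp
  from poly_exp_bounded[OF this, of "N + 2"] obtain B where
    B: "0 < B" "\<And>r. 0 \<le> r \<Longrightarrow> (1 + r) ^ (N + 2) * exp (- (c / 2 * r)) \<le> B" by blast
  define M where "M = 1 + norm x0"
  define V where "V = (norm v + C * d0) * M"
  define L where "L = K * V + K * V\<^sup>2 + K * (C * M)"
  define B' where "B' = B * exp (c / 2 + u \<bullet> x0)"
  have B': "0 < B'" using B by (simp add: B'_def)
  have M: "1 \<le> M" by (simp add: M_def)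
  have V: "0 \<le> V" using C d0 M by (simp add: V_def)
  have L: "0 \<le> L" using K V C M by (simp add: L_def)
  have "0 < e / (2 * B')" using e B' by simp
  from q[OF this] obtain d1 where d1: "0 < d1" "\<And>s x. 0 < s \<Longrightarrow> s < d1 \<Longrightarrow> psd x \<Longrightarrow>
      \<bar>q s x - q0 x - s * q1 x\<bar> \<le> e / (2 * B') * s * (1 + norm x) ^ N" by blast
  \<comment> \<open>The first two entries are the ranges of the hypotheses; the third ensures s V <=
    c / 2 and the fourth s L <= e / (2 B').\<close>
  define d where "d = Min {d0, d1, c / (2 * (V + 1)), e / (2 * B' * (L + 1))}"
  have "0 < d" using d0 d1 c e B' V L by (simp add: d_def)
  moreover have "\<bar>q s x * exp (- (U s \<bullet> (x - x0))) - q0 x * exp (- (u \<bullet> (x - x0)))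
       - s * ((q1 x - (v \<bullet> (x - x0)) * q0 x) * exp (- (u \<bullet> (x - x0))))\<bar> \<le> e * s"
    if s: "0 < s" "s < d" and x: "psd x" for s x
  proof -
    have sd: "s < d0" "s < d1" "s < c / (2 * (V + 1))" "s < e / (2 * B' * (L + 1))"
      using s(2) by (auto simp: d_def)
    define y where "y = x - x0"
    define \<rho> where "\<rho> = 1 + norm x"
    have \<rho>: "1 \<le> \<rho>" by (simp add: \<rho>_def)
    \<comment> \<open>\<open>z\<close> is the change of the exponent: the perturbed weight is
      \<open>exp z\<close> times the original one.\<close>
    define z where "z = - ((U s - u) \<bullet> y)"
    have "norm y \<le> norm x + norm x0" unfolding y_def by (rule norm_triangle_ineq4)
    also have "\<dots> \<le> M * \<rho>" by (simp add: M_def \<rho>_def algebra_simps)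
    finally have ny: "norm y \<le> M * \<rho>" .
    have "norm (U s - u) \<le> norm (U s - u - s *\<^sub>R v) + norm (s *\<^sub>R v)"
      using norm_triangle_ineq[of "U s - u - s *\<^sub>R v" "s *\<^sub>R v"] by simp
    also have "\<dots> \<le> C * s\<^sup>2 + s * norm v" using U[OF s(1) sd(1)] s by simp
    also have "\<dots> \<le> s * (norm v + C * d0)"
      using mult_left_mono[of s d0 "s * C"] s sd C by (simp add: power2_eq_square algebra_simps)
    finally have nU: "norm (U s - u) \<le> s * (norm v + C * d0)" .
    have "\<bar>z\<bar> \<le> norm (U s - u) * norm y" unfolding z_def by (metis abs_minus Cauchy_Schwarz_ineq2)
    also have "\<dots> \<le> (s * (norm v + C * d0)) * (M * \<rho>)"
      using nU ny s C d0 by (intro mult_mono) auto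
    finally have z: "\<bar>z\<bar> \<le> s * V * \<rho>" by (simp add: V_def ac_simps)
    have "z + s * (v \<bullet> y) = - ((U s - u - s *\<^sub>R v) \<bullet> y)"
      by (simp add: z_def inner_diff_left)
    then have "\<bar>z + s * (v \<bullet> y)\<bar> \<le> norm (U s - u - s *\<^sub>R v) * norm y"
      by (metis abs_minus Cauchy_Schwarz_ineq2)
    also have "\<dots> \<le> (C * s\<^sup>2) * (M * \<rho>)"
      using U[OF s(1) sd(1)] ny C by (intro mult_mono) auto
    finally have zl: "\<bar>z + s * (v \<bullet> y)\<bar> \<le> (C * s\<^sup>2) * (M * \<rho>)" .
    define E where "E = exp (s * V * \<rho>)"
    have E1: "1 \<le> E" using s V \<rho> by (simp add: E_def)
    have Ez: "exp \<bar>z\<bar> \<le> E" using z by (simp add: E_def)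
    have E0: "exp z \<le> E" using Ez by (meson abs_ge_self exp_le_cancel_iff order_trans)
    have KK: "0 \<le> K * \<rho> ^ N" using K \<rho> by simp
    have T1: "\<bar>(q s x - q0 x - s * q1 x) * exp z\<bar> \<le> (e / (2 * B') * s * \<rho> ^ N) * E"
      unfolding abs_mult using d1(2)[OF s(1) sd(2) x] E0 e B' s
      by (intro mult_mono) (auto simp: \<rho>_def)
    have "\<bar>exp z - 1\<bar> \<le> (s * V * \<rho>) * E"
      using abs_exp_minus_one_le[of z] z Ez s V \<rho>
      by (elim order_trans) (intro mult_mono, auto)
    then have T2: "\<bar>s * q1 x * (exp z - 1)\<bar> \<le> (s * (K * \<rho> ^ N)) * ((s * V * \<rho>) * E)"
      unfolding abs_mult using b1[OF x] s KK
      by (intro mult_mono) (auto simp: \<rho>_def)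
    have "z\<^sup>2 \<le> (s * V * \<rho>)\<^sup>2" using z by (metis abs_ge_zero power2_abs power_mono)
    then have "\<bar>exp z - 1 - z\<bar> \<le> (s * V * \<rho>)\<^sup>2 * E"
      using abs_exp_minus_linear_le[of z] Ez
      by (elim order_trans) (intro mult_mono, auto)
    then have T3: "\<bar>q0 x * (exp z - 1 - z)\<bar> \<le> (K * \<rho> ^ N) * ((s * V * \<rho>)\<^sup>2 * E)"
      unfolding abs_mult using b0[OF x] KK
      by (intro mult_mono) (auto simp: \<rho>_def)
    have "(C * s\<^sup>2) * (M * \<rho>) * 1 \<le> (C * s\<^sup>2) * (M * \<rho>) * E"
      using C M \<rho> E1 by (intro mult_left_mono) auto
    then have T4: "\<bar>q0 x * (z + s * (v \<bullet> y))\<bar> \<le> (K * \<rho> ^ N) * ((C * s\<^sup>2) * (M * \<rho>) * E)"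
      unfolding abs_mult using b0[OF x] KK zl
      by (intro mult_mono) (auto simp: \<rho>_def)
    have p1: "\<rho> ^ N \<le> \<rho> ^ (N + 2)" "\<rho> ^ N * \<rho> \<le> \<rho> ^ (N + 2)"
      using power_increasing[of N "N + 2" \<rho>] power_increasing[of "Suc N" "N + 2" \<rho>] \<rho>
      by (auto simp: ac_simps)
    define R where "R = \<rho> ^ (N + 2) * E"
    have R: "0 \<le> R" using \<rho> E1 by (simp add: R_def)
    have S1: "(e / (2 * B') * s * \<rho> ^ N) * E \<le> s * (e / (2 * B')) * R"
      using mult_left_mono[OF p1(1), of "s * (e / (2 * B')) * E"] s e B' E1 by (simp add: R_def ac_simps)
    have S2: "(s * (K * \<rho> ^ N)) * ((s * V * \<rho>) * E) \<le> s\<^sup>2 * (K * V) * R"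
      using mult_left_mono[OF p1(2), of "s\<^sup>2 * (K * V) * E"] s K V E1 by (simp add: R_def ac_simps power2_eq_square)
    have S3: "(K * \<rho> ^ N) * ((s * V * \<rho>)\<^sup>2 * E) = s\<^sup>2 * (K * V\<^sup>2) * R"
      by (simp add: R_def power_add power_mult_distrib ac_simps power2_eq_square)
    have S4: "(K * \<rho> ^ N) * ((C * s\<^sup>2) * (M * \<rho>) * E) \<le> s\<^sup>2 * (K * (C * M)) * R"
      using mult_left_mono[OF p1(2), of "s\<^sup>2 * (K * (C * M)) * E"] s K M C E1 by (simp add: R_def ac_simps power2_eq_square)
    define A where "A = q s x * exp z - q0 x - s * (q1 x - (v \<bullet> y) * q0 x)"
    \<comment> \<open>Four sources of error: \<open>q\<close> beyond first order, the product of two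
      first-order changes, the quadratic remainder of \<open>exp\<close>, and the deviation of the
      exponent from its linearisation. All but the first are of order s^2.\<close>
    have "A = (q s x - q0 x - s * q1 x) * exp z + s * q1 x * (exp z - 1)
        + q0 x * (exp z - 1 - z) + q0 x * (z + s * (v \<bullet> y))"
      by (simp add: A_def algebra_simps)
    then have "\<bar>A\<bar> \<le> s * (e / (2 * B')) * R + s\<^sup>2 * (K * V) * R + s\<^sup>2 * (K * V\<^sup>2) * R + s\<^sup>2 * (K * (C * M)) * R"
      using T1 T2 T3 T4 S1 S2 S3 S4 by linarith
    also have "\<dots> = s * (e / (2 * B') + s * L) * R"
      by (simp add: L_def algebra_simps power2_eq_square)
    finally have A: "\<bar>A\<bar> \<le> s * (e / (2 * B') + s * L) * R" .
    have RB: "R * exp (- (u \<bullet> y)) \<le> B'"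
    proof -
      have "s * V \<le> s * (V + 1)" using s by simp
      also have "\<dots> \<le> c / 2" using sd(3) V by (simp add: field_simps)
      finally have "s * V * \<rho> \<le> c / 2 * \<rho>" using \<rho> by (intro mult_right_mono) auto
      then have "s * V * \<rho> - u \<bullet> y \<le> - (c / 2 * norm x) + (c / 2 + u \<bullet> x0)"
        using c(2)[OF x] by (simp add: y_def \<rho>_def inner_diff_right algebra_simps)
      then have "E * exp (- (u \<bullet> y)) \<le> exp (- (c / 2 * norm x)) * exp (c / 2 + u \<bullet> x0)"
        by (simp add: E_def mult_exp_exp)
      then have "R * exp (- (u \<bullet> y)) \<le> \<rho> ^ (N + 2) * (exp (- (c / 2 * norm x)) * exp (c / 2 + u \<bullet> x0))"
        unfolding R_def mult.assoc using \<rho> by (intro mult_left_mono) auto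
      also have "\<dots> \<le> B'"
        using mult_right_mono[OF B(2)[of "norm x"], of "exp (c / 2 + u \<bullet> x0)"]
        by (simp add: B'_def \<rho>_def ac_simps)
      finally show ?thesis .
    qed
    have "exp (- (U s \<bullet> y)) = exp z * exp (- (u \<bullet> y))"
      by (simp add: z_def mult_exp_exp inner_diff_left)
    then have "\<bar>q s x * exp (- (U s \<bullet> y)) - q0 x * exp (- (u \<bullet> y))
       - s * ((q1 x - (v \<bullet> y) * q0 x) * exp (- (u \<bullet> y)))\<bar> = \<bar>A\<bar> * exp (- (u \<bullet> y))"
    proof -
      assume ex: "exp (- (U s \<bullet> y)) = exp z * exp (- (u \<bullet> y))"
      have "q s x * exp (- (U s \<bullet> y)) - q0 x * exp (- (u \<bullet> y))
         - s * ((q1 x - (v \<bullet> y) * q0 x) * exp (- (u \<bullet> y))) = A * exp (- (u \<bullet> y))"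
        unfolding ex A_def by (simp only: left_diff_distrib mult.assoc)
      then show ?thesis by (simp only: abs_mult abs_exp_cancel)
    qed
    also have "\<dots> \<le> s * (e / (2 * B') + s * L) * R * exp (- (u \<bullet> y))"
      using A by (intro mult_right_mono) auto
    also have "\<dots> \<le> s * (e / (2 * B') + s * L) * B'"
      unfolding mult.assoc[of _ R] using RB s e B' L by (intro mult_left_mono) auto
    also have "\<dots> \<le> s * e"
    proof -
      have "s * L \<le> s * (L + 1)" using s by simp
      also have "\<dots> \<le> e / (2 * B')" proof -
        have "s * (2 * B' * (L + 1)) < e"
          using sd(4) L B' by (simp only: pos_less_divide_eq mult_pos_pos zero_less_numeral add_nonneg_pos zero_less_one)
        then show ?thesis using B' by (simp add: pos_le_divide_eq algebra_simps)
      qed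
      finally have "e / (2 * B') + s * L \<le> e / B'" by simp
      then have "(e / (2 * B') + s * L) * B' \<le> e" using B' by (simp add: field_simps)
      then show ?thesis using s by (simp add: mult.assoc)
    qed
    finally show ?thesis by (simp add: y_def ac_simps)
  qed
  ultimately show ?thesis by blast
qed

section \<open>Density of the exponentials\<close>

text \<open>The linear span, built by one scaled exponential at a time in the shape
  \<open>a * f x + g x\<close> in which linearity of operators is stated; statements about linear
  maps then follow by induction.\<close>

inductive_set expspan :: "(real^'n^'n) set \<Rightarrow> (real^'n^'n \<Rightarrow> real) set" for D where
  zero: "(\<lambda>x. 0) \<in> expspan D"
| step: "pd u \<Longrightarrow> g \<in> expspan D \<Longrightarrow> (\<lambda>x. a * fexp D u x + g x) \<in> expspan D"

lemma expspan_fexp: "pd u \<Longrightarrow> (\<lambda>x. a * fexp D u x) \<in> expspan D"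
  using expspan.step[OF _ expspan.zero, of u a D] by simp

lemma expspan_add: "f \<in> expspan D \<Longrightarrow> g \<in> expspan D \<Longrightarrow> (\<lambda>x. f x + g x) \<in> expspan D"
  by (induction rule: expspan.induct) (auto simp: add.assoc intro: expspan.step)

lemma expspan_scale: "f \<in> expspan D \<Longrightarrow> (\<lambda>x. c * f x) \<in> expspan D"
proof (induction rule: expspan.induct)
  case (step u g a)
  then show ?case using expspan.step[of u "\<lambda>x. c * g x" D "c * a"] by (simp add: algebra_simps)
qed (simp add: expspan.zero)

lemma expspan_sum:
  "(\<And>i. i \<in> I \<Longrightarrow> f i \<in> expspan D) \<Longrightarrow> (\<lambda>x. \<Sum>i\<in>I. f i x) \<in> expspan D"
  by (induction I rule: infinite_finite_induct) (auto intro: expspan_add expspan.zero)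

text \<open>On D exponentials multiply by adding their parameters, and sums of positive definite
  matrices are positive definite.\<close>

lemma expspan_mult:
  assumes D: "D \<subseteq> Collect psd" and "f \<in> expspan D" "g \<in> expspan D"
  shows "(\<lambda>x. f x * g x) \<in> expspan D"
proof -
  have 1: "(\<lambda>x. fexp D u x * g x) \<in> expspan D" if u: "pd u" for u
    using assms(3)
  proof (induction rule: expspan.induct)
    case (step v h a)
    have "fexp D u x * (a * fexp D v x + h x) = a * fexp D (u + v) x + fexp D u x * h x" for x
      by (simp add: fexp_eq[OF D] inner_add_left exp_add[symmetric] algebra_simps)
    moreover have "pd (u + v)" using u step.hyps by (intro pd_add_psd pd_imp_psd)
    ultimately show ?case using expspan.step[of "u + v" "\<lambda>x. fexp D u x * h x" D a] step.IH by simp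
  qed (simp add: expspan.zero)
  show ?thesis using assms(2)
  proof (induction rule: expspan.induct)
    case (step u h a)
    have "(\<lambda>x. a * (fexp D u x * g x) + h x * g x) \<in> expspan D"
      by (intro expspan_add expspan_scale 1 step)
    then show ?case by (simp add: algebra_simps)
  qed (simp add: expspan.zero)
qed

lemma expspan_subset_C0: "D \<subseteq> Collect psd \<Longrightarrow> f \<in> expspan D \<Longrightarrow> f \<in> C0 D"
  by (rotate_tac, induction rule: expspan.induct) (auto intro: C0_zero C0_lincomb fexp_in_C0)

text \<open>The map expchart embeds the positive semidefinite matrices into the cube; adding the origin
  compactifies the image of a closed set, and nonconstant monomials in the new coordinates are the
  functions \<^const>\<open>fexp\<close>.\<close>

definition expchart :: "real^'n^'n \<Rightarrow> real^'n^'n" where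
  "expchart x = (\<chi> i j. exp (- (2 * trace x + x $ i $ j)))"

text \<open>Inverse of \<open>expchart\<close>: the logarithms of the diagonal entries add up to -(1
  + 2 CARD('n)) times the trace, which recovers the trace and then every entry.\<close>

definition logchart :: "real^'n^'n \<Rightarrow> real^'n^'n" where
  "logchart y = (\<chi> i j. - ln (y $ i $ j) + 2 * (\<Sum>l\<in>UNIV. ln (y $ l $ l)) / (1 + 2 * real CARD('n)))"

lemma trace_eq_inner: "trace (x :: real^'n^'n) = mat 1 \<bullet> x"
  by (simp add: trace_def inner_vec_def mat_def if_distrib if_distribR cong: if_cong)

lemma logchart_expchart: "logchart (expchart x) = (x :: real^'n^'n)"
proof -
  have "(\<Sum>l\<in>UNIV. ln (expchart x $ l $ l)) = - ((1 + 2 * real CARD('n)) * trace x)"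
    by (simp add: expchart_def sum.distrib sum_negf trace_def algebra_simps sum_subtractf)
  then have "2 * (\<Sum>l\<in>UNIV. ln (expchart x $ l $ l)) / (1 + 2 * real CARD('n)) = - 2 * trace x"
    by (simp add: add_nonneg_eq_0_iff)
  then show ?thesis by (simp add: logchart_def vec_eq_iff) (simp add: expchart_def)
qed

lemma abs_nth_nth_le_norm: "\<bar>x $ i $ j\<bar> \<le> norm (x :: real^'n^'m)"
  using component_le_norm_cart[of "x $ i" j] Finite_Cartesian_Product.norm_nth_le[of x i] by linarith

text \<open>On the cone |x_ij| <= norm x <= trace x, so the coefficient 2 of the trace leaves an
  exponent of at least norm x. Thus infinity is sent to the origin.\<close>

lemma expchart_le:
  assumes "psd (x :: real^'n^'n)"
  shows "norm (expchart x) \<le> (real CARD('n))\<^sup>2 * exp (- norm x)"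
proof -
  have c: "\<bar>expchart x $ i $ j\<bar> \<le> exp (- norm x)" for i j
  proof -
    have "\<bar>x $ i $ j\<bar> \<le> norm x" by (rule abs_nth_nth_le_norm)
    then show ?thesis using psd_norm_le_trace[OF assms]
      by (simp add: expchart_def trace_eq_inner)
  qed
  have "norm (expchart x) \<le> (\<Sum>i\<in>UNIV. norm (expchart x $ i))"
    by (simp add: norm_vec_def L2_set_le_sum)
  also have "\<dots> \<le> (\<Sum>i\<in>(UNIV::'n set). \<Sum>j\<in>(UNIV::'n set). \<bar>expchart x $ i $ j\<bar>)"
    by (intro sum_mono norm_le_l1_cart)
  also have "\<dots> \<le> (\<Sum>i\<in>(UNIV::'n set). \<Sum>j\<in>(UNIV::'n set). exp (- norm x))"
    by (intro sum_mono c)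
  finally show ?thesis by (simp add: power2_eq_square)
qed

text \<open>The reverse estimate: only far points are mapped near the origin. This gives continuity
  at the origin of functions transported from \<open>C0\<close>.\<close>

lemma expchart_ge:
  "exp (- ((2 * norm (mat 1 :: real^'n^'n) + 1) * norm x)) \<le> norm (expchart (x :: real^'n^'n))"
proof -
  fix i j :: 'n
  have "\<bar>x $ i $ j\<bar> \<le> norm x" by (rule abs_nth_nth_le_norm)
  moreover have "trace x \<le> norm (mat 1 :: real^'n^'n) * norm x"
    unfolding trace_eq_inner by (rule norm_cauchy_schwarz)
  ultimately have "exp (- ((2 * norm (mat 1 :: real^'n^'n) + 1) * norm x)) \<le> expchart x $ i $ j"
    by (simp add: expchart_def algebra_simps)
  also have "\<dots> \<le> norm (expchart x)"
    using abs_nth_nth_le_norm[of "expchart x" i j] by linarith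
  finally show ?thesis .
qed

lemma continuous_on_expchart: "continuous_on S expchart"
  unfolding expchart_def trace_def by (intro continuous_intros)

lemma expchart_nonzero: "expchart x \<noteq> (0 :: real^'n^'n)"
  using expchart_ge[of x] exp_gt_zero[of "- ((2 * norm (mat 1 :: real^'n^'n) + 1) * norm x)"]
  by (metis norm_zero not_le)

text \<open>Turns the exponent \<open>2 * trace x + x $ i $ j\<close> into an inner product with one
  symmetric matrix, so that each entry of \<open>expchart\<close> becomes an exponential. Positive
  definiteness rests on |v_i v_j| <= |v|^2 < 2 |v|^2.\<close>

definition chart_form :: "'n \<Rightarrow> 'n \<Rightarrow> real^'n^'n" where
  "chart_form i j = 2 *\<^sub>R mat 1 + (1/2) *\<^sub>R (axis i (axis j 1) + axis j (axis i 1))"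

lemma chart_form:
  fixes i j :: "'n::finite"
  shows pd_chart_form: "pd (chart_form i j)"
    and inner_chart_form: "transpose x = x \<Longrightarrow> chart_form i j \<bullet> x = 2 * trace x + x $ i $ j"
proof -
  let ?u = "chart_form i j"
  show u: "?u \<bullet> x = 2 * trace x + x $ i $ j" if "transpose x = x" for x
    using sym_nth[OF that, of j i] by (simp add: chart_form_def inner_add_left inner_axis' trace_eq_inner)
  show "pd ?u"
    unfolding pd_def
  proof (intro conjI allI impI)
    show "transpose ?u = ?u" by (auto simp: chart_form_def transpose_def vec_eq_iff mat_def axis_def)
    fix v :: "real^'n" assume v: "v \<noteq> 0"
    have "?u \<bullet> outer v = 2 * (norm v)\<^sup>2 + v $ i * v $ j"
      by (subst u) (simp_all add: trace_eq_inner inner_outer power2_norm_eq_inner)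
    moreover have "\<bar>v $ i * v $ j\<bar> \<le> norm v * norm v"
      unfolding abs_mult by (intro mult_mono component_le_norm_cart) auto
    moreover have "0 < (norm v)\<^sup>2" using v by simp
    ultimately show "0 < v \<bullet> (?u *v v)" by (simp add: inner_outer power2_eq_square)
  qed
qed

lemma matrix_axis_expansion:
  "y = (\<Sum>i\<in>UNIV. \<Sum>j\<in>UNIV. y $ i $ j *\<^sub>R axis i (axis j 1))" for y :: "real^'n^'m"
proof -
  have "(\<Sum>j\<in>UNIV. y $ i $ j * (axis i (axis j (1::real)) :: real^'n^'m) $ a $ b) = (if i = a then y $ i $ b else 0)"
    for i a b
  proof (cases "i = a")
    case True
    have "(\<Sum>j\<in>UNIV. y $ i $ j * (axis i (axis j (1::real)) :: real^'n^'m) $ a $ b)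
        = (\<Sum>j\<in>UNIV. if b = j then y $ i $ j else 0)"
      by (rule sum.cong) (use True in \<open>auto simp: axis_def\<close>)
    then show ?thesis using True by simp
  next
    case False
    then show ?thesis by (simp add: axis_def)
  qed
  then show ?thesis by (simp add: vec_eq_iff)
qed

text \<open>Every function in the span decays at infinity, so the value at the origin, the image of
  infinity, is split off. In a product the mixed terms \<open>p 0 * h x\<close> and
  \<open>q 0 * g x\<close> stay in the span.\<close>

lemma polynomial_expchart:
  assumes D: "D \<subseteq> Collect psd" and "real_polynomial_function p"
  shows "\<exists>g\<in>expspan D. \<forall>x\<in>D. p (expchart x) = p 0 + g (x :: real^'n^'n)"
  using assms(2)
proof (induction rule: real_polynomial_function.induct)
  case (linear f)
  interpret f: bounded_linear f by fact
  define g where "g x = (\<Sum>i\<in>UNIV. \<Sum>j\<in>UNIV. f (axis i (axis j 1)) * fexp D (chart_form i j) x)" for x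
  have g: "g \<in> expspan D" unfolding g_def
    by (intro expspan_sum expspan_fexp pd_chart_form)
  have "f (expchart x) = f 0 + g x" if x: "x \<in> D" for x
  proof -
    from arg_cong[OF matrix_axis_expansion[of "expchart x"], of f]
    have "f (expchart x) = (\<Sum>i\<in>UNIV. \<Sum>j\<in>UNIV. expchart x $ i $ j * f (axis i (axis j 1)))"
      by (simp add: f.sum f.scaleR)
    moreover have "transpose x = x" using D x psdD by auto
    ultimately show ?thesis using x
      by (simp only: g_def fexp_eq[OF D] inner_chart_form) (simp add: expchart_def mult.commute)
  qed
  then show ?case using g by blast
next
  case (const c)
  then show ?case using expspan.zero[of D] by force
next
  case (add p q)
  then obtain g h where "g \<in> expspan D" "\<forall>x\<in>D. p (expchart x) = p 0 + g x"
    "h \<in> expspan D" "\<forall>x\<in>D. q (expchart x) = q 0 + h x" by blast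
  then show ?case
    by (intro bexI[of _ "\<lambda>x. g x + h x"]) (auto intro: expspan_add)
next
  case (mult p q)
  then obtain g h where gh: "g \<in> expspan D" "\<forall>x\<in>D. p (expchart x) = p 0 + g x"
    "h \<in> expspan D" "\<forall>x\<in>D. q (expchart x) = q 0 + h x" by blast
  then have "(\<lambda>x. (p 0 * h x + q 0 * g x) + g x * h x) \<in> expspan D"
    by (intro expspan_add expspan_scale expspan_mult D)
  with gh show ?case
    by (intro bexI[of _ "\<lambda>x. (p 0 * h x + q 0 * g x) + g x * h x"]) (auto simp: algebra_simps)
qed

lemma compact_insert_expchart_image:
  fixes D :: "(real^'n^'n) set"
  assumes D: "closed D" "D \<subseteq> Collect psd"
  shows "compact (insert 0 (expchart ` D))" (is "compact ?S")
  unfolding compact_eq_bounded_closed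
proof
  let ?p = "(real CARD('n))\<^sup>2"
  have p: "0 < ?p" by simp
  show "bounded ?S"
    unfolding bounded_iff
  proof (intro exI[of _ ?p] ballI)
    fix y assume "y \<in> ?S"
    then consider "y = 0" | x where "x \<in> D" "y = expchart x" by auto
    then show "norm y \<le> ?p"
    proof cases
      case 2
      then have "norm y \<le> ?p * exp (- norm x)" using D(2) expchart_le[of x] by auto
      also have "\<dots> \<le> ?p * 1" by (intro mult_left_mono) auto
      finally show ?thesis by simp
    qed simp
  qed
  have "y \<in> ?S" if y: "y \<in> closure ?S" for y
  proof (cases "y = 0")
    case False
    \<comment> \<open>Outside this radius all images have at most half the norm of \<open>y\<close>,
      so \<open>y\<close> can be approached only from the compact part.\<close>
    define r where "r = - ln (norm y / (2 * ?p))"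
    have er: "?p * exp (- r) = norm y / 2" using False p by (simp add: r_def)
    let ?T = "expchart ` (D \<inter> cball 0 r)"
    have "compact ?T"
      using D by (intro compact_continuous_image continuous_on_expchart closed_Int_compact) auto
    then have "closed (?T \<union> cball 0 (norm y / 2))" by (intro closed_Un compact_imp_closed) auto
    moreover have "?S \<subseteq> ?T \<union> cball 0 (norm y / 2)"
    proof
      fix z assume "z \<in> ?S"
      then consider "z = 0" | x where "x \<in> D" "z = expchart x" by auto
      then show "z \<in> ?T \<union> cball 0 (norm y / 2)"
      proof cases
        case 2
        show ?thesis
        proof (cases "norm x \<le> r")
          case True
          then show ?thesis using 2 by auto
        next
          case False
          have "norm z \<le> ?p * exp (- norm x)" using D(2) expchart_le[of x] 2 by auto
          also have "\<dots> \<le> ?p * exp (- r)" using False by (intro mult_left_mono) auto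
          finally show ?thesis by (simp add: er)
        qed
      qed simp
    qed
    ultimately have "y \<in> ?T \<union> cball 0 (norm y / 2)" using y closure_minimal by blast
    then show ?thesis using False by auto
  qed simp
  then show "closed ?S" using closure_subset_eq by blast
qed

text \<open>Stone-Weierstrass on the compactified image, applied to \<open>f\<close> transported
  there and extended by 0 to the added point.\<close>

lemma C0_dense:
  fixes D :: "(real^'n^'n) set"
  assumes D: "closed D" "D \<subseteq> Collect psd" and f: "f \<in> C0 D" and e: "0 < e"
  shows "\<exists>g\<in>expspan D. \<forall>x\<in>D. \<bar>f x - g x\<bar> \<le> e"
proof -
  let ?S = "insert 0 (expchart ` D)"
  define F where "F y = (if y = 0 then 0 else f (logchart y))" for y
  have F: "F (expchart x) = f x" for x
    by (simp add: F_def expchart_nonzero logchart_expchart)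
  have cf: "continuous_on D f" using f by (simp add: C0_def)
  have "continuous_on ?S F"
    unfolding continuous_on_eq_continuous_within
  proof
    fix y assume "y \<in> ?S"
    then consider "y = 0" | x where "x \<in> D" "y = expchart x" by auto
    then show "continuous (at y within ?S) F"
    proof cases
      case 1
      show ?thesis
        unfolding continuous_within_eps_delta
      proof (intro allI impI)
        fix e :: real assume "0 < e"
        then obtain r where r: "\<And>x. x \<in> D \<Longrightarrow> r \<le> norm x \<Longrightarrow> \<bar>f x\<bar> < e"
          using f unfolding C0_def by blast
        let ?c = "2 * norm (mat 1 :: real^'n^'n) + 1"
        \<comment> \<open>By \<open>expchart_ge\<close> an image closer to the origin than
          \<open>d\<close> comes from a point of norm greater than \<open>r\<close>, where
          \<open>f\<close> is below \<open>e\<close>.\<close>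
        define d where "d = exp (- (?c * max r 0))"
        have "dist (F z) (F y) < e" if z: "z \<in> ?S" "dist z y < d" for z
        proof -
          consider "z = 0" | x where "x \<in> D" "z = expchart x" using z by auto
          then show ?thesis
          proof cases
            case 2
            have "exp (- (?c * norm x)) < d" using expchart_ge[of x] z 1 2 by simp
            then have "max r 0 < norm x" unfolding d_def
              by (simp add: add_nonneg_pos)
            then show ?thesis using r[of x] 2 1 by (simp add: F) (simp add: F_def)
          qed (use \<open>0 < e\<close> 1 in simp)
        qed
        moreover have "0 < d" by (simp add: d_def)
        ultimately show "\<exists>d>0. \<forall>z\<in>?S. dist z y < d \<longrightarrow> dist (F z) (F y) < e" by blast
      qed
    next
      case 2
      have "continuous_on (expchart ` D) (\<lambda>y. f (logchart y))"
      proof (rule continuous_on_compose2[OF cf])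
        have "(y :: real^'n^'n) $ i $ j \<noteq> 0" if "y \<in> expchart ` D" for y i j
          using that by (auto simp: expchart_def)
        then show "continuous_on (expchart ` D) logchart"
          unfolding logchart_def by (intro continuous_intros) auto
      qed (auto simp: logchart_expchart)
      then have "continuous_on (expchart ` D) F"
        by (rule continuous_on_eq) (auto simp: F_def expchart_nonzero)
      then have "continuous (at y within expchart ` D) F"
        using 2 by (simp add: continuous_on_eq_continuous_within)
      moreover have "at y within ?S = at y within expchart ` D"
        by (rule at_within_nhd[of _ "- {0}"]) (use 2 expchart_nonzero in \<open>auto\<close>)
      ultimately show ?thesis by simp
    qed
  qed
  then obtain p where p: "real_polynomial_function p" "\<And>y. y \<in> ?S \<Longrightarrow> \<bar>F y - p y\<bar> < e / 2"
    using Stone_Weierstrass_real_polynomial_function[OF compact_insert_expchart_image[OF D], of F "e / 2"] e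
    by auto
  from polynomial_expchart[OF D(2) p(1)] obtain g where g: "g \<in> expspan D"
    "\<And>x. x \<in> D \<Longrightarrow> p (expchart x) = p 0 + g x" by blast
  have "\<bar>f x - g x\<bar> \<le> e" if "x \<in> D" for x
  proof -
    have "\<bar>f x - p (expchart x)\<bar> < e / 2" using p(2)[of "expchart x"] that by (simp add: F)
    \<comment> \<open>The constant term may be dropped: it approximates \<open>F 0 = 0\<close> and
      costs only the second half of \<open>e\<close>.\<close>
    moreover have "\<bar>p 0\<bar> < e / 2" using p(2)[of 0] by (simp add: F_def)
    ultimately show ?thesis using g(2)[OF that] by linarith
  qed
  then show ?thesis using g(1) by blast
qed

section \<open>Positive contractions and Wishart operators\<close>

text \<open>The single-time conditions of \<open>pos_sc_contraction_semigroup\<close>, separated so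
  that they apply to the one-coordinate factors before a semigroup is assembled.\<close>

definition posop :: "'a::real_normed_vector set \<Rightarrow> (('a \<Rightarrow> real) \<Rightarrow> ('a \<Rightarrow> real)) \<Rightarrow> bool" where
  "posop D Q \<longleftrightarrow> (\<forall>f\<in>C0 D. Q f \<in> C0 D)
   \<and> (\<forall>f\<in>C0 D. \<forall>g\<in>C0 D. \<forall>a. Q (\<lambda>x. a * f x + g x) = (\<lambda>x. a * Q f x + Q g x))
   \<and> (\<forall>f\<in>C0 D. (\<forall>x\<in>D. 0 \<le> f x) \<longrightarrow> (\<forall>x\<in>D. 0 \<le> Q f x))
   \<and> (\<forall>f\<in>C0 D. \<forall>c. (\<forall>x\<in>D. \<bar>f x\<bar> \<le> c) \<longrightarrow> (\<forall>x\<in>D. \<bar>Q f x\<bar> \<le> c))"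

lemma posopD:
  assumes "posop D Q"
  shows "f \<in> C0 D \<Longrightarrow> Q f \<in> C0 D"
    and "f \<in> C0 D \<Longrightarrow> g \<in> C0 D \<Longrightarrow> Q (\<lambda>x. a * f x + g x) = (\<lambda>x. a * Q f x + Q g x)"
    and "f \<in> C0 D \<Longrightarrow> (\<And>x. x \<in> D \<Longrightarrow> 0 \<le> f x) \<Longrightarrow> x \<in> D \<Longrightarrow> 0 \<le> Q f x"
    and "f \<in> C0 D \<Longrightarrow> (\<And>x. x \<in> D \<Longrightarrow> \<bar>f x\<bar> \<le> c) \<Longrightarrow> x \<in> D \<Longrightarrow> \<bar>Q f x\<bar> \<le> c"
  using assms unfolding posop_def by blast+

lemma posop_zero: "posop D Q \<Longrightarrow> Q (\<lambda>x. 0) = (\<lambda>x. 0)"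
  using posopD(2)[OF _ C0_zero C0_zero, of D Q "-1"] by (simp add: fun_eq_iff)

lemma posop_scale: "posop D Q \<Longrightarrow> f \<in> C0 D \<Longrightarrow> Q (\<lambda>x. a * f x) = (\<lambda>x. a * Q f x)"
  using posopD(2)[OF _ _ C0_zero, of D Q f a] by (simp add: posop_zero)

lemma C0_scale: "f \<in> C0 D \<Longrightarrow> (\<lambda>x. a * f x) \<in> C0 D"
  using C0_lincomb[OF _ C0_zero, of f D a] by simp

lemma posop_id: "posop D (\<lambda>f. f)"
  by (simp add: posop_def)

lemma posop_comp:
  assumes Q: "posop D Q" and R: "posop D R"
  shows "posop D (\<lambda>f. Q (R f))"
  unfolding posop_def
  using posopD[OF Q] posopD[OF R] by simp

lemma posop_approx:
  assumes "posop D Q" "f \<in> C0 D" "g \<in> C0 D" "\<And>x. x \<in> D \<Longrightarrow> \<bar>f x - g x\<bar> \<le> e" "x \<in> D"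
  shows "\<bar>Q f x - Q g x\<bar> \<le> e"
proof -
  have "Q (\<lambda>x. (-1) * g x + f x) = (\<lambda>x. (-1) * Q g x + Q f x)"
    by (rule posopD(2)[OF assms(1,3,2)])
  moreover have "\<bar>Q (\<lambda>x. (-1) * g x + f x) x\<bar> \<le> e"
    by (rule posopD(4)[OF assms(1) C0_lincomb[OF assms(3,2)] _ assms(5)]) (use assms(4) in auto)
  ultimately show ?thesis by simp
qed

text \<open>Agreement passes from exponentials to their span by linearity, and to all of
  \<open>C0\<close> by density and contraction.\<close>

lemma posop_eqI:
  fixes D :: "(real^'n^'n) set"
  assumes D: "closed D" "D \<subseteq> Collect psd" and Q: "posop D Q" and R: "posop D R"
    and eq: "\<And>u. pd u \<Longrightarrow> Q (fexp D u) = R (fexp D u)" and f: "f \<in> C0 D"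
  shows "Q f = R f"
proof
  have span: "Q g = R g" if "g \<in> expspan D" for g
    using that
  proof (induction rule: expspan.induct)
    case (step u g a)
    note C = fexp_in_C0[OF D(2) step.hyps(1)] expspan_subset_C0[OF D(2) step.hyps(2)]
    show ?case using posopD(2)[OF Q C] posopD(2)[OF R C] step eq by simp
  qed (simp add: posop_zero[OF Q] posop_zero[OF R])
  fix x
  show "Q f x = R f x"
  proof (cases "x \<in> D")
    case True
    have "\<bar>Q f x - R f x\<bar> \<le> e" if e: "0 < e" for e
    proof -
      obtain g where g: "g \<in> expspan D" "\<And>x. x \<in> D \<Longrightarrow> \<bar>f x - g x\<bar> \<le> e / 2"
        using C0_dense[OF D f, of "e/2"] e by auto
      note gC = expspan_subset_C0[OF D(2) g(1)]
      have "\<bar>Q f x - Q g x\<bar> \<le> e / 2" by (rule posop_approx[OF Q f gC g(2) True])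
      moreover have "\<bar>R f x - R g x\<bar> \<le> e / 2" by (rule posop_approx[OF R f gC g(2) True])
      ultimately show ?thesis unfolding span[OF g(1)] by linarith
    qed
    then have "\<bar>Q f x - R f x\<bar> \<le> 0" by (rule field_le_epsilon) simp
    then show ?thesis by simp
  next
    case False
    then show ?thesis using posopD(1)[OF Q f] posopD(1)[OF R f] by (simp add: C0_def)
  qed
qed

section \<open>Operators given by probability kernels\<close>

lemma C0_borel_measurable:
  fixes f :: "'a::euclidean_space \<Rightarrow> real"
  assumes "closed D" "f \<in> C0 D"
  shows "f \<in> borel_measurable borel"
proof -
  have "(\<lambda>x. indicator D x *\<^sub>R f x) \<in> borel_measurable borel"
    using assms by (intro borel_measurable_continuous_on_indicator) (auto simp: C0_def)
  moreover have "(\<lambda>x. indicator D x *\<^sub>R f x) = f"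
    using assms(2) by (auto simp: C0_def indicator_def fun_eq_iff)
  ultimately show ?thesis by simp
qed

text \<open>The Feller property is read off from the Laplace transforms: an exponential goes to a
  multiple of an exponential with positive definite parameter \<open>T u\<close>, hence into
  \<open>C0\<close>. Density and contraction carry this over to every \<open>f\<close> in
  \<open>C0 D\<close>.\<close>

lemma posop_of_kernel:
  fixes D :: "(real^'n^'n) set" and c :: "real^'n^'n \<Rightarrow> real" and T :: "real^'n^'n \<Rightarrow> real^'n^'n"
  assumes D: "closed D" "D \<subseteq> Collect psd"
    and T: "\<And>u. pd u \<Longrightarrow> pd (T u)"
    and kernel: "\<And>x. x \<in> D \<Longrightarrow> \<exists>M. prob_space M \<and> sets M = sets borel \<and> (AE y in M. y \<in> D) \<and>
       (\<forall>u. pd u \<longrightarrow> (\<integral>y. exp (- (u \<bullet> y)) \<partial>M) = c u * exp (- (T u \<bullet> x)))"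
  shows "\<exists>Q. posop D Q \<and> (\<forall>u. pd u \<longrightarrow> Q (fexp D u) = (\<lambda>x. c u * fexp D (T u) x))"
proof -
  obtain M where M: "\<And>x. x \<in> D \<Longrightarrow> prob_space (M x)" "\<And>x. x \<in> D \<Longrightarrow> sets (M x) = sets borel"
    "\<And>x. x \<in> D \<Longrightarrow> AE y in M x. y \<in> D"
    "\<And>x u. x \<in> D \<Longrightarrow> pd u \<Longrightarrow> (\<integral>y. exp (- (u \<bullet> y)) \<partial>M x) = c u * exp (- (T u \<bullet> x))"
    using kernel by metis
  define Q where "Q (f :: real^'n^'n \<Rightarrow> real) x = (if x \<in> D then (\<integral>y. f y \<partial>M x) else 0)" for f x
  have meas: "f \<in> borel_measurable (M x)" if "f \<in> C0 D" "x \<in> D" for f x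
    using C0_borel_measurable[OF D(1) that(1)] M(2)[OF that(2)] measurable_cong_sets by blast
  have int: "integrable (M x) f" if f: "f \<in> C0 D" and x: "x \<in> D" for f x
  proof -
    interpret prob_space "M x" by (rule M(1)[OF x])
    obtain B where "\<And>x. \<bar>f x\<bar> \<le> B" using C0_bounded[OF D(1) f] by blast
    then show ?thesis by (intro integrable_const_bound[of _ B] meas f x) auto
  qed
  have fexp: "Q (fexp D u) = (\<lambda>x. c u * fexp D (T u) x)" if u: "pd u" for u
  proof
    fix x
    show "Q (fexp D u) x = c u * fexp D (T u) x"
    proof (cases "x \<in> D")
      case True
      have "(\<integral>y. fexp D u y \<partial>M x) = (\<integral>y. exp (- (u \<bullet> y)) \<partial>M x)"
      proof (rule integral_cong_AE)
        show "fexp D u \<in> borel_measurable (M x)" by (rule meas[OF fexp_in_C0[OF D(2) u] True])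
        have "(\<lambda>y. exp (- (u \<bullet> y))) \<in> borel_measurable borel" by measurable
        then show "(\<lambda>y. exp (- (u \<bullet> y))) \<in> borel_measurable (M x)"
          using M(2)[OF True] measurable_cong_sets by blast
        show "AE y in M x. fexp D u y = exp (- (u \<bullet> y))"
          using M(3)[OF True] by eventually_elim (simp add: fexp_eq[OF D(2)])
      qed
      then show ?thesis using True M(4)[OF True u] by (simp add: Q_def fexp_eq[OF D(2)])
    next
      case False
      then show ?thesis by (simp add: Q_def fexp_def)
    qed
  qed
  have lin: "Q (\<lambda>x. a * f x + g x) = (\<lambda>x. a * Q f x + Q g x)" if "f \<in> C0 D" "g \<in> C0 D" for f g a
    using int that by (auto simp: Q_def fun_eq_iff)
  have pos: "0 \<le> Q f x" if "f \<in> C0 D" "\<forall>x\<in>D. 0 \<le> f x" "x \<in> D" for f x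
  proof -
    have "AE y in M x. 0 \<le> f y" using M(3)[OF that(3)] by eventually_elim (use that in auto)
    then show ?thesis using that(3) by (auto simp: Q_def intro: integral_nonneg_AE)
  qed
  have con: "\<bar>Q f x\<bar> \<le> c" if "f \<in> C0 D" "\<forall>x\<in>D. \<bar>f x\<bar> \<le> c" "x \<in> D" for f c x
  proof -
    interpret prob_space "M x" by (rule M(1)[OF that(3)])
    have ae: "AE y in M x. \<bar>f y\<bar> \<le> c" using M(3)[OF that(3)] by eventually_elim (use that in auto)
    have "\<bar>\<integral>y. f y \<partial>M x\<bar> \<le> (\<integral>y. \<bar>f y\<bar> \<partial>M x)" by (rule integral_abs_bound)
    also have "\<dots> \<le> (\<integral>y. c \<partial>M x)"
      using int[OF that(1,3)] ae by (intro integral_mono_AE) auto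
    finally show ?thesis using that(3) by (simp add: Q_def prob_space)
  qed
  have C0: "Q f \<in> C0 D" if f: "f \<in> C0 D" for f
  proof (rule C0_uniform_limit)
    show "Q f x = 0" if "x \<notin> D" for x using that by (simp add: Q_def)
    have span: "Q g \<in> C0 D" if "g \<in> expspan D" for g
      using that
    proof (induction rule: expspan.induct)
      case zero
      then show ?case using C0_zero by (simp add: Q_def cong: if_cong)
    next
      case (step u g a)
      have "Q (\<lambda>x. a * fexp D u x + g x) = (\<lambda>x. a * Q (fexp D u) x + Q g x)"
        by (intro lin fexp_in_C0 expspan_subset_C0 D step)
      moreover have "Q (fexp D u) \<in> C0 D"
        unfolding fexp[OF step.hyps(1)] by (intro C0_scale fexp_in_C0 D T step)
      ultimately show ?case using C0_lincomb step.IH by simp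
    qed
    fix e :: real assume "0 < e"
    then obtain g where g: "g \<in> expspan D" "\<forall>x\<in>D. \<bar>f x - g x\<bar> \<le> e"
      using C0_dense[OF D f] by blast
    note gC = expspan_subset_C0[OF D(2) g(1)]
    have "\<bar>Q f x - Q g x\<bar> \<le> e" if "x \<in> D" for x
    proof -
      have "Q (\<lambda>x. (-1) * g x + f x) x = (-1) * Q g x + Q f x" by (simp only: lin[OF gC f])
      moreover have "\<bar>Q (\<lambda>x. (-1) * g x + f x) x\<bar> \<le> e"
        by (rule con[OF C0_lincomb[OF gC f] _ that]) (use g(2) in auto)
      ultimately show ?thesis by simp
    qed
    then show "\<exists>h\<in>C0 D. \<forall>x\<in>D. \<bar>Q f x - h x\<bar> \<le> e" using span[OF g(1)] by blast
  qed
  show ?thesis unfolding posop_def using fexp lin pos con C0 by blast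
qed

section \<open>First-order expansion of the Wishart formula in time\<close>

lemma det_one_plus_has_derivative:
  fixes u :: "real^'n^'n"
  shows "((\<lambda>s. det (mat 1 + s *\<^sub>R u)) has_real_derivative trace u) (at 0)"
proof -
  let ?P = "{p. p permutes (UNIV :: 'n set)}"
  let ?d = "\<lambda>p. \<Sum>i\<in>UNIV. u $ i $ p i * (\<Prod>j\<in>UNIV - {i}. (mat 1 :: real^'n^'n) $ j $ p j)"
  have d: "?d p = (if p = id then trace u else 0)" if p: "p \<in> ?P" for p
  proof (cases "p = id")
    case False
    \<comment> \<open>A permutation other than the identity moves at least two points, so after one
      factor has been differentiated a zero off-diagonal entry of the identity matrix
      remains.\<close>
    have "(\<Prod>j\<in>UNIV - {i}. (mat 1 :: real^'n^'n) $ j $ p j) = 0" for i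
    proof -
      have "\<exists>j. j \<noteq> i \<and> p j \<noteq> j"
      proof (rule ccontr)
        assume "\<not> ?thesis"
        then have f: "\<And>j. j \<noteq> i \<Longrightarrow> p j = j" by blast
        have "inj p" using p permutes_inj by auto
        then have "p i = i" using f by (metis injD)
        then show False using f False by (metis eq_id_iff)
      qed
      then obtain j where "j \<noteq> i" "p j \<noteq> j" by blast
      then show ?thesis by (intro prod_zero) (auto simp: mat_def intro!: bexI[of _ j])
    qed
    then show ?thesis using False by (simp only: mult_zero_right sum.neutral_const if_False)
  next
    case True
    then show ?thesis by (simp add: mat_def trace_def)
  qed
  have "((\<lambda>s. \<Prod>i\<in>UNIV. (mat 1 + s *\<^sub>R u) $ i $ p i) has_real_derivative ?d p) (at 0)" for p
  proof -
    have "((\<lambda>s. \<Prod>i\<in>UNIV. mat 1 $ i $ p i + s * u $ i $ p i) has_derivative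
      (\<lambda>y. \<Sum>i\<in>UNIV. (y * u $ i $ p i) * (\<Prod>j\<in>UNIV - {i}. mat 1 $ j $ p j + 0 * u $ j $ p j))) (at 0)"
      by (rule has_derivative_prod) (auto intro!: derivative_eq_intros)
    moreover have "(\<lambda>y. \<Sum>i\<in>UNIV. (y * u $ i $ p i) * (\<Prod>j\<in>UNIV - {i}. mat 1 $ j $ p j + 0 * u $ j $ p j)) = (*) (?d p)"
      by (simp add: fun_eq_iff sum_distrib_left sum_distrib_right ac_simps)
    ultimately show ?thesis by (simp add: has_field_derivative_def)
  qed
  then have "((\<lambda>s. \<Sum>p\<in>?P. of_int (sign p) * (\<Prod>i\<in>UNIV. (mat 1 + s *\<^sub>R u) $ i $ p i))
      has_real_derivative (\<Sum>p\<in>?P. of_int (sign p) * ?d p)) (at 0)"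
    by (intro derivative_intros DERIV_cmult)
  moreover have "(\<Sum>p\<in>?P. of_int (sign p) * ?d p) = (\<Sum>p\<in>?P. if p = id then trace u else 0)"
    by (intro sum.cong refl) (simp add: d sign_id)
  moreover have "\<dots> = trace u" by (simp add: permutes_id)
  ultimately show ?thesis unfolding det_def by simp
qed

lemma matrix_mult_scaleR_right: "A ** (c *\<^sub>R B) = c *\<^sub>R (A ** (B :: real^'n^'m))"
  and matrix_mult_scaleR_left: "(c *\<^sub>R A) ** B = c *\<^sub>R (A ** (B :: real^'n^'m))"
  by (simp_all add: matrix_matrix_mult_def vec_eq_iff sum_distrib_left ac_simps)

lemma matrix_add_rdistrib_real: "(A + B) ** C = A ** C + B ** (C :: real^'n^'m)"
  by (simp add: matrix_matrix_mult_def vec_eq_iff distrib_right sum.distrib)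

lemma matrix_diff_ldistrib: "A ** (B - C) = A ** B - A ** (C :: real^'n^'m)"
  by (simp add: matrix_matrix_mult_def vec_eq_iff right_diff_distrib sum_subtractf)

lemma det_one_plus_inv:
  fixes w :: "real^'n^'n"
  assumes "pd w"
  shows "det (mat 1 + c *\<^sub>R matrix_inv w) = det (w + c *\<^sub>R mat 1) / det w"
proof -
  note cc = matrix_inv_cancel[OF pd_invertible[OF assms]]
  have "w ** (mat 1 + c *\<^sub>R matrix_inv w) = w + c *\<^sub>R mat 1"
    by (simp add: matrix_add_ldistrib matrix_mult_scaleR_right cc)
  then have "det w * det (mat 1 + c *\<^sub>R matrix_inv w) = det (w + c *\<^sub>R mat 1)"
    by (metis det_mul)
  then show ?thesis using pd_det_pos[OF assms] by (simp add: field_simps)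
qed


abbreviation wexponent :: "real^'n^'n \<Rightarrow> real \<Rightarrow> real^'n^'n" where
  "wexponent u t \<equiv> matrix_inv (matrix_inv u + (2 * t) *\<^sub>R mat 1)"

abbreviation wfactor :: "real \<Rightarrow> real^'n^'n \<Rightarrow> real \<Rightarrow> real" where
  "wfactor \<alpha> u t \<equiv> det (mat 1 + (2 * t) *\<^sub>R u) powr (- \<alpha> / 2)"

text \<open>The resolvent identity U = u - 2 t u U, inserted into itself once, leaves the remainder
  4 t^2 u u U. The smallness condition gives norm U <= 2 norm u, hence the constant 8.\<close>

lemma wishart_exponent_expansion:
  fixes u :: "real^'n^'n"
  assumes u: "pd u" and t: "0 \<le> t" and small: "4 * t * norm u \<le> 1"
  defines "U \<equiv> wexponent u t"
  shows "norm (U - u - t *\<^sub>R ((-2) *\<^sub>R (u ** u))) \<le> 8 * norm u ^ 3 * t\<^sup>2"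
proof -
  let ?w = "matrix_inv u"
  have "pd (?w + (2 * t) *\<^sub>R mat 1)"
    using t by (intro pd_add_psd pd_matrix_inv u psd_scaleR pd_imp_psd pd_mat_1) auto
  then have "(?w + (2 * t) *\<^sub>R mat 1) ** U = mat 1"
    unfolding U_def by (intro matrix_inv_cancel pd_invertible)
  then have "u ** ((?w + (2 * t) *\<^sub>R mat 1) ** U) = u" by simp
  moreover have "u ** ((?w + (2 * t) *\<^sub>R mat 1) ** U) = U + (2 * t) *\<^sub>R (u ** U)"
    by (simp add: matrix_mul_assoc matrix_add_ldistrib matrix_mult_scaleR_right
        matrix_inv_cancel pd_invertible u matrix_add_rdistrib_real matrix_mult_scaleR_left)
  ultimately have eq: "U = u - (2 * t) *\<^sub>R (u ** U)" by (simp add: algebra_simps)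
  have "norm U \<le> norm u + norm ((2 * t) *\<^sub>R (u ** U))"
    by (subst eq) (rule norm_triangle_ineq4)
  also have "norm ((2 * t) *\<^sub>R (u ** U)) \<le> 2 * t * (norm u * norm U)"
    using t mult_left_mono[OF norm_matrix_mult_le[of u U], of "2 * t"] by simp
  also have "\<dots> \<le> norm U / 2"
    using mult_right_mono[OF small, of "norm U"] by (simp add: ac_simps)
  finally have nU: "norm U \<le> 2 * norm u" by simp
  have "u ** U = u ** (u - (2 * t) *\<^sub>R (u ** U))" by (subst eq) simp
  also have "\<dots> = u ** u - (2 * t) *\<^sub>R (u ** (u ** U))"
    by (simp add: matrix_diff_ldistrib matrix_mult_scaleR_right)
  finally have uU: "u ** U = u ** u - (2 * t) *\<^sub>R (u ** (u ** U))" .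
  have "U - u - t *\<^sub>R ((-2) *\<^sub>R (u ** u)) = (2 * t) *\<^sub>R (u ** u) - (2 * t) *\<^sub>R (u ** U)"
    by (subst eq) simp
  also have "\<dots> = (4 * t\<^sup>2) *\<^sub>R (u ** (u ** U))"
    by (subst uU) (simp add: scaleR_diff_right power2_eq_square)
  finally have "norm (U - u - t *\<^sub>R ((-2) *\<^sub>R (u ** u))) = 4 * t\<^sup>2 * norm (u ** (u ** U))" by simp
  also have "\<dots> \<le> 4 * t\<^sup>2 * (norm u * (norm u * (2 * norm u)))"
    by (intro mult_left_mono order_trans[OF norm_matrix_mult_le] nU) auto
  also have "\<dots> = 8 * norm u ^ 3 * t\<^sup>2" by (simp add: power3_eq_cube)
  finally show ?thesis .
qed

lemma real_derivative_linear_error: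
  assumes "(f has_real_derivative d) (at 0)" "0 < e"
  shows "\<exists>\<delta>>0. \<forall>t. 0 < t \<and> t < \<delta> \<longrightarrow> \<bar>f t - f 0 - t * d\<bar> \<le> e * t"
proof -
  have "(f has_derivative (*) d) (at 0)" using assms(1) by (simp add: has_field_derivative_def)
  then obtain \<delta> where "0 < \<delta>" "\<And>y. norm (y - 0) < \<delta> \<Longrightarrow> norm (f y - f 0 - d * (y - 0)) \<le> e * norm (y - 0)"
    unfolding has_derivative_at_alt using assms(2) by blast
  note \<delta> = this
  have "\<bar>f t - f 0 - t * d\<bar> \<le> e * t" if "0 < t" "t < \<delta>" for t
    using \<delta>(2)[of t] that by (simp add: mult.commute[of d])
  then show ?thesis using \<delta>(1) by blast
qed

text \<open>At time zero the exponent moves with velocity -2 u^2 and the prefactor with velocity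
  -\<alpha> trace u; together they are the generator applied to f_u.\<close>

lemma wishart_generator_uniform:
  fixes u :: "real^'n^'n"
  assumes u: "pd u" and e: "0 < e"
  shows "\<exists>d>0. \<forall>t. 0 < t \<and> t < d \<longrightarrow> (\<forall>x. psd x \<longrightarrow>
     \<bar>wfactor \<alpha> u t * exp (- (wexponent u t \<bullet> x))
       - exp (- (u \<bullet> x)) - t * ((- \<alpha> * trace u + 2 * ((u ** u) \<bullet> x)) * exp (- (u \<bullet> x)))\<bar> \<le> e * t)"
proof -
  define c where "c t = wfactor \<alpha> u t" for t
  have "((\<lambda>t. det (mat 1 + (2 * t) *\<^sub>R u)) has_real_derivative trace u * 2) (at 0)"
    using DERIV_chain[of "\<lambda>s. det (mat 1 + s *\<^sub>R u)" "trace u" "\<lambda>t. 2 * t" 0 2 UNIV]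
      det_one_plus_has_derivative[of u]
    by (auto simp: o_def intro!: derivative_eq_intros)
  from DERIV_powr[OF this, of "\<lambda>_. - \<alpha> / 2" 0]
  have "(c has_real_derivative - \<alpha> * trace u) (at 0)" by (simp add: c_def[abs_def] mult.commute)
  note c = real_derivative_linear_error[OF this]
  have c0: "c 0 = 1" by (simp add: c_def)
  define d0 where "d0 = 1 / (4 * (norm u + 1))"
  define K where "K = 1 + \<bar>\<alpha> * trace u\<bar>"
  have "\<exists>d>0. \<forall>t. 0 < t \<and> t < d \<longrightarrow> (\<forall>x. psd x \<longrightarrow>
     \<bar>c t * exp (- (wexponent u t \<bullet> (x - 0)))
       - 1 * exp (- (u \<bullet> (x - 0))) - t * ((- \<alpha> * trace u - (((-2) *\<^sub>R (u ** u)) \<bullet> (x - 0)) * 1) * exp (- (u \<bullet> (x - 0))))\<bar> \<le> e * t)"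
  proof (rule exp_family_uniform_derivative[where ?d0.0 = d0 and C = "8 * norm u ^ 3" and N = 0 and K = K
        and ?q0.0 = "\<lambda>x. 1" and ?q1.0 = "\<lambda>x. - \<alpha> * trace u", OF u _ _ _ _ _ _ e])
    show "0 < d0" by (simp add: d0_def add_nonneg_pos)
    show "norm (wexponent u s - u - s *\<^sub>R ((-2) *\<^sub>R (u ** u))) \<le> 8 * norm u ^ 3 * s\<^sup>2"
      if "0 < s" "s < d0" for s
    proof (rule wishart_exponent_expansion[OF u])
      have "4 * (norm u + 1) * s < 1"
        using that(2) by (simp add: d0_def pos_less_divide_eq add_nonneg_pos mult.commute)
      then show "4 * s * norm u \<le> 1" using that(1) by (simp add: algebra_simps)
    qed (use that in simp)
    show "\<exists>d>0. \<forall>s. 0 < s \<and> s < d \<longrightarrow> (\<forall>x. psd x \<longrightarrow>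
        \<bar>c s - 1 - s * (- \<alpha> * trace u)\<bar> \<le> e * s * (1 + norm x) ^ 0)" if "0 < e" for e
      using c[OF that] by (auto simp: c0)
  qed (auto simp: K_def)
  then show ?thesis by (simp add: c_def algebra_simps)
qed


section \<open>Wishart operators and the assembly of the semigroup\<close>

definition wishart_op :: "(real^'n^'n) set \<Rightarrow> real \<Rightarrow> real^'n^'n \<Rightarrow> ((real^'n^'n \<Rightarrow> real) \<Rightarrow> real^'n^'n \<Rightarrow> real) \<Rightarrow> bool"
  where "wishart_op D \<alpha> s Q \<longleftrightarrow> posop D Q \<and> (\<forall>w. pd w \<longrightarrow> Q (fexp D (matrix_inv w)) =
    (\<lambda>x. (det (w + s) / det w) powr (- \<alpha> / 2) * fexp D (matrix_inv (w + s)) x))"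

text \<open>The determinant ratios telescope along w, w + t, w + t + s, so the prefactors combine
  and the increments simply add.\<close>

lemma wishart_op_comp:
  fixes D :: "(real^'n^'n) set"
  assumes D: "D \<subseteq> Collect psd" and Q: "wishart_op D \<alpha> s Q" and R: "wishart_op D \<alpha> t R"
    and "psd s" "psd t"
  shows "wishart_op D \<alpha> (s + t) (\<lambda>f. Q (R f))"
  unfolding wishart_op_def
proof (intro conjI allI impI)
  have pQ: "posop D Q" and pR: "posop D R" using Q R by (auto simp: wishart_op_def)
  then show "posop D (\<lambda>f. Q (R f))" by (rule posop_comp)
  fix w :: "real^'n^'n" assume w: "pd w"
  have wt: "pd (w + t)" "pd (w + t + s)" using w assms by (auto intro: pd_add_psd)
  have "Q (R (fexp D (matrix_inv w))) =
      Q (\<lambda>x. (det (w + t) / det w) powr (- \<alpha> / 2) * fexp D (matrix_inv (w + t)) x)"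
    using R w by (simp add: wishart_op_def)
  also have "\<dots> = (\<lambda>x. (det (w + t) / det w) powr (- \<alpha> / 2) * Q (fexp D (matrix_inv (w + t))) x)"
    using posop_scale[OF pQ fexp_in_C0[OF D pd_matrix_inv(1)[OF wt(1)]]] .
  also have "Q (fexp D (matrix_inv (w + t))) =
      (\<lambda>x. (det (w + t + s) / det (w + t)) powr (- \<alpha> / 2) * fexp D (matrix_inv (w + t + s)) x)"
    using Q wt by (simp add: wishart_op_def)
  finally have 1: "Q (R (fexp D (matrix_inv w))) = (\<lambda>x. (det (w + t) / det w) powr (- \<alpha> / 2) *
      ((det (w + t + s) / det (w + t)) powr (- \<alpha> / 2) * fexp D (matrix_inv (w + t + s)) x))" .
  have "(det (w + t) / det w) powr (- \<alpha> / 2) * (det (w + t + s) / det (w + t)) powr (- \<alpha> / 2)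
      = (det (w + t) / det w * (det (w + t + s) / det (w + t))) powr (- \<alpha> / 2)"
    by (rule powr_mult[symmetric])
  also have "det (w + t) / det w * (det (w + t + s) / det (w + t)) = det (w + t + s) / det w"
    using pd_det_pos[OF wt(1)] by simp
  finally show "Q (R (fexp D (matrix_inv w))) =
      (\<lambda>x. (det (w + (s + t)) / det w) powr (- \<alpha> / 2) * fexp D (matrix_inv (w + (s + t))) x)"
    unfolding 1 by (simp add: mult.assoc[symmetric] add.assoc add.commute[of t s])
qed

lemma wishart_op_id: "wishart_op D \<alpha> 0 (\<lambda>f. f)"
  unfolding wishart_op_def using posop_id pd_det_pos by fastforce

text \<open>Reduces identities between operators to a comparison of increments; the identity at time
  0 and the semigroup law are obtained in this way.\<close>

lemma wishart_op_unique:
  assumes D: "closed D" "D \<subseteq> Collect psd" and "wishart_op D \<alpha> s Q" "wishart_op D \<alpha> s R" "f \<in> C0 D"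
  shows "Q f = R f"
proof (rule posop_eqI[OF D _ _ _ assms(5)])
  show "posop D Q" "posop D R" using assms by (auto simp: wishart_op_def)
  fix u :: "real^'a^'a" assume u: "pd u"
  then show "Q (fexp D u) = R (fexp D u)"
    using assms(3,4) pd_matrix_inv[OF u] unfolding wishart_op_def by metis
qed

lemma wishart_op_fexp:
  assumes D: "D \<subseteq> Collect psd" and Q: "wishart_op D \<alpha> ((2 * t) *\<^sub>R mat 1) Q"
    and u: "pd u" and t: "0 \<le> t" and x: "x \<in> D"
  shows "Q (fexp D u) x = wfactor \<alpha> u t *
    exp (- (wexponent u t \<bullet> x))"
proof -
  note w = pd_matrix_inv[OF u]
  have "Q (fexp D u) x = (det (matrix_inv u + (2 * t) *\<^sub>R mat 1) / det (matrix_inv u)) powr (- \<alpha> / 2)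
    * fexp D (wexponent u t) x"
    using Q w unfolding wishart_op_def by metis
  then show ?thesis using det_one_plus_inv[OF w(1), of "2 * t"] x by (simp add: w(2) fexp_eq[OF D])
qed

text \<open>For an exponential the first-order expansion bounds the displacement by t (B + 1), where
  \<open>B\<close> bounds the image under the generator. Linear combinations and density extend
  continuity to \<open>C0\<close>.\<close>

lemma wishart_op_strongly_continuous:
  fixes D :: "(real^'n^'n) set"
  assumes D: "closed D" "D \<subseteq> Collect psd"
    and P: "\<And>t. 0 \<le> t \<Longrightarrow> wishart_op D \<alpha> ((2 * t) *\<^sub>R mat 1) (P t)"
    and P0: "\<And>f. f \<in> C0 D \<Longrightarrow> P 0 f = f"
    and f: "f \<in> C0 D" and e: "0 < e"
  shows "\<exists>d>0. \<forall>t. 0 \<le> t \<and> t < d \<longrightarrow> (\<forall>x\<in>D. \<bar>P t f x - f x\<bar> \<le> e)"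
proof -
  have pP: "posop D (P t)" if "0 \<le> t" for t using P[OF that] by (simp add: wishart_op_def)
  have exp: "\<exists>d>0. \<forall>t. 0 \<le> t \<and> t < d \<longrightarrow> (\<forall>x\<in>D. \<bar>P t (fexp D u) x - fexp D u x\<bar> \<le> e)"
    if u: "pd u" and e: "0 < e" for u e
  proof -
    let ?H = "\<lambda>x. if x \<in> D then (- \<alpha> * trace u + 2 * ((u ** u) \<bullet> x)) * exp (- (u \<bullet> x)) else 0"
    define K where "K = \<bar>\<alpha> * trace u\<bar> + 2 * norm (u ** u)"
    have "?H \<in> C0 D"
    proof (rule C0_poly_exp[OF D(2) u, of _ K 1])
      show "\<bar>- \<alpha> * trace u + 2 * ((u ** u) \<bullet> x)\<bar> \<le> K * (1 + norm x) ^ 1" for x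
      proof -
        have "\<bar>(u ** u) \<bullet> x\<bar> \<le> norm (u ** u) * norm x" by (rule Cauchy_Schwarz_ineq2)
        then have "\<bar>- \<alpha> * trace u + 2 * ((u ** u) \<bullet> x)\<bar> \<le> \<bar>\<alpha> * trace u\<bar> * 1 + 2 * (norm (u ** u) * norm x)"
          by simp
        also have "\<dots> \<le> \<bar>\<alpha> * trace u\<bar> * (1 + norm x) + 2 * (norm (u ** u) * (1 + norm x))"
          by (intro add_mono mult_left_mono) auto
        finally show ?thesis by (simp add: K_def algebra_simps)
      qed
    qed (intro continuous_intros)
    then obtain B where B: "0 \<le> B" "\<And>x. \<bar>?H x\<bar> \<le> B" using C0_bounded[OF D(1)] by blast
    from wishart_generator_uniform[OF u zero_less_one, of \<alpha>] obtain d where d: "0 < d"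
      "\<And>t x. 0 < t \<Longrightarrow> t < d \<Longrightarrow> psd x \<Longrightarrow>
       \<bar>wfactor \<alpha> u t * exp (- (wexponent u t \<bullet> x))
       - exp (- (u \<bullet> x)) - t * ((- \<alpha> * trace u + 2 * ((u ** u) \<bullet> x)) * exp (- (u \<bullet> x)))\<bar> \<le> 1 * t" by blast
    define d' where "d' = min d (e / (B + 1))"
    have "\<bar>P t (fexp D u) x - fexp D u x\<bar> \<le> e" if t: "0 \<le> t" "t < d'" and x: "x \<in> D" for t x
    proof (cases "t = 0")
      case True
      then show ?thesis using P0[OF fexp_in_C0[OF D(2) u]] e by simp
    next
      case False
      then have t0: "0 < t" "t < d" using t by (auto simp: d'_def)
      have "\<bar>P t (fexp D u) x - fexp D u x - t * ?H x\<bar> \<le> t"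
        using d(2)[OF t0, of x] D(2) x unfolding wishart_op_fexp[OF D(2) P[OF t(1)] u t(1) x]
        by (auto simp: fexp_eq[OF D(2)])
      moreover have "\<bar>t * ?H x\<bar> \<le> t * B" unfolding abs_mult using t B(2)[of x] by (intro mult_mono) auto
      moreover have "t * (B + 1) \<le> e"
        using t(2) B(1) by (simp add: d'_def pos_less_divide_eq)
      ultimately show ?thesis by (simp add: distrib_left)
    qed
    moreover have "0 < d'" using d e B by (simp add: d'_def)
    ultimately show ?thesis by blast
  qed
  have span: "\<forall>e>0. \<exists>d>0. \<forall>t. 0 \<le> t \<and> t < d \<longrightarrow> (\<forall>x\<in>D. \<bar>P t g x - g x\<bar> \<le> e)" if "g \<in> expspan D" for g
    using that
  proof (induction rule: expspan.induct)
    case zero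
    show ?case using posop_zero[OF pP] by (intro allI impI exI[of _ 1]) simp
  next
    case (step u g a)
    note C = fexp_in_C0[OF D(2) step.hyps(1)] expspan_subset_C0[OF D(2) step.hyps(2)]
    show ?case
    proof (intro allI impI)
      fix e :: real assume e: "0 < e"
      have "0 < e / (2 * (\<bar>a\<bar> + 1))" using e by (simp add: add_nonneg_pos)
      from exp[OF step.hyps(1) this] obtain d1 where d1: "0 < d1"
        "\<And>t x. 0 \<le> t \<Longrightarrow> t < d1 \<Longrightarrow> x \<in> D \<Longrightarrow> \<bar>P t (fexp D u) x - fexp D u x\<bar> \<le> e / (2 * (\<bar>a\<bar> + 1))" by blast
      have "0 < e / 2" using e by simp
      from step.IH[rule_format, OF this] obtain d2 where d2: "0 < d2"
        "\<And>t x. 0 \<le> t \<Longrightarrow> t < d2 \<Longrightarrow> x \<in> D \<Longrightarrow> \<bar>P t g x - g x\<bar> \<le> e / 2" by blast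
      have "\<bar>P t (\<lambda>x. a * fexp D u x + g x) x - (a * fexp D u x + g x)\<bar> \<le> e"
        if t: "0 \<le> t" "t < min d1 d2" and x: "x \<in> D" for t x
      proof -
        have "\<bar>a * (P t (fexp D u) x - fexp D u x)\<bar> \<le> (\<bar>a\<bar> + 1) * (e / (2 * (\<bar>a\<bar> + 1)))"
          unfolding abs_mult using d1(2)[of t x] t x by (intro mult_mono) auto
        also have "m * (e / (2 * m)) = e / 2" if "m \<noteq> 0" for m using that by simp
        then have "(\<bar>a\<bar> + 1) * (e / (2 * (\<bar>a\<bar> + 1))) = e / 2" by (metis abs_ge_zero add_nonneg_pos less_irrefl zero_less_one)
        finally have "\<bar>a * (P t (fexp D u) x - fexp D u x)\<bar> \<le> e / 2" .
        moreover have "P t (\<lambda>x. a * fexp D u x + g x) x - (a * fexp D u x + g x) =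
            a * (P t (fexp D u) x - fexp D u x) + (P t g x - g x)"
          using posopD(2)[OF pP[OF t(1)] C] by (simp add: algebra_simps)
        ultimately show ?thesis using d2(2)[of t x] t x by linarith
      qed
      then show "\<exists>d>0. \<forall>t. 0 \<le> t \<and> t < d \<longrightarrow>
          (\<forall>x\<in>D. \<bar>P t (\<lambda>x. a * fexp D u x + g x) x - (a * fexp D u x + g x)\<bar> \<le> e)"
        using d1(1) d2(1) by (intro exI[of _ "min d1 d2"]) auto
    qed
  qed
  obtain g where g: "g \<in> expspan D" "\<And>x. x \<in> D \<Longrightarrow> \<bar>f x - g x\<bar> \<le> e / 3"
    using C0_dense[OF D f, of "e / 3"] e by auto
  have "0 < e / 3" using e by simp
  from span[OF g(1), rule_format, OF this]
  obtain d where d: "0 < d" "\<And>t x. 0 \<le> t \<Longrightarrow> t < d \<Longrightarrow> x \<in> D \<Longrightarrow> \<bar>P t g x - g x\<bar> \<le> e / 3"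
    by blast
  have "\<bar>P t f x - f x\<bar> \<le> e" if "0 \<le> t" "t < d" "x \<in> D" for t x
    using posop_approx[OF pP[OF that(1)] f expspan_subset_C0[OF D(2) g(1)] g(2) that(3)]
      g(2)[OF that(3)] d(2)[OF that] by linarith
  then show ?thesis using d(1) by blast
qed

text \<open>The operators are chosen for each time independently; uniqueness then forces them to
  form a semigroup.\<close>

lemma wishart_semigroup_exists:
  fixes D :: "(real^'n^'n) set"
  assumes D: "closed D" "D \<subseteq> Collect psd" and \<alpha>: "0 \<le> \<alpha>"
    and ex: "\<And>t. 0 \<le> t \<Longrightarrow> \<exists>Q. wishart_op D \<alpha> ((2 * t) *\<^sub>R mat 1) Q"
  shows "\<exists>P. wishart_semigroup D \<alpha> P"
proof -
  obtain P where P: "\<And>t. 0 \<le> t \<Longrightarrow> wishart_op D \<alpha> ((2 * t) *\<^sub>R mat 1) (P t)" using ex by metis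
  have pP: "posop D (P t)" if "0 \<le> t" for t using P[OF that] by (simp add: wishart_op_def)
  have P0: "P 0 f = f" if "f \<in> C0 D" for f
    using wishart_op_unique[OF D P[of 0] _ that, of "\<lambda>f. f"] wishart_op_id[of D \<alpha>] by simp
  have Pst: "P (s + t) f = P s (P t f)" if "0 \<le> s" "0 \<le> t" "f \<in> C0 D" for s t f
  proof (rule wishart_op_unique[OF D P _ that(3)])
    have "psd ((2 * t) *\<^sub>R mat 1 :: real^'n^'n)" if "0 \<le> t" for t
      using that by (intro psd_scaleR pd_imp_psd pd_mat_1) auto
    then have "wishart_op D \<alpha> ((2 * s) *\<^sub>R mat 1 + (2 * t) *\<^sub>R mat 1) (\<lambda>f. P s (P t f))"
      using that by (intro wishart_op_comp D P)
    then show "wishart_op D \<alpha> ((2 * (s + t)) *\<^sub>R mat 1) (\<lambda>f. P s (P t f))"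
      by (simp add: scaleR_add_left[symmetric] distrib_left)
  qed (use that in simp)
  have "pos_sc_contraction_semigroup D P"
    unfolding pos_sc_contraction_semigroup_def
  proof (intro conjI)
    show "\<forall>t\<ge>0. \<forall>f\<in>C0 D. P t f \<in> C0 D" using posopD(1)[OF pP] by blast
    show "\<forall>t\<ge>0. \<forall>f\<in>C0 D. \<forall>g\<in>C0 D. \<forall>a. P t (\<lambda>x. a * f x + g x) = (\<lambda>x. a * P t f x + P t g x)"
      using posopD(2)[OF pP] by simp
    show "\<forall>t\<ge>0. \<forall>f\<in>C0 D. (\<forall>x\<in>D. 0 \<le> f x) \<longrightarrow> (\<forall>x\<in>D. 0 \<le> P t f x)"
      using posopD(3)[OF pP] by simp
    show "\<forall>t\<ge>0. \<forall>f\<in>C0 D. \<forall>c. (\<forall>x\<in>D. \<bar>f x\<bar> \<le> c) \<longrightarrow> (\<forall>x\<in>D. \<bar>P t f x\<bar> \<le> c)"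
      using posopD(4)[OF pP] by simp
    show "\<forall>f\<in>C0 D. P 0 f = f" using P0 by simp
    show "\<forall>s\<ge>0. \<forall>t\<ge>0. \<forall>f\<in>C0 D. P (s + t) f = P s (P t f)" using Pst by simp
    show "\<forall>f\<in>C0 D. \<forall>e>0. \<exists>\<delta>>0. \<forall>t. 0 \<le> t \<and> t < \<delta> \<longrightarrow> (\<forall>x\<in>D. \<bar>P t f x - f x\<bar> \<le> e)"
      by (intro ballI allI impI wishart_op_strongly_continuous[OF D P P0])
  qed
  moreover have "P t (fexp D u) x = wfactor \<alpha> u t *
          exp (- trace (x ** wexponent u t))"
    if "pd u" "0 \<le> t" "x \<in> D" for u t x
    using wishart_op_fexp[OF D(2) P[OF that(2)] that] D(2) that(3)
    by (auto simp: trace_mul_sym[of x] trace_mult_eq_inner psdD)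
  ultimately show ?thesis using \<alpha> unfolding wishart_semigroup_def by blast
qed

text \<open>The diagonal directions may be treated one at a time because
  adding \<open>s + t\<close> to the inverse parameter is composition of the operators.\<close>

lemma wishart_op_from_coordinates:
  fixes D :: "(real^'n^'n) set"
  assumes D: "D \<subseteq> Collect psd" and t: "0 \<le> t"
    and ex: "\<And>i. \<exists>Q. wishart_op D \<alpha> (t *\<^sub>R outer (axis i 1)) Q"
  shows "\<exists>Q. wishart_op D \<alpha> (t *\<^sub>R mat 1) Q"
proof -
  have ps: "psd (t *\<^sub>R outer (axis i 1) :: real^'n^'n)" for i
    using t by (intro psd_scaleR) auto
  have "\<exists>Q. wishart_op D \<alpha> (\<Sum>i\<in>J. t *\<^sub>R outer (axis i 1)) Q" if "finite J" for J :: "'n set"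
    using that
  proof (induction J)
    case empty
    then show ?case using wishart_op_id[of D \<alpha>] by auto
  next
    case (insert i J)
    then obtain Q where "wishart_op D \<alpha> (\<Sum>i\<in>J. t *\<^sub>R outer (axis i 1)) Q" by blast
    moreover obtain R where "wishart_op D \<alpha> (t *\<^sub>R outer (axis i 1)) R" using ex by blast
    ultimately have "wishart_op D \<alpha> (t *\<^sub>R outer (axis i 1) + (\<Sum>i\<in>J. t *\<^sub>R outer (axis i 1))) (\<lambda>f. R (Q f))"
      by (intro wishart_op_comp D ps psd_sum)
    then show ?case using insert.hyps by auto
  qed
  moreover have "(\<Sum>i\<in>UNIV. t *\<^sub>R outer (axis i 1)) = (t *\<^sub>R mat 1 :: real^'n^'n)"
  proof -
    have "(\<Sum>i\<in>UNIV. (axis i 1 :: real^'n) $ a * axis i 1 $ b) = (mat 1 :: real^'n^'n) $ a $ b" for a b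
    proof -
      have "(\<Sum>i\<in>UNIV. (axis i 1 :: real^'n) $ a * axis i 1 $ b) = (\<Sum>i\<in>UNIV. if a = i then (if a = b then 1 else 0) else 0)"
        by (rule sum.cong) (auto simp: axis_def)
      then show ?thesis by (simp add: mat_def)
    qed
    then show ?thesis by (simp add: vec_eq_iff sum_distrib_left[symmetric])
  qed
  ultimately show ?thesis by (metis finite)
qed

section \<open>Squared Bessel and Gaussian laws\<close>

text \<open>Completing the square: the weighted density is a constant times the normal density with
  mean (m - 2 t b) / k and variance t / k, where k = 1 + 2 t a.\<close>

lemma normal_law_laplace:
  fixes t m :: real
  assumes t: "0 < t" and a: "0 \<le> a"
  shows "has_bochner_integral (density lborel (normal_density m (sqrt t))) (\<lambda>g. exp (- (a * g\<^sup>2 + 2 * b * g)))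
    ((1 + 2 * t * a) powr (- 1 / 2) * exp (- (a * m\<^sup>2 + 2 * b * m - 2 * t * b\<^sup>2) / (1 + 2 * t * a)))"
proof -
  define k where "k = 1 + 2 * t * a"
  have k: "0 < k" using t a by (simp add: k_def add_pos_nonneg)
  define m' where "m' = (m - 2 * t * b) / k"
  define C where "C = k powr (- 1 / 2) * exp (- (a * m\<^sup>2 + 2 * b * m - 2 * t * b\<^sup>2) / k)"
  have ak: "a = (k - 1) / (2 * t)" using t by (simp add: k_def)
  have "normal_density m (sqrt t) g * exp (- (a * g\<^sup>2 + 2 * b * g)) = C * normal_density m' (sqrt (t / k)) g" for g
  proof -
    have e: "- (g - m)\<^sup>2 / (2 * t) - (a * g\<^sup>2 + 2 * b * g)
        = - (a * m\<^sup>2 + 2 * b * m - 2 * t * b\<^sup>2) / k - (g - m')\<^sup>2 / (2 * (t / k))"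
      unfolding ak m'_def using t k by (simp add: field_simps power2_eq_square)
    have "sqrt (2 * pi * (t / k)) = sqrt (2 * pi * t) * k powr (- 1 / 2)"
    proof -
      have "2 * pi * (t / k) = (2 * pi * t) / k" by simp
      then have "sqrt (2 * pi * (t / k)) = sqrt (2 * pi * t) / sqrt k" by (simp only: real_sqrt_divide)
      then show ?thesis using k by (simp add: powr_minus_divide powr_half_sqrt)
    qed
    then have s: "1 / sqrt (2 * pi * t) = k powr (- 1 / 2) * (1 / sqrt (2 * pi * (t / k)))"
      using k by simp
    have f: "x * exp X * exp (- Y) = x * exp (X - Y)" for x X Y :: real
      by (simp add: exp_diff exp_minus divide_inverse)
    have "normal_density m (sqrt t) g * exp (- (a * g\<^sup>2 + 2 * b * g)) =
        1 / sqrt (2 * pi * t) * exp (- (g - m)\<^sup>2 / (2 * t) - (a * g\<^sup>2 + 2 * b * g))"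
      unfolding normal_density_def f using t by simp
    also have "\<dots> = k powr (- 1 / 2) * (1 / sqrt (2 * pi * (t / k))) *
        exp (- (a * m\<^sup>2 + 2 * b * m - 2 * t * b\<^sup>2) / k) * exp (- ((g - m')\<^sup>2 / (2 * (t / k))))"
      unfolding e s f ..
    also have "\<dots> = C * normal_density m' (sqrt (t / k)) g"
      unfolding C_def normal_density_def using t k by simp
    finally show ?thesis .
  qed
  moreover have "has_bochner_integral lborel (\<lambda>g. C * normal_density m' (sqrt (t / k)) g) (C * 1)"
    using t k by (intro has_bochner_integral_mult_right) (simp add: has_bochner_integral_iff)
  ultimately show ?thesis
    by (intro has_bochner_integral_density) (auto simp: C_def k_def)
qed

lemma nn_integral_Gamma_scaled:
  assumes \<beta>: "0 < \<beta>" and c: "0 < c"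
  shows "(\<integral>\<^sup>+x. ennreal (indicator {0..} x * x powr (\<beta> - 1) * exp (- (c * x))) \<partial>lborel) = ennreal (Gamma \<beta> / c powr \<beta>)"
proof -
  let ?I = "\<integral>\<^sup>+x. ennreal (indicator {0..} x * x powr (\<beta> - 1) * exp (- (c * x))) \<partial>lborel"
  have "ennreal (Gamma \<beta>) = ennreal c * (\<integral>\<^sup>+x. ennreal (indicator {0..} (0 + c * x) * (0 + c * x) powr (\<beta> - 1) / exp (0 + c * x)) \<partial>lborel)"
    unfolding Gamma_conv_nn_integral_real[OF \<beta>]
    by (subst nn_integral_real_affine[where c = c and t = 0]) (use c in auto)
  also have "(\<integral>\<^sup>+x. ennreal (indicator {0..} (0 + c * x) * (0 + c * x) powr (\<beta> - 1) / exp (0 + c * x)) \<partial>lborel)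
      = (\<integral>\<^sup>+x. ennreal (c powr (\<beta> - 1)) * ennreal (indicator {0..} x * x powr (\<beta> - 1) * exp (- (c * x))) \<partial>lborel)"
    using c by (intro nn_integral_cong)
      (auto simp: ennreal_mult[symmetric] indicator_def powr_mult exp_minus zero_le_mult_iff field_simps)
  also have "\<dots> = ennreal (c powr (\<beta> - 1)) * ?I" by (rule nn_integral_cmult) measurable
  also have "ennreal c * (ennreal (c powr (\<beta> - 1)) * ?I) = ennreal (c powr \<beta>) * ?I"
    using c by (simp add: mult.assoc[symmetric] ennreal_mult[symmetric] powr_diff)
  finally have "ennreal (1 / c powr \<beta>) * ennreal (Gamma \<beta>) = ennreal (1 / c powr \<beta>) * (ennreal (c powr \<beta>) * ?I)" by simp
  also have "\<dots> = ?I" using c by (simp add: mult.assoc[symmetric] ennreal_mult[symmetric])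
  finally show ?thesis using c \<beta> by (simp add: ennreal_mult[symmetric] Gamma_real_nonneg)
qed

text \<open>The law of the square root of a squared Bessel process of dimension \<open>\<delta>\<close> started at \<open>s\<close>.\<close>

definition bessel_law :: "real \<Rightarrow> real \<Rightarrow> real \<Rightarrow> real measure \<Rightarrow> bool" where
  "bessel_law t \<delta> s M \<longleftrightarrow> sets M = sets borel \<and> (\<forall>a\<ge>0. (\<integral>\<^sup>+g. ennreal (exp (- (a * g\<^sup>2))) \<partial>M)
     = ennreal ((1 + 2 * t * a) powr (- \<delta> / 2) * exp (- (a * s) / (1 + 2 * t * a))))"

lemma bessel_law_prob_space:
  assumes "bessel_law t \<delta> s M" shows "prob_space M"
proof
  have "(\<integral>\<^sup>+g. ennreal (exp (- (0 * g\<^sup>2))) \<partial>M) = ennreal ((1 + 2 * t * 0) powr (- \<delta> / 2) * exp (- (0 * s) / (1 + 2 * t * 0)))"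
    using assms unfolding bessel_law_def by blast
  then show "emeasure M (space M) = 1" by simp
qed

lemma bessel_law_return:
  assumes t: "0 < t"
  shows "bessel_law t 0 0 (return borel 0)"
  unfolding bessel_law_def
proof (intro conjI allI impI)
  fix a :: real assume "0 \<le> a"
  then have "1 + 2 * t * a \<noteq> 0" using t by (smt (verit) mult_nonneg_nonneg)
  then show "(\<integral>\<^sup>+g. ennreal (exp (- (a * g\<^sup>2))) \<partial>return borel 0) =
     ennreal ((1 + 2 * t * a) powr (- 0 / 2) * exp (- (a * 0) / (1 + 2 * t * a)))"
    by (subst nn_integral_return) auto
qed simp

text \<open>The image under \<open>sqrt\<close> of the Gamma law with shape \<delta> / 2 and rate 1
  / (2 t); for \<delta> = 0 it degenerates to the point mass at 0.\<close>

lemma bessel_law_from_zero: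
  assumes t: "0 < t" and \<delta>: "0 \<le> \<delta>"
  shows "\<exists>M. bessel_law t \<delta> 0 M"
proof (cases "\<delta> = 0")
  case True
  then show ?thesis using bessel_law_return[OF t] by auto
next
  case False
  define \<beta> where "\<beta> = \<delta> / 2"
  have \<beta>: "0 < \<beta>" using False \<delta> by (simp add: \<beta>_def)
  define c where "c = 1 / (2 * t)"
  have c: "0 < c" using t by (simp add: c_def)
  have G: "0 < Gamma \<beta>" using \<beta> by (simp add: Gamma_real_pos)
  define h where "h x = indicator {0..} x * x powr (\<beta> - 1) * exp (- (c * x)) * (c powr \<beta> / Gamma \<beta>)" for x :: real
  have hm[measurable]: "h \<in> borel_measurable borel" unfolding h_def by measurable
  have h0: "0 \<le> h x" for x using G by (simp add: h_def indicator_def)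
  let ?M = "distr (density lborel (\<lambda>x. ennreal (h x))) borel sqrt"
  have "bessel_law t \<delta> 0 ?M"
    unfolding bessel_law_def
  proof (intro conjI allI impI)
    fix a :: real assume a: "0 \<le> a"
    have "(\<integral>\<^sup>+g. ennreal (exp (- (a * g\<^sup>2))) \<partial>?M) = (\<integral>\<^sup>+x. ennreal (h x) * ennreal (exp (- (a * (sqrt x)\<^sup>2))) \<partial>lborel)"
      by (simp add: nn_integral_distr nn_integral_density)
    also have "\<dots> = (\<integral>\<^sup>+x. ennreal (c powr \<beta> / Gamma \<beta>) * ennreal (indicator {0..} x * x powr (\<beta> - 1) * exp (- ((c + a) * x))) \<partial>lborel)"
    proof (intro nn_integral_cong)
      fix x :: real
      have "h x * exp (- (a * (sqrt x)\<^sup>2)) = c powr \<beta> / Gamma \<beta> * (indicator {0..} x * x powr (\<beta> - 1) * exp (- ((c + a) * x)))"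
      proof (cases "0 \<le> x")
        case True
        have "exp (- ((c + a) * x)) = exp (- (c * x)) * exp (- (a * x))"
          by (simp add: mult_exp_exp algebra_simps)
        then show ?thesis using True by (simp add: h_def)
      qed (simp add: h_def)
      then show "ennreal (h x) * ennreal (exp (- (a * (sqrt x)\<^sup>2))) = ennreal (c powr \<beta> / Gamma \<beta>) *
          ennreal (indicator {0..} x * x powr (\<beta> - 1) * exp (- ((c + a) * x)))"
        using h0[of x] G by (simp add: ennreal_mult[symmetric])
    qed
    also have "\<dots> = ennreal (c powr \<beta> / Gamma \<beta>) * (\<integral>\<^sup>+x. ennreal (indicator {0..} x * x powr (\<beta> - 1) * exp (- ((c + a) * x))) \<partial>lborel)"
      by (rule nn_integral_cmult) measurable
    also have "\<dots> = ennreal (c powr \<beta> / Gamma \<beta>) * ennreal (Gamma \<beta> / (c + a) powr \<beta>)"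
      using nn_integral_Gamma_scaled[OF \<beta>, of "c + a"] c a by (simp only: add_pos_nonneg)
    also have "\<dots> = ennreal (c powr \<beta> / Gamma \<beta> * (Gamma \<beta> / (c + a) powr \<beta>))"
      using G by (intro ennreal_mult[symmetric]) auto
    also have "c powr \<beta> / Gamma \<beta> * (Gamma \<beta> / (c + a) powr \<beta>) = (c / (c + a)) powr \<beta>"
      using G c a by (simp add: powr_divide)
    also have "c / (c + a) = inverse (1 + 2 * t * a)"
      using t a by (simp add: c_def field_simps add_pos_nonneg)
    also have "inverse (1 + 2 * t * a) powr \<beta> = (1 + 2 * t * a) powr (- \<delta> / 2)"
      using t a by (simp add: \<beta>_def powr_minus inverse_powr)
    finally show "(\<integral>\<^sup>+g. ennreal (exp (- (a * g\<^sup>2))) \<partial>?M) =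
       ennreal ((1 + 2 * t * a) powr (- \<delta> / 2) * exp (- (a * 0) / (1 + 2 * t * a)))" by simp
  qed simp
  then show ?thesis by blast
qed

text \<open>A noncentral chi-square law is a Poisson mixture of central ones: dimension \<delta> + 2
  n started at 0, with n Poisson of mean s / (2 t). The Poisson generating function produces the
  factor involving \<open>s\<close>.\<close>

lemma bessel_law_exists:
  assumes t: "0 < t" and \<delta>: "0 \<le> \<delta>" and s: "0 \<le> s"
  shows "\<exists>M. bessel_law t \<delta> s M"
proof (cases "s = 0")
  case True
  then show ?thesis using bessel_law_from_zero[OF t \<delta>] by simp
next
  case False
  define r where "r = s / (2 * t)"
  have r: "0 < r" using False s t by (simp add: r_def)
  have "\<exists>M. bessel_law t (\<delta> + 2 * real n) 0 M" for n using t \<delta> by (intro bessel_law_from_zero) auto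
  then obtain N where N: "\<And>n::nat. bessel_law t (\<delta> + 2 * real n) 0 (N n)" by metis
  have Nm: "N \<in> measurable (measure_pmf (poisson_pmf r)) (subprob_algebra borel)"
  proof -
    have "subprob_space (N n)" for n by (intro prob_space_imp_subprob_space bessel_law_prob_space[OF N])
    moreover have "sets (N n) = sets borel" for n using N[of n] by (simp add: bessel_law_def)
    ultimately show ?thesis by (simp add: measurable_def space_subprob_algebra)
  qed
  let ?M = "measure_pmf (poisson_pmf r) \<bind> N"
  have "bessel_law t \<delta> s ?M"
    unfolding bessel_law_def
  proof (intro conjI allI impI)
    show "sets ?M = sets borel" by (rule sets_bind[where N = borel]) (use N in \<open>auto simp: bessel_law_def\<close>)
    fix a :: real assume a: "0 \<le> a"
    define k where "k = 1 + 2 * t * a"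
    have k: "0 < k" using t a by (simp add: k_def add_pos_nonneg)
    have "(\<integral>\<^sup>+g. ennreal (exp (- (a * g\<^sup>2))) \<partial>?M) =
        (\<integral>\<^sup>+n. \<integral>\<^sup>+g. ennreal (exp (- (a * g\<^sup>2))) \<partial>N n \<partial>measure_pmf (poisson_pmf r))"
      by (rule nn_integral_bind[OF _ Nm]) measurable
    also have "\<dots> = (\<integral>\<^sup>+n. ennreal (k powr (- (\<delta> + 2 * real n) / 2)) \<partial>measure_pmf (poisson_pmf r))"
      using N a by (intro nn_integral_cong) (simp add: bessel_law_def k_def)
    also have "\<dots> = (\<Sum>n. ennreal (k powr (- \<delta> / 2) * exp (- r) * ((r / k) ^ n /\<^sub>R fact n)))"
      unfolding nn_integral_measure_pmf nn_integral_count_space_nat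
    proof (intro suminf_cong)
      fix n
      have "k powr (- (\<delta> + 2 * real n) / 2) = k powr (- \<delta> / 2 + - real n)"
        by (rule arg_cong[of _ _ "(powr) k"]) (simp add: field_simps)
      also have "\<dots> = k powr (- \<delta> / 2) * k powr (- real n)" by (rule powr_add)
      also have "k powr (- real n) = 1 / k ^ n" using k by (simp add: powr_minus_divide powr_realpow)
      finally have p: "k powr (- (\<delta> + 2 * real n) / 2) = k powr (- \<delta> / 2) * (1 / k ^ n)" .
      have "pmf (poisson_pmf r) n * (k powr (- \<delta> / 2) * (1 / k ^ n)) =
          k powr (- \<delta> / 2) * exp (- r) * ((r / k) ^ n /\<^sub>R fact n)"
        using r k by (simp add: power_divide field_simps)
      then show "ennreal (pmf (poisson_pmf r) n) * ennreal (k powr (- (\<delta> + 2 * real n) / 2)) =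
          ennreal (k powr (- \<delta> / 2) * exp (- r) * ((r / k) ^ n /\<^sub>R fact n))"
        unfolding p by (subst ennreal_mult[symmetric]) (use k in auto)
    qed
    also have "\<dots> = ennreal (k powr (- \<delta> / 2) * exp (- r) * exp (r / k))"
      using r k by (intro suminf_ennreal_eq sums_mult exp_converges) auto
    also have "k powr (- \<delta> / 2) * exp (- r) * exp (r / k) = k powr (- \<delta> / 2) * exp (- (a * s) / k)"
    proof -
      have "- r + r / k = - (a * s) / k"
        using t k by (simp add: r_def field_simps) (simp add: k_def algebra_simps)
      then show ?thesis by (simp add: mult_exp_exp mult.assoc)
    qed
    finally show "(\<integral>\<^sup>+g. ennreal (exp (- (a * g\<^sup>2))) \<partial>?M) =
       ennreal ((1 + 2 * t * a) powr (- \<delta> / 2) * exp (- (a * s) / (1 + 2 * t * a)))"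
      by (simp add: k_def)
  qed
  then show ?thesis by blast
qed

text \<open>The law of one moved entry of a factor, started at \<open>m\<close> and contributing
  \<delta> to the total dimension. The transform with the linear term 2 b g is demanded only under
  \<open>lin\<close>; a Bessel entry is controlled only through its square and serves where b =
  0.\<close>

definition update_law :: "real \<Rightarrow> real \<Rightarrow> real \<Rightarrow> bool \<Rightarrow> real measure \<Rightarrow> bool" where
  "update_law t \<delta> m lin M \<longleftrightarrow> prob_space M \<and> sets M = sets borel \<and>
    (\<forall>a b. 0 \<le> a \<longrightarrow> b = 0 \<or> lin \<longrightarrow> has_bochner_integral M (\<lambda>g. exp (- (a * g\<^sup>2 + 2 * b * g)))
      ((1 + 2 * t * a) powr (- \<delta> / 2) * exp (- (a * m\<^sup>2 + 2 * b * m - 2 * t * b\<^sup>2) / (1 + 2 * t * a))))"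

lemma update_law_normal:
  "0 < t \<Longrightarrow> update_law t 1 m sh (density lborel (normal_density m (sqrt t)))"
  unfolding update_law_def using normal_law_laplace[of t _ m] prob_space_normal_density[of "sqrt t" m]
  by simp

lemma update_law_bessel:
  assumes "bessel_law t \<delta> (m\<^sup>2) M"
  shows "update_law t \<delta> m False M"
  unfolding update_law_def
proof (intro conjI allI impI bessel_law_prob_space[OF assms])
  show s: "sets M = sets borel" using assms by (simp add: bessel_law_def)
  fix a b :: real assume a: "0 \<le> a" and "b = 0 \<or> False"
  then have b: "b = 0" by simp
  have "(\<lambda>g. exp (- (a * g\<^sup>2))) \<in> borel_measurable borel" by measurable
  then have "(\<lambda>g. exp (- (a * g\<^sup>2))) \<in> borel_measurable M" using s measurable_cong_sets by blast
  then show "has_bochner_integral M (\<lambda>g. exp (- (a * g\<^sup>2 + 2 * b * g)))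
      ((1 + 2 * t * a) powr (- \<delta> / 2) * exp (- (a * m\<^sup>2 + 2 * b * m - 2 * t * b\<^sup>2) / (1 + 2 * t * a)))"
    using assms a unfolding bessel_law_def b
    by (intro has_bochner_integral_nn_integral) auto
qed

section \<open>Existence\<close>

text \<open>The prescribed transform is that of a Wishart operator with increment 2 t e_i e_i^T,
  rewritten from w to u by the rank-one update formulas.\<close>

definition has_row_kernel :: "(real^'n^'n) set \<Rightarrow> real \<Rightarrow> real \<Rightarrow> 'n \<Rightarrow> real^'n^'n \<Rightarrow> bool" where
  "has_row_kernel D \<alpha> t i x \<longleftrightarrow> (\<exists>N. prob_space N \<and> sets N = sets borel \<and> (AE y in N. y \<in> D) \<and>
      (\<forall>u. pd u \<longrightarrow> (\<integral>y. exp (- (u \<bullet> y)) \<partial>N) = (1 + 2 * t * u $ i $ i) powr (- \<alpha> / 2) *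
        exp (- ((u - (2 * t / (1 + 2 * t * u $ i $ i)) *\<^sub>R outer (u *v axis i 1)) \<bullet> x))))"

text \<open>Replacing row \<open>i\<close> of a factor \<open>q\<close> of \<open>x = q q\<^sup>T\<close> by independent random entries;
  the columns of \<open>q\<close> are the vectors \<open>w l\<close>.\<close>

lemma row_update_kernel:
  fixes w :: "'n::finite \<Rightarrow> real^'n" and M :: "'n \<Rightarrow> real measure"
  assumes t: "0 < t" and M: "\<And>l. update_law t (\<delta> l) (w l $ i) (l \<in> K) (M l)"
    and off: "\<And>l j. l \<notin> K \<Longrightarrow> j \<noteq> i \<Longrightarrow> w l $ j = 0"
    and D: "closed D"
    and inD: "AE \<omega> in PiM UNIV M. (\<Sum>l\<in>UNIV. outer (w l + (\<omega> l - w l $ i) *\<^sub>R axis i 1)) \<in> D"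
  shows "has_row_kernel D (\<Sum>l\<in>UNIV. \<delta> l) t i (\<Sum>l\<in>UNIV. outer (w l))"
proof -
  have pM: "prob_space (M l)" and sM: "sets (M l) = sets borel" for l
    using M[of l] by (auto simp: update_law_def)
  interpret product_prob_space M UNIV by (intro product_prob_spaceI pM)
  interpret P: prob_space "PiM UNIV M" by (rule prob_space_PiM[OF pM])
  define Y where "Y \<omega> = (\<Sum>l\<in>UNIV. outer (w l + (\<omega> l - w l $ i) *\<^sub>R axis i 1))" for \<omega> :: "'n \<Rightarrow> real"
  have co: "(\<lambda>\<omega>. \<omega> l) \<in> borel_measurable (PiM UNIV M)" for l
    using measurable_component_singleton[of l UNIV M] measurable_cong_sets[OF refl sM[of l], of "PiM UNIV M"]
    by blast
  have Ym: "Y \<in> borel_measurable (PiM UNIV M)"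
  proof (rule borel_measurable_euclidean_space[THEN iffD2], rule ballI)
    fix b :: "real^'n^'n" assume "b \<in> Basis"
    then obtain r s where b: "b = axis r (axis s 1)"
      unfolding Basis_vec_def Basis_real_def by blast
    have Yb: "Y \<omega> \<bullet> b = (\<Sum>l\<in>UNIV. (w l $ r + (\<omega> l - w l $ i) * axis i 1 $ r) * (w l $ s + (\<omega> l - w l $ i) * axis i 1 $ s))" for \<omega>
      unfolding Y_def inner_sum_left b inner_axis by simp
    show "(\<lambda>\<omega>. Y \<omega> \<bullet> b) \<in> borel_measurable (PiM UNIV M)"
      unfolding Yb
      by (intro borel_measurable_sum borel_measurable_times borel_measurable_add borel_measurable_diff
          borel_measurable_const co)
  qed
  let ?N = "distr (PiM UNIV M) borel Y"
  show ?thesis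
    unfolding has_row_kernel_def
  proof (intro exI[of _ ?N] conjI allI impI)
    show "prob_space ?N" by (rule P.prob_space_distr[OF Ym])
    show "sets ?N = sets borel" by simp
    show "AE y in ?N. y \<in> D"
      using inD D by (subst AE_distr_iff[OF Ym]) (auto simp: Y_def borel_closed)
    fix u :: "real^'n^'n" assume u: "pd u"
    define a where "a = u $ i $ i"
    have a: "0 \<le> a" unfolding a_def by (rule psd_diag_nonneg[OF pd_imp_psd[OF u]])
    define k where "k = 1 + 2 * t * a"
    have k: "0 < k" using t a by (simp add: k_def add_pos_nonneg)
    let ?e = "axis i 1 :: real^'n"
    \<comment> \<open>\<open>c l\<close> is the column without row \<open>i\<close>, which stays
      fixed; \<open>b l\<close> is its coupling under \<open>u\<close> to the random entry.\<close>
    define c where "c l = w l - (w l $ i) *\<^sub>R ?e" for l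
    define b where "b l = ?e \<bullet> (u *v c l)" for l
    have c0: "c l = 0" if "l \<notin> K" for l
      using off[OF that] by (auto simp: c_def vec_eq_iff axis_def)
    have sy: "c l \<bullet> (u *v ?e) = b l" for l unfolding b_def by (rule sym_inner[OF pdD(1)[OF u]])
    have quad: "(c l + g *\<^sub>R ?e) \<bullet> (u *v (c l + g *\<^sub>R ?e)) = c l \<bullet> (u *v c l) + (a * g\<^sup>2 + 2 * b l * g)" for l g
      by (simp add: inner_add_left inner_add_right matrix_vector_right_distrib matrix_vector_mult_scaleR
          inner_axis_mult_axis sy b_def[symmetric] a_def[symmetric] power2_eq_square algebra_simps)
    have wc: "w l + (g - w l $ i) *\<^sub>R ?e = c l + g *\<^sub>R ?e" for l g by (simp add: c_def algebra_simps)
    \<comment> \<open>The exponent is a sum over columns, each involving a single random entry, so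
      the integral over the product measure factorises.\<close>
    have uY: "exp (- (u \<bullet> Y \<omega>)) = (\<Prod>l\<in>UNIV. exp (- (c l \<bullet> (u *v c l))) * exp (- (a * (\<omega> l)\<^sup>2 + 2 * b l * \<omega> l)))" for \<omega>
      unfolding Y_def inner_sum_right inner_outer wc quad sum_negf[symmetric]
      by (simp add: exp_sum mult_exp_exp algebra_simps)
    define I where "I l = k powr (- \<delta> l / 2) * exp (- (a * (w l $ i)\<^sup>2 + 2 * b l * (w l $ i) - 2 * t * (b l)\<^sup>2) / k)" for l
    have hI: "has_bochner_integral (M l) (\<lambda>g. exp (- (a * g\<^sup>2 + 2 * b l * g))) (I l)" for l
    proof -
      \<comment> \<open>Off \<open>K\<close> the fixed part of the column is zero, so no linear term
        occurs and control of the square of the entry suffices.\<close>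
      have "b l = 0 \<or> l \<in> K" using c0[of l] by (auto simp: b_def)
      then show ?thesis using M[of l] a unfolding update_law_def I_def k_def by blast
    qed
    have "(\<integral>y. exp (- (u \<bullet> y)) \<partial>?N) = (\<integral>\<omega>. exp (- (u \<bullet> Y \<omega>)) \<partial>PiM UNIV M)"
      by (rule integral_distr[OF Ym]) measurable
    also have "\<dots> = (\<Prod>l\<in>UNIV. \<integral>g. exp (- (c l \<bullet> (u *v c l))) * exp (- (a * g\<^sup>2 + 2 * b l * g)) \<partial>M l)"
      unfolding uY using hI
      by (intro product_integral_prod integrable_mult_right) (auto simp: has_bochner_integral_iff)
    also have "\<dots> = (\<Prod>l\<in>UNIV. exp (- (c l \<bullet> (u *v c l))) * I l)"
      using hI by (intro prod.cong refl) (simp add: has_bochner_integral_iff)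
    also have "\<dots> = (\<Prod>l\<in>UNIV. k powr (- \<delta> l / 2) *
        exp (- ((u - (2 * t / k) *\<^sub>R outer (u *v ?e)) \<bullet> outer (w l))))"
    proof (intro prod.cong refl)
      fix l
      define m where "m = w l $ i"
      have w: "w l = c l + m *\<^sub>R ?e" by (simp add: c_def m_def)
      have 1: "w l \<bullet> (u *v w l) = c l \<bullet> (u *v c l) + (a * m\<^sup>2 + 2 * b l * m)"
        unfolding w by (rule quad)
      have 2: "(u *v ?e) \<bullet> w l = b l + a * m"
        unfolding w by (simp add: inner_add_right inner_commute[of "u *v ?e"] sy inner_axis_mult_axis a_def mult.commute)
      have "(u - (2 * t / k) *\<^sub>R outer (u *v ?e)) \<bullet> outer (w l) = w l \<bullet> (u *v w l) - (2 * t / k) * ((u *v ?e) \<bullet> w l)\<^sup>2"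
        by (simp only: matrix_vector_mult_diff_rdistrib scaleR_matrix_vector_assoc[symmetric] inner_diff_right inner_outer outer_mult_vec inner_scaleR_right
            power2_eq_square inner_commute[of "w l" "u *v ?e"])
      also have "\<dots> = c l \<bullet> (u *v c l) + ((a * m\<^sup>2 + 2 * b l * m) - (2 * t / k) * (b l + a * m)\<^sup>2)"
        unfolding 1 2 by simp
      \<comment> \<open>The quotient by \<open>k\<close> delivered by the entry law is exactly the
        rank-one correction of the Sherman-Morrison formula.\<close>
      also have "(a * m\<^sup>2 + 2 * b l * m) - (2 * t / k) * (b l + a * m)\<^sup>2 = (a * m\<^sup>2 + 2 * b l * m - 2 * t * (b l)\<^sup>2) / k"
        using k by (simp add: field_simps) (simp add: k_def power2_eq_square algebra_simps)
      finally have q: "(u - (2 * t / k) *\<^sub>R outer (u *v ?e)) \<bullet> outer (w l) =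
        c l \<bullet> (u *v c l) + (a * m\<^sup>2 + 2 * b l * m - 2 * t * (b l)\<^sup>2) / k" .
      show "exp (- (c l \<bullet> (u *v c l))) * I l = k powr (- \<delta> l / 2) *
        exp (- ((u - (2 * t / k) *\<^sub>R outer (u *v ?e)) \<bullet> outer (w l)))"
        unfolding q I_def m_def[symmetric] minus_add_distrib exp_add minus_divide_left
        by (simp only: mult.left_commute)
    qed
    also have "\<dots> = (\<Prod>l\<in>UNIV. k powr (- \<delta> l / 2)) * exp (- ((u - (2 * t / k) *\<^sub>R outer (u *v ?e)) \<bullet> (\<Sum>l\<in>UNIV. outer (w l))))"
      by (simp add: prod.distrib exp_sum[symmetric] inner_sum_right sum_negf)
    also have "(\<Prod>l\<in>UNIV. k powr (- \<delta> l / 2)) = k powr (- (\<Sum>l\<in>UNIV. \<delta> l) / 2)"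
      using k by (subst powr_sum[symmetric]) (auto simp: sum_negf[symmetric] sum_divide_distrib)
    finally show "(\<integral>y. exp (- (u \<bullet> y)) \<partial>?N) = (1 + 2 * t * u $ i $ i) powr (- (\<Sum>l\<in>UNIV. \<delta> l) / 2) *
      exp (- ((u - (2 * t / (1 + 2 * t * u $ i $ i)) *\<^sub>R outer (u *v axis i 1)) \<bullet> (\<Sum>l\<in>UNIV. outer (w l))))"
      by (simp add: k_def a_def)
  qed
qed

lemma wishart_op_of_kernel:
  fixes D :: "(real^'n^'n) set"
  assumes D: "closed D" "D \<subseteq> Collect psd" and t: "0 \<le> t"
    and kernel: "\<And>x. x \<in> D \<Longrightarrow> has_row_kernel D \<alpha> t i x"
  shows "\<exists>Q. wishart_op D \<alpha> ((2 * t) *\<^sub>R outer (axis i 1)) Q"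
proof -
  let ?T = "\<lambda>u. u - (2 * t / (1 + 2 * t * u $ i $ i)) *\<^sub>R outer (u *v axis i 1)"
  have t2: "0 \<le> 2 * t" using t by simp
  have T: "matrix_inv (w + (2 * t) *\<^sub>R outer (axis i 1)) = ?T (matrix_inv w)"
    and d: "det (w + (2 * t) *\<^sub>R outer (axis i 1)) = (1 + 2 * t * matrix_inv w $ i $ i) * det w"
    if "pd w" for w :: "real^'n^'n"
    using pd_rank_one_update[OF that t2, of i] by auto
  have pT: "pd (?T u)" if u: "pd u" for u
  proof -
    have "pd (matrix_inv u + (2 * t) *\<^sub>R outer (axis i 1))"
      using t2 by (intro pd_add_psd pd_matrix_inv u psd_scaleR) auto
    from pd_matrix_inv(1)[OF this] show ?thesis
      unfolding T[OF pd_matrix_inv(1)[OF u]] pd_matrix_inv(2)[OF u] .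
  qed
  from posop_of_kernel[OF D pT kernel[unfolded has_row_kernel_def]] obtain Q where Q: "posop D Q"
    "\<And>u. pd u \<Longrightarrow> Q (fexp D u) = (\<lambda>x. (1 + 2 * t * u $ i $ i) powr (- \<alpha> / 2) * fexp D (?T u) x)"
    by blast
  have "Q (fexp D (matrix_inv w)) = (\<lambda>x. (det (w + (2 * t) *\<^sub>R outer (axis i 1)) / det w) powr (- \<alpha> / 2) *
      fexp D (matrix_inv (w + (2 * t) *\<^sub>R outer (axis i 1))) x)" if w: "pd w" for w
    unfolding Q(2)[OF pd_matrix_inv(1)[OF w]] T[OF w] d[OF w] using pd_det_pos[OF w] by simp
  then show ?thesis using Q(1) unfolding wishart_op_def by blast
qed

lemma wishart_exists_if_coordinate_kernels:
  fixes D :: "(real^'n^'n) set"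
  assumes D: "closed D" "D \<subseteq> Collect psd" and \<alpha>: "0 \<le> \<alpha>"
    and kernel: "\<And>x t i. x \<in> D \<Longrightarrow> 0 < t \<Longrightarrow> has_row_kernel D \<alpha> t i x"
  shows "\<exists>P. wishart_semigroup D \<alpha> P"
proof (rule wishart_semigroup_exists[OF D \<alpha>])
  fix t :: real assume t: "0 \<le> t"
  show "\<exists>Q. wishart_op D \<alpha> ((2 * t) *\<^sub>R mat 1) Q"
  proof (cases "t = 0")
    case True
    then show ?thesis using wishart_op_id[of D \<alpha>] by auto
  next
    case False
    then have "0 < t" using t by simp
    then show ?thesis
      by (intro wishart_op_from_coordinates[OF D(2)] wishart_op_of_kernel[OF D] kernel) auto
  qed
qed

lemma wishart_exists_low_rank:
  assumes k: "k \<le> CARD('n::finite)"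
  shows "\<exists>P. wishart_semigroup (Dpk k :: (real^'n^'n) set) (real k) P"
proof (rule wishart_exists_if_coordinate_kernels)
  show "closed (Dpk k :: (real^'n^'n) set)" by (rule closed_Dpk[OF k])
  show "Dpk k \<subseteq> Collect (psd :: real^'n^'n \<Rightarrow> bool)" by (auto simp: Dpk_def)
  obtain K :: "'n set" where K: "card K = k" using obtain_card_UNIV[OF k] .
  note De = Dpk_eq_sum_outer[OF K]
  fix x :: "real^'n^'n" and t :: real and i :: 'n
  assume "x \<in> Dpk k" and t: "0 < t"
  then obtain W where W: "\<And>l. l \<notin> K \<Longrightarrow> W $ l = 0" and x: "x = (\<Sum>l\<in>UNIV. outer (W $ l))"
    unfolding De by blast
  \<comment> \<open>Vectors outside \<open>K\<close> are zero and must remain zero to preserve the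
    rank bound, so their moved entry has the point mass at 0, of dimension 0. The Gaussian entries
    contribute 1 each, in total \<open>k\<close>.\<close>
  define M where "M l = (if l \<in> K then density lborel (normal_density (W $ l $ i) (sqrt t)) else return borel 0)" for l
  define \<delta> where "\<delta> l = (if l \<in> K then 1 else 0 :: real)" for l
  have M: "update_law t (\<delta> l) (W $ l $ i) (l \<in> K) (M l)" for l
    using update_law_normal[OF t] update_law_bessel[of t 0 0 "return borel 0"] bessel_law_return[OF t] W[of l]
    by (auto simp: M_def \<delta>_def)
  have pM: "prob_space (M l)" for l using M[of l] by (simp add: update_law_def)
  have "AE \<omega> in PiM UNIV M. \<forall>l\<in>-K. \<omega> l = 0"
  proof (rule AE_finite_allI)
    fix l assume l: "l \<in> - K"
    have Ml: "M l = return borel 0" using l by (simp add: M_def)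
    have "AE g in M l. g = 0" unfolding Ml by (subst AE_return) auto
    then show "AE \<omega> in PiM UNIV M. \<omega> l = 0" by (intro AE_PiM_component pM) auto
  qed simp
  then have "AE \<omega> in PiM UNIV M. (\<Sum>l\<in>UNIV. outer (W $ l + (\<omega> l - W $ l $ i) *\<^sub>R axis i 1)) \<in> Dpk k"
  proof eventually_elim
    case (elim \<omega>)
    let ?V = "\<chi> l. W $ l + (\<omega> l - W $ l $ i) *\<^sub>R axis i 1"
    show ?case unfolding De by (rule image_eqI[of _ _ ?V]) (use elim W in auto)
  qed
  moreover have "(\<Sum>l\<in>UNIV. \<delta> l) = real k" using K by (simp add: \<delta>_def sum.If_cases)
  ultimately show "has_row_kernel (Dpk k) (real k) t i x"
    using row_update_kernel[where w = "\<lambda>l. W $ l" and i = i and K = K, OF t M _ closed_Dpk[OF k]] W x by simp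
qed simp

lemma Dpk_full: "Dpk CARD('n) = Collect (psd :: real^'n^'n \<Rightarrow> bool)"
  using rank_bound by (fastforce simp: Dpk_def)

lemma wishart_exists_full_rank:
  fixes \<alpha> :: real
  assumes \<alpha>: "real CARD('n::finite) - 1 \<le> \<alpha>"
  shows "\<exists>P. wishart_semigroup (Dpk CARD('n) :: (real^'n^'n) set) \<alpha> P"
proof (rule wishart_exists_if_coordinate_kernels)
  show cl: "closed (Dpk CARD('n) :: (real^'n^'n) set)" by (rule closed_Dpk) simp
  show "Dpk CARD('n) \<subseteq> Collect (psd :: real^'n^'n \<Rightarrow> bool)" by (auto simp: Dpk_def)
  have "1 \<le> real CARD('n)" by (simp add: Suc_leI)
  then show "0 \<le> \<alpha>" using \<alpha> by linarith
  fix x :: "real^'n^'n" and t :: real and i :: 'n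
  assume "x \<in> Dpk CARD('n)" and t: "0 < t"
  then have "psd x" by (simp add: Dpk_def)
  \<comment> \<open>Eliminating every coordinate except \<open>i\<close> leaves a multiple of e_i
    e_i^T, which becomes the column supported in row \<open>i\<close>.\<close>
  from psd_cholesky[OF _ this, of "UNIV - {i}"] obtain v where
    v: "psd (x - (\<Sum>j\<in>UNIV - {i}. outer (v j)))"
    "\<And>j l. j \<noteq> i \<Longrightarrow> (x - (\<Sum>j\<in>UNIV - {i}. outer (v j))) $ j $ l = 0" by auto
  define r where "r = x - (\<Sum>j\<in>UNIV - {i}. outer (v j))"
  have r: "psd r" "\<And>j l. j \<noteq> i \<Longrightarrow> r $ j $ l = 0" using v by (auto simp: r_def)
  have ri: "r = outer (sqrt (r $ i $ i) *\<^sub>R axis i 1)"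
  proof -
    have "r $ a $ b = (sqrt (r $ i $ i) *\<^sub>R axis i 1) $ a * (sqrt (r $ i $ i) *\<^sub>R axis i 1) $ b" for a b
      using r(2)[of a b] r(2)[of b a] sym_nth[OF psdD(1)[OF r(1)], of a b] psd_diag_nonneg[OF r(1), of i]
      by (cases "a = i"; cases "b = i") (auto simp: axis_def)
    then show ?thesis unfolding vec_eq_iff outer_nth by blast
  qed
  define w where "w l = (if l = i then sqrt (r $ i $ i) *\<^sub>R axis i 1 else v l)" for l
  have x: "x = (\<Sum>l\<in>UNIV. outer (w l))"
  proof -
    have "(\<Sum>l\<in>UNIV. outer (w l)) = outer (w i) + (\<Sum>l\<in>UNIV - {i}. outer (w l))"
      by (simp add: sum.remove[of UNIV i])
    also have "outer (w i) = r" using ri by (simp add: w_def)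
    also have "(\<Sum>l\<in>UNIV - {i}. outer (w l)) = (\<Sum>l\<in>UNIV - {i}. outer (v l))"
      by (rule sum.cong) (auto simp: w_def)
    finally show ?thesis by (simp add: r_def)
  qed
  \<comment> \<open>The Gaussian columns contribute 1 each; column \<open>i\<close> supplies what is
    missing to \<alpha>, which is nonnegative by the hypothesis.\<close>
  define \<delta> where "\<delta> l = (if l = i then \<alpha> - (real CARD('n) - 1) else 1)" for l
  obtain B where B: "bessel_law t (\<delta> i) ((w i $ i)\<^sup>2) B"
    using bessel_law_exists[OF t, of "\<delta> i" "(w i $ i)\<^sup>2"] \<alpha> by (auto simp: \<delta>_def)
  define M where "M l = (if l = i then B else density lborel (normal_density (w l $ i) (sqrt t)))" for l
  have M: "update_law t (\<delta> l) (w l $ i) (l \<in> UNIV - {i}) (M l)" for l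
    using update_law_normal[OF t] update_law_bessel[OF B] by (auto simp: M_def \<delta>_def)
  have "(\<Sum>l\<in>UNIV. \<delta> l) = \<delta> i + (\<Sum>l\<in>UNIV - {i}. \<delta> l)" by (simp add: sum.remove[of UNIV i])
  also have "(\<Sum>l\<in>UNIV - {i}. \<delta> l) = (\<Sum>l\<in>UNIV - {i}. 1)" by (rule sum.cong) (auto simp: \<delta>_def)
  also have "\<dots> = real CARD('n) - 1" by (simp add: card_Diff_singleton Suc_leI of_nat_diff)
  finally have s: "(\<Sum>l\<in>UNIV. \<delta> l) = \<alpha>" by (simp add: \<delta>_def)
  have "AE \<omega> in PiM UNIV M. (\<Sum>l\<in>UNIV. outer (w l + (\<omega> l - w l $ i) *\<^sub>R axis i 1)) \<in> Dpk CARD('n)"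
    by (simp add: Dpk_full psd_sum)
  from row_update_kernel[where w = w and i = i and K = "UNIV - {i}", OF t M _ cl this]
  show "has_row_kernel (Dpk CARD('n)) \<alpha> t i x"
    unfolding s x[symmetric] by (simp add: w_def axis_def)
qed

section \<open>Generators of contraction semigroups\<close>

lemma semigroup_posop: "pos_sc_contraction_semigroup D P \<Longrightarrow> 0 \<le> t \<Longrightarrow> posop D (P t)"
  unfolding pos_sc_contraction_semigroup_def posop_def by simp

lemma semigroup_add:
  "pos_sc_contraction_semigroup D P \<Longrightarrow> 0 \<le> s \<Longrightarrow> 0 \<le> t \<Longrightarrow> f \<in> C0 D \<Longrightarrow> P (s + t) f = P s (P t f)"
  unfolding pos_sc_contraction_semigroup_def by simp

lemma semigroup_zero: "pos_sc_contraction_semigroup D P \<Longrightarrow> f \<in> C0 D \<Longrightarrow> P 0 f = f"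
  unfolding pos_sc_contraction_semigroup_def by simp

lemma semigroup_continuous:
  assumes "pos_sc_contraction_semigroup D P" "f \<in> C0 D" "0 < e"
  obtains d where "0 < d" "\<And>t x. 0 \<le> t \<Longrightarrow> t < d \<Longrightarrow> x \<in> D \<Longrightarrow> \<bar>P t f x - f x\<bar> \<le> e"
proof -
  have "\<forall>f\<in>C0 D. \<forall>e>0. \<exists>\<delta>>0. \<forall>t. 0 \<le> t \<and> t < \<delta> \<longrightarrow> (\<forall>x\<in>D. \<bar>P t f x - f x\<bar> \<le> e)"
    using assms(1) unfolding pos_sc_contraction_semigroup_def by (elim conjE)
  from this[rule_format, OF assms(2,3)] show thesis using that by blast
qed

text \<open>The graph of the infinitesimal generator, as a relation between \<open>F\<close> and its
  image \<open>H\<close>, with convergence of difference quotients uniform on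
  \<open>D\<close>.\<close>

definition gen :: "'a::real_normed_vector set \<Rightarrow> (real \<Rightarrow> ('a \<Rightarrow> real) \<Rightarrow> 'a \<Rightarrow> real) \<Rightarrow> ('a \<Rightarrow> real) \<Rightarrow> ('a \<Rightarrow> real) \<Rightarrow> bool"
  where "gen D P F H \<longleftrightarrow> F \<in> C0 D \<and> H \<in> C0 D \<and>
    (\<forall>e>0. \<exists>d>0. \<forall>t. 0 < t \<and> t < d \<longrightarrow> (\<forall>x\<in>D. \<bar>P t F x - F x - t * H x\<bar> \<le> e * t))"

lemma genE:
  assumes "gen D P F H" "0 < e"
  obtains d where "0 < d" "\<And>t x. 0 < t \<Longrightarrow> t < d \<Longrightarrow> x \<in> D \<Longrightarrow> \<bar>P t F x - F x - t * H x\<bar> \<le> e * t"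
proof -
  have "\<forall>e>0. \<exists>d>0. \<forall>t. 0 < t \<and> t < d \<longrightarrow> (\<forall>x\<in>D. \<bar>P t F x - F x - t * H x\<bar> \<le> e * t)"
    using assms(1) by (simp add: gen_def)
  from this[rule_format, OF assms(2)] show thesis using that by blast
qed

lemma gen_C0: "gen D P F H \<Longrightarrow> F \<in> C0 D" "gen D P F H \<Longrightarrow> H \<in> C0 D"
  by (auto simp: gen_def)

lemma gen_lincomb:
  assumes P: "pos_sc_contraction_semigroup D P" and F: "gen D P F H" and G: "gen D P F' H'"
  shows "gen D P (\<lambda>x. a * F x + F' x) (\<lambda>x. a * H x + H' x)"
  unfolding gen_def
proof (intro conjI allI impI C0_lincomb gen_C0[OF F] gen_C0[OF G])
  fix e :: real assume e: "0 < e"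
  define e1 where "e1 = e / (2 * (\<bar>a\<bar> + 1))"
  have a: "0 < 2 * (\<bar>a\<bar> + 1)" by simp
  have e1: "0 < e1" unfolding e1_def using e a by (rule divide_pos_pos)
  have ae: "\<bar>a\<bar> * e1 \<le> e / 2"
  proof -
    have "\<bar>a\<bar> * e1 \<le> (\<bar>a\<bar> + 1) * e1" using e1 by simp
    also have "e1 * (2 * (\<bar>a\<bar> + 1)) = e"
      using a nonzero_eq_divide_eq[of "2 * (\<bar>a\<bar> + 1)" e1 e] unfolding e1_def by simp
    then have "(\<bar>a\<bar> + 1) * e1 = e / 2" by (simp add: algebra_simps)
    finally show ?thesis .
  qed
  obtain d1 where d1: "0 < d1" "\<And>t x. 0 < t \<Longrightarrow> t < d1 \<Longrightarrow> x \<in> D \<Longrightarrow> \<bar>P t F x - F x - t * H x\<bar> \<le> e1 * t"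
    using genE[OF F e1] by blast
  have "0 < e / 2" using e by simp
  from genE[OF G this] obtain d2 where d2: "0 < d2"
    "\<And>t x. 0 < t \<Longrightarrow> t < d2 \<Longrightarrow> x \<in> D \<Longrightarrow> \<bar>P t F' x - F' x - t * H' x\<bar> \<le> e / 2 * t" by blast
  have "\<bar>P t (\<lambda>x. a * F x + F' x) x - (a * F x + F' x) - t * (a * H x + H' x)\<bar> \<le> e * t"
    if t: "0 < t" "t < min d1 d2" and x: "x \<in> D" for t x
  proof -
    have "P t (\<lambda>x. a * F x + F' x) x = a * P t F x + P t F' x"
      using posopD(2)[OF semigroup_posop[OF P] gen_C0(1)[OF F] gen_C0(1)[OF G], of t a] t by simp
    then have eq: "P t (\<lambda>x. a * F x + F' x) x - (a * F x + F' x) - t * (a * H x + H' x)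
       = a * (P t F x - F x - t * H x) + (P t F' x - F' x - t * H' x)" by (simp add: algebra_simps)
    have "\<bar>a * (P t F x - F x - t * H x)\<bar> \<le> \<bar>a\<bar> * (e1 * t)"
      unfolding abs_mult using d1(2)[of t x] t x by (intro mult_left_mono) auto
    also have "\<dots> \<le> e / 2 * t" using mult_right_mono[OF ae, of t] t by (simp add: mult.assoc)
    finally have "\<bar>a * (P t F x - F x - t * H x)\<bar> \<le> e / 2 * t" .
    moreover have "\<bar>P t F' x - F' x - t * H' x\<bar> \<le> e / 2 * t" using d2(2)[of t x] t x by simp
    moreover have "e * t = e / 2 * t + e / 2 * t" by simp
    ultimately show ?thesis unfolding eq by linarith
  qed
  then show "\<exists>d>0. \<forall>t. 0 < t \<and> t < d \<longrightarrow>
      (\<forall>x\<in>D. \<bar>P t (\<lambda>x. a * F x + F' x) x - (a * F x + F' x) - t * (a * H x + H' x)\<bar> \<le> e * t)"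
    using d1(1) d2(1) by (intro exI[of _ "min d1 d2"]) auto
qed

lemma gen_zero: "pos_sc_contraction_semigroup D P \<Longrightarrow> gen D P (\<lambda>x. 0) (\<lambda>x. 0)"
  unfolding gen_def using posop_zero[OF semigroup_posop] C0_zero by (force intro: exI[of _ "1::real"])

lemma gen_sum:
  assumes P: "pos_sc_contraction_semigroup D P" and "\<And>i. i \<in> I \<Longrightarrow> gen D P (F i) (H i)"
  shows "gen D P (\<lambda>x. \<Sum>i\<in>I. F i x) (\<lambda>x. \<Sum>i\<in>I. H i x)"
  using assms(2)
proof (induction I rule: infinite_finite_induct)
  case (insert i I)
  then show ?case using gen_lincomb[OF P, of "F i" "H i" "\<lambda>x. \<Sum>i\<in>I. F i x" "\<lambda>x. \<Sum>i\<in>I. H i x" 1] by simp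
qed (simp_all add: gen_zero[OF P])

text \<open>A discrete form of the identity that P_t F - F is the integral of P_s H over [0, t]:
  telescoping over \<open>n\<close> short steps, with an extra error \<open>r\<close> that finally
  tends to 0.\<close>

lemma gen_bound:
  assumes P: "pos_sc_contraction_semigroup D P" and F: "gen D P F H" and t: "0 \<le> t"
    and H: "\<And>s x. 0 \<le> s \<Longrightarrow> s \<le> t \<Longrightarrow> x \<in> D \<Longrightarrow> \<bar>P s H x - H x\<bar> \<le> e" and x: "x \<in> D"
  shows "\<bar>P t F x - F x - t * H x\<bar> \<le> t * e"
proof (cases "t = 0")
  case True
  then show ?thesis using semigroup_zero[OF P gen_C0(1)[OF F]] by simp
next
  case False
  then have t0: "0 < t" using t by simp
  have FC: "F \<in> C0 D" and HC: "H \<in> C0 D" using gen_C0[OF F] by auto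
  have "\<bar>P t F x - F x - t * H x\<bar> \<le> t * e + r" if r: "0 < r" for r
  proof -
    have "0 < r / t" using r t0 by simp
    from genE[OF F this] obtain d where d: "0 < d"
      "\<And>s x. 0 < s \<Longrightarrow> s < d \<Longrightarrow> x \<in> D \<Longrightarrow> \<bar>P s F x - F x - s * H x\<bar> \<le> r / t * s" by blast
    \<comment> \<open>This makes the step length t / n smaller than \<open>d\<close>, where the
      first-order estimate for \<open>F\<close> applies.\<close>
    obtain n :: nat where n: "t / d < real n" using reals_Archimedean2 by blast
    have n0: "0 < real n" using n t0 d(1) by (meson divide_pos_pos less_trans)
    define h where "h = t / n"
    have h: "0 < h" "h < d" using n n0 t0 d(1) by (auto simp: h_def field_simps)
    have nh: "real n * h = t" using n0 by (simp add: h_def)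
    have "\<forall>x\<in>D. \<bar>P (real j * h) F x - F x - real j * h * H x\<bar> \<le> real j * h * (e + r / t)" if "j \<le> n" for j
      using that
    proof (induction j)
      case 0
      then show ?case using semigroup_zero[OF P FC] by simp
    next
      case (Suc j)
      show ?case
      proof
        fix x assume x: "x \<in> D"
        define s where "s = real j * h"
        have s0: "0 \<le> s" using h by (simp add: s_def)
        have "s \<le> real n * h" unfolding s_def using Suc.prems h by (intro mult_right_mono) auto
        then have st: "s \<le> t" by (simp add: nh)
        note Q = semigroup_posop[OF P s0]
        have PhF: "P h F \<in> C0 D" using posopD(1)[OF semigroup_posop[OF P] FC] h by simp
        \<comment> \<open>The defect of one short step is transported by the contraction
          \<open>P s\<close>, so it is not amplified.\<close>
        have "P s (\<lambda>x. (-h) * H x + ((-1) * F x + P h F x)) x = P s (P h F) x - P s F x - h * P s H x"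
          using posopD(2)[OF Q HC C0_lincomb[OF FC PhF], of "-h" "-1"] posopD(2)[OF Q FC PhF, of "-1"]
          by (simp add: algebra_simps)
        moreover have "\<bar>P s (\<lambda>x. (-h) * H x + ((-1) * F x + P h F x)) x\<bar> \<le> r / t * h"
        proof (rule posopD(4)[OF Q C0_lincomb[OF HC C0_lincomb[OF FC PhF]] _ x])
          show "\<bar>(-h) * H x + ((-1) * F x + P h F x)\<bar> \<le> r / t * h" if "x \<in> D" for x
            using d(2)[OF h that] by (simp add: algebra_simps)
        qed
        moreover have "P (real (Suc j) * h) F x = P s (P h F) x"
          using semigroup_add[OF P s0 _ FC, of h] h by (simp add: s_def algebra_simps)
        moreover have "\<bar>h * (P s H x - H x)\<bar> \<le> h * e"
          unfolding abs_mult using H[OF s0 st x] h by simp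
        moreover have "\<bar>P s F x - F x - s * H x\<bar> \<le> s * (e + r / t)"
          using Suc x by (simp add: s_def)
        moreover have "real (Suc j) * h * H x = s * H x + h * H x"
          "real (Suc j) * h * (e + r / t) = s * (e + r / t) + h * e + r / t * h"
          by (simp_all add: s_def algebra_simps)
        ultimately show "\<bar>P (real (Suc j) * h) F x - F x - real (Suc j) * h * H x\<bar> \<le> real (Suc j) * h * (e + r / t)"
          unfolding right_diff_distrib by linarith
      qed
    qed
    from this[of n] x have "\<bar>P t F x - F x - t * H x\<bar> \<le> t * (e + r / t)" by (simp add: nh)
    also have "\<dots> = t * e + r" using t0 by (simp add: distrib_left)
    finally show ?thesis .
  qed
  then show ?thesis by (rule field_le_epsilon)
qed

text \<open>The time threshold comes from strong continuity at the limit \<open>H\<close> alone, so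
  the approximating pair may be chosen afterwards, depending on t.\<close>

lemma gen_closed:
  assumes P: "pos_sc_contraction_semigroup D P" and F: "F \<in> C0 D" and H: "H \<in> C0 D"
    and ap: "\<And>r. 0 < r \<Longrightarrow> \<exists>F' H'. gen D P F' H' \<and> (\<forall>x\<in>D. \<bar>F x - F' x\<bar> \<le> r) \<and> (\<forall>x\<in>D. \<bar>H x - H' x\<bar> \<le> r)"
  shows "gen D P F H"
  unfolding gen_def
proof (intro conjI allI impI F H)
  fix e :: real assume e: "0 < e"
  then have "0 < e / 2" by simp
  from semigroup_continuous[OF P H this] obtain d where d: "0 < d"
    "\<And>t x. 0 \<le> t \<Longrightarrow> t < d \<Longrightarrow> x \<in> D \<Longrightarrow> \<bar>P t H x - H x\<bar> \<le> e / 2" by blast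
  have "\<bar>P t F x - F x - t * H x\<bar> \<le> e * t" if t: "0 < t" "t < d" and x: "x \<in> D" for t x
  proof -
    \<comment> \<open>Solves t (e / 2 + 2 r) + 2 r + t r = t e, the balance of all errors
      below.\<close>
    define r where "r = t * e / (2 * (2 + 3 * t))"
    have r: "0 < r" unfolding r_def using t e by (intro divide_pos_pos mult_pos_pos add_pos_pos) auto
    have "2 * (2 + 3 * t) \<noteq> 0" using t by simp
    then have rr: "r * (2 * (2 + 3 * t)) = t * e" using nonzero_eq_divide_eq[of "2 * (2 + 3 * t)" r "t * e"] r_def by blast
    from ap[OF r] obtain F' H' where g: "gen D P F' H'"
      and FF: "\<And>x. x \<in> D \<Longrightarrow> \<bar>F x - F' x\<bar> \<le> r" and HH: "\<And>x. x \<in> D \<Longrightarrow> \<bar>H x - H' x\<bar> \<le> r" by blast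
    note C = gen_C0[OF g]
    have "\<bar>P s H' y - H' y\<bar> \<le> e / 2 + 2 * r" if s: "0 \<le> s" "s \<le> t" and y: "y \<in> D" for s y
      using posop_approx[OF semigroup_posop[OF P s(1)] H C(2) HH y] HH[OF y] d(2)[OF s(1) _ y] s t
      by linarith
    then have "\<bar>P t F' x - F' x - t * H' x\<bar> \<le> t * (e / 2 + 2 * r)"
      using t x by (intro gen_bound[OF P g]) auto
    moreover have "\<bar>P t F x - P t F' x\<bar> \<le> r"
      using posop_approx[OF semigroup_posop[OF P] F C(1) FF x] t by simp
    moreover have "\<bar>t * H x - t * H' x\<bar> \<le> t * r"
      using HH[OF x] t by (simp add: right_diff_distrib[symmetric] abs_mult)
    moreover have "t * (e / 2 + 2 * r) + 2 * r + t * r = e * t"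
      using rr by (simp add: algebra_simps)
    ultimately show ?thesis using FF[OF x] by linarith
  qed
  then show "\<exists>d>0. \<forall>t. 0 < t \<and> t < d \<longrightarrow> (\<forall>x\<in>D. \<bar>P t F x - F x - t * H x\<bar> \<le> e * t)"
    using d(1) by blast
qed

text \<open>\<open>P t F\<close> stays nonnegative at the zero \<open>x\<close> of \<open>F\<close>,
  so the difference quotients there, and hence their limit, are nonnegative.\<close>

lemma gen_positive_minimum:
  assumes P: "pos_sc_contraction_semigroup D P" and F: "gen D P F H"
    and pos: "\<And>x. x \<in> D \<Longrightarrow> 0 \<le> F x" and x: "x \<in> D" "F x = 0"
  shows "0 \<le> H x"
proof (rule ccontr)
  assume "\<not> 0 \<le> H x"
  then have e: "0 < - H x / 2" by simp
  from genE[OF F e] obtain d where d: "0 < d"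
    "\<And>t x'. 0 < t \<Longrightarrow> t < d \<Longrightarrow> x' \<in> D \<Longrightarrow> \<bar>P t F x' - F x' - t * H x'\<bar> \<le> - H x / 2 * t" by blast
  define t where "t = d / 2"
  have t: "0 < t" "t < d" using d(1) by (auto simp: t_def)
  have "0 \<le> P t F x" using posopD(3)[OF semigroup_posop[OF P] gen_C0(1)[OF F] pos x(1)] t by simp
  moreover have "\<bar>P t F x - t * H x\<bar> \<le> - H x / 2 * t" using d(2)[OF t x(1)] x(2) by simp
  moreover have "0 < t * (- H x / 2)" using e t by (intro mult_pos_pos)
  ultimately show False by (simp add: algebra_simps)
qed

section \<open>Functions of polynomial growth\<close>

definition polyb :: "(real^'n^'n \<Rightarrow> real) \<Rightarrow> bool" where
  "polyb q \<longleftrightarrow> continuous_on UNIV q \<and> (\<exists>C N. 0 \<le> C \<and> (\<forall>x. \<bar>q x\<bar> \<le> C * (1 + norm x) ^ N))"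

lemma polyb_const: "polyb (\<lambda>x. c)"
  unfolding polyb_def by (intro conjI exI[of _ "\<bar>c\<bar>"] exI[of _ 0]) auto

lemma polyb_add:
  assumes "polyb p" "polyb q" shows "polyb (\<lambda>x. p x + q x)"
proof -
  obtain C N where p: "0 \<le> C" "\<And>x. \<bar>p x\<bar> \<le> C * (1 + norm x) ^ N" using assms(1) unfolding polyb_def by blast
  obtain C' N' where q: "0 \<le> C'" "\<And>x. \<bar>q x\<bar> \<le> C' * (1 + norm x) ^ N'" using assms(2) unfolding polyb_def by blast
  have "\<bar>p x + q x\<bar> \<le> (C + C') * (1 + norm x) ^ (N + N')" for x
  proof -
    have "C * (1 + norm x) ^ N \<le> C * (1 + norm x) ^ (N + N')" "C' * (1 + norm x) ^ N' \<le> C' * (1 + norm x) ^ (N + N')"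
      using p(1) q(1) by (auto intro!: mult_left_mono power_increasing)
    then show ?thesis using p(2)[of x] q(2)[of x] unfolding distrib_right by linarith
  qed
  moreover have "continuous_on UNIV (\<lambda>x. p x + q x)"
    using assms by (intro continuous_intros) (auto simp: polyb_def)
  ultimately show ?thesis unfolding polyb_def using p(1) q(1) by (meson add_nonneg_nonneg)
qed

lemma polyb_mult:
  assumes "polyb p" "polyb q" shows "polyb (\<lambda>x. p x * q x)"
proof -
  obtain C N where p: "0 \<le> C" "\<And>x. \<bar>p x\<bar> \<le> C * (1 + norm x) ^ N" using assms(1) unfolding polyb_def by blast
  obtain C' N' where q: "0 \<le> C'" "\<And>x. \<bar>q x\<bar> \<le> C' * (1 + norm x) ^ N'" using assms(2) unfolding polyb_def by blast
  have "\<bar>p x * q x\<bar> \<le> (C * C') * (1 + norm x) ^ (N + N')" for x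
  proof -
    have "\<bar>p x * q x\<bar> \<le> (C * (1 + norm x) ^ N) * (C' * (1 + norm x) ^ N')"
      unfolding abs_mult using p q by (intro mult_mono) auto
    then show ?thesis by (simp add: power_add ac_simps)
  qed
  moreover have "continuous_on UNIV (\<lambda>x. p x * q x)"
    using assms by (intro continuous_intros) (auto simp: polyb_def)
  ultimately show ?thesis unfolding polyb_def using p(1) q(1) by (meson mult_nonneg_nonneg)
qed

lemma polyb_inner: "polyb (\<lambda>x. v \<bullet> x)"
  unfolding polyb_def
proof (intro conjI exI[of _ "norm v"] exI[of _ 1] allI)
  show "\<bar>v \<bullet> x\<bar> \<le> norm v * (1 + norm x) ^ 1" for x
    using Cauchy_Schwarz_ineq2[of v x] norm_ge_zero[of v] unfolding power_one_right distrib_left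
    by linarith
qed (auto intro: continuous_intros)

lemma polyb_diff: "polyb p \<Longrightarrow> polyb q \<Longrightarrow> polyb (\<lambda>x. p x - q x)"
  using polyb_add[of p "\<lambda>x. (-1) * q x"] polyb_mult[OF polyb_const, of q "-1"] by simp

lemma polyb_inner_centered: "polyb (\<lambda>x. v \<bullet> (x - c))"
  unfolding inner_diff_right by (intro polyb_diff polyb_inner polyb_const)

lemma polyb_common_bound:
  fixes p q r :: "real^'n^'n \<Rightarrow> real"
  assumes "polyb p" "polyb q" "polyb r"
  obtains C N where "0 \<le> C" "\<And>x. \<bar>p x\<bar> \<le> C * (1 + norm x) ^ N"
    "\<And>x. \<bar>q x\<bar> \<le> C * (1 + norm x) ^ N" "\<And>x. \<bar>r x\<bar> \<le> C * (1 + norm x) ^ N"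
proof -
  have "polyb (\<lambda>x. \<bar>f x\<bar>)" if "polyb f" for f :: "real^'n^'n \<Rightarrow> real"
    using that unfolding polyb_def by (auto intro: continuous_intros)
  then have "polyb (\<lambda>x. \<bar>p x\<bar> + (\<bar>q x\<bar> + \<bar>r x\<bar>))" using assms by (intro polyb_add)
  then obtain C N where C: "0 \<le> C" "\<And>x. \<bar>\<bar>p x\<bar> + (\<bar>q x\<bar> + \<bar>r x\<bar>)\<bar> \<le> C * (1 + norm x) ^ N"
    unfolding polyb_def by blast
  show thesis
  proof (rule that[OF C(1)])
    show "\<bar>p x\<bar> \<le> C * (1 + norm x) ^ N" "\<bar>q x\<bar> \<le> C * (1 + norm x) ^ N" "\<bar>r x\<bar> \<le> C * (1 + norm x) ^ N" for x
      using C(2)[of x] by linarith+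
  qed
qed

section \<open>The Wishart generator on polynomials times exponentials\<close>

text \<open>Centering makes the weight equal to 1 at \<open>c\<close>, so for \<open>c\<close> in
  \<open>D\<close> the value there is just \<open>q c\<close>.\<close>

definition pexp :: "(real^'n^'n) set \<Rightarrow> real^'n^'n \<Rightarrow> real^'n^'n \<Rightarrow> (real^'n^'n \<Rightarrow> real) \<Rightarrow> real^'n^'n \<Rightarrow> real" where
  "pexp D c u q = (\<lambda>x. if x \<in> D then q x * exp (- (u \<bullet> (x - c))) else 0)"

lemma pexp_eq_scaled: "pexp D c u q = (\<lambda>x. exp (u \<bullet> c) * (if x \<in> D then q x * exp (- (u \<bullet> x)) else 0))"
  by (auto simp: pexp_def fun_eq_iff inner_diff_right exp_diff exp_minus divide_inverse)

lemma pexp_in_C0: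
  assumes "D \<subseteq> Collect psd" "pd u" "polyb q"
  shows "pexp D c u q \<in> C0 D"
proof -
  obtain C N where "\<And>x. \<bar>q x\<bar> \<le> C * (1 + norm x) ^ N" using assms(3) unfolding polyb_def by blast
  moreover have "continuous_on D q" using assms(3) continuous_on_subset unfolding polyb_def by blast
  ultimately show ?thesis
    unfolding pexp_eq_scaled by (intro C0_scale C0_poly_exp[OF assms(1,2)])
qed

text \<open>The factor by which the generator multiplies the exponential with parameter
  \<open>u\<close>; \<open>symbol1\<close> and \<open>symbol2\<close> are its first and mixed second
  derivatives in \<open>u\<close>. Third derivatives vanish.\<close>

definition symbol0 :: "real \<Rightarrow> real^'n^'n \<Rightarrow> real^'n^'n \<Rightarrow> real" where
  "symbol0 \<alpha> u x = - \<alpha> * trace u + 2 * ((u ** u) \<bullet> x)"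

definition symbol1 :: "real \<Rightarrow> real^'n^'n \<Rightarrow> real^'n^'n \<Rightarrow> real^'n^'n \<Rightarrow> real" where
  "symbol1 \<alpha> u v x = - \<alpha> * trace v + 2 * ((u ** v + v ** u) \<bullet> x)"

definition symbol2 :: "real^'n^'n \<Rightarrow> real^'n^'n \<Rightarrow> real^'n^'n \<Rightarrow> real" where
  "symbol2 v w x = 2 * ((v ** w + w ** v) \<bullet> x)"

lemma trace_scaleR: "trace (s *\<^sub>R (v :: real^'n^'n)) = s * trace v"
  by (simp add: trace_def sum_distrib_left)

lemma symbol0_expand:
  "symbol0 \<alpha> (u + s *\<^sub>R v) x = symbol0 \<alpha> u x + s * symbol1 \<alpha> u v x + s\<^sup>2 * (2 * ((v ** v) \<bullet> x))"
  by (simp add: symbol0_def symbol1_def trace_add trace_scaleR matrix_add_ldistrib matrix_add_rdistrib_real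
      matrix_mult_scaleR_left matrix_mult_scaleR_right inner_add_left power2_eq_square algebra_simps)

lemma symbol1_expand: "symbol1 \<alpha> (u + s *\<^sub>R v) w x = symbol1 \<alpha> u w x + s * symbol2 v w x"
  by (simp add: symbol1_def symbol2_def matrix_add_ldistrib matrix_add_rdistrib_real
      matrix_mult_scaleR_left matrix_mult_scaleR_right inner_add_left algebra_simps)

lemma wishart_gen_exp:
  assumes D: "D \<subseteq> Collect psd" and W: "wishart_semigroup D \<alpha> P" and u: "pd u"
  shows "gen D P (pexp D c u (\<lambda>x. 1)) (pexp D c u (symbol0 \<alpha> u))"
proof -
  have P: "pos_sc_contraction_semigroup D P" using W by (simp add: wishart_semigroup_def)
  have s0: "polyb (symbol0 \<alpha> u)"
    unfolding symbol0_def by (intro polyb_add polyb_mult polyb_const polyb_inner)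
  have f: "pexp D 0 u (\<lambda>x. 1) = fexp D u" unfolding fexp_eq[OF D] by (auto simp: pexp_def fun_eq_iff)
  have "gen D P (pexp D 0 u (\<lambda>x. 1)) (pexp D 0 u (symbol0 \<alpha> u))"
    unfolding gen_def
  proof (intro conjI allI impI pexp_in_C0 D u polyb_const s0)
    fix e :: real assume "0 < e"
    from wishart_generator_uniform[OF u this, of \<alpha>] obtain d where d: "0 < d"
      "\<And>t x. 0 < t \<Longrightarrow> t < d \<Longrightarrow> psd x \<Longrightarrow>
       \<bar>wfactor \<alpha> u t * exp (- (wexponent u t \<bullet> x))
       - exp (- (u \<bullet> x)) - t * ((- \<alpha> * trace u + 2 * ((u ** u) \<bullet> x)) * exp (- (u \<bullet> x)))\<bar> \<le> e * t" by blast
    have "\<bar>P t (pexp D 0 u (\<lambda>x. 1)) x - pexp D 0 u (\<lambda>x. 1) x - t * pexp D 0 u (symbol0 \<alpha> u) x\<bar> \<le> e * t"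
      if t: "0 < t" "t < d" and x: "x \<in> D" for t x
    proof -
      have px: "psd x" using D x by auto
      have "P t (fexp D u) x = wfactor \<alpha> u t *
          exp (- (wexponent u t \<bullet> x))"
        using W u t x px unfolding wishart_semigroup_def
        by (simp add: trace_mul_sym[of x] trace_mult_eq_inner psdD)
      then show ?thesis using d(2)[OF t px] x
        unfolding f by (simp add: fexp_eq[OF D] pexp_def symbol0_def)
    qed
    then show "\<exists>d>0. \<forall>t. 0 < t \<and> t < d \<longrightarrow> (\<forall>x\<in>D.
        \<bar>P t (pexp D 0 u (\<lambda>x. 1)) x - pexp D 0 u (\<lambda>x. 1) x - t * pexp D 0 u (symbol0 \<alpha> u) x\<bar> \<le> e * t)"
      using d(1) by blast
  qed
  from gen_lincomb[OF P this gen_zero[OF P], of "exp (u \<bullet> c)"] show ?thesis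
    unfolding pexp_eq_scaled by simp
qed

lemma exp_perturb_uniform:
  fixes u v c :: "real^'n^'n"
  assumes u: "pd u" and q: "polyb q0" "polyb q1" "polyb q2" and e: "0 < e"
  shows "\<exists>d>0. \<forall>s. 0 < s \<and> s < d \<longrightarrow> (\<forall>x. psd x \<longrightarrow>
     \<bar>(q0 x + s * q1 x + s\<^sup>2 * q2 x) * exp (- ((u + s *\<^sub>R v) \<bullet> (x - c))) - q0 x * exp (- (u \<bullet> (x - c)))
       - s * ((q1 x - (v \<bullet> (x - c)) * q0 x) * exp (- (u \<bullet> (x - c))))\<bar> \<le> e * s)"
proof -
  obtain C N where C: "0 \<le> C" "\<And>x. \<bar>q0 x\<bar> \<le> C * (1 + norm x) ^ N"
    "\<And>x. \<bar>q1 x\<bar> \<le> C * (1 + norm x) ^ N" "\<And>x. \<bar>q2 x\<bar> \<le> C * (1 + norm x) ^ N"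
    using polyb_common_bound[OF q] by blast
  show ?thesis
  proof (rule exp_family_uniform_derivative[where ?d0.0 = 1 and C = 0 and N = N and K = C, OF u _ _ _ _ C(2,3) e])
    fix r :: real assume r: "0 < r"
    have c1: "0 < C + 1" using C by simp
    show "\<exists>d>0. \<forall>s. 0 < s \<and> s < d \<longrightarrow> (\<forall>x. psd x \<longrightarrow>
        \<bar>(q0 x + s * q1 x + s\<^sup>2 * q2 x) - q0 x - s * q1 x\<bar> \<le> r * s * (1 + norm x) ^ N)"
    proof (intro exI[of _ "r / (C + 1)"] conjI allI impI)
      show "0 < r / (C + 1)" using r c1 by simp
      fix s x assume s: "0 < s \<and> s < r / (C + 1)"
      have "s * (C + 1) < r" using s c1 by (simp add: pos_less_divide_eq)
      then have sC: "s * C \<le> r" using s by (simp add: distrib_left)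
      have "\<bar>(q0 x + s * q1 x + s\<^sup>2 * q2 x) - q0 x - s * q1 x\<bar> = s\<^sup>2 * \<bar>q2 x\<bar>" by (simp add: abs_mult)
      also have "\<dots> \<le> s\<^sup>2 * (C * (1 + norm x) ^ N)" by (intro mult_left_mono C) auto
      also have "\<dots> = (s * C) * (s * (1 + norm x) ^ N)" by (simp add: power2_eq_square)
      also have "\<dots> \<le> r * (s * (1 + norm x) ^ N)" using s by (intro mult_right_mono sC) auto
      finally show "\<bar>(q0 x + s * q1 x + s\<^sup>2 * q2 x) - q0 x - s * q1 x\<bar> \<le> r * s * (1 + norm x) ^ N"
        by (simp add: mult.assoc)
    qed
  qed auto
qed

text \<open>The generator is closed, so the relation may be differentiated in the parameter \<open>u\<close>.\<close>

lemma gen_differentiate: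
  assumes D: "D \<subseteq> Collect psd" and P: "pos_sc_contraction_semigroup D P" and u: "pd u" and v: "transpose v = v"
    and p: "polyb p" and r: "polyb r0" "polyb r1" "polyb r2"
    and g: "\<And>s. pd (u + s *\<^sub>R v) \<Longrightarrow>
      gen D P (pexp D c (u + s *\<^sub>R v) p) (pexp D c (u + s *\<^sub>R v) (\<lambda>x. r0 x + s * r1 x + s\<^sup>2 * r2 x))"
  shows "gen D P (pexp D c u (\<lambda>x. (v \<bullet> (x - c)) * p x)) (pexp D c u (\<lambda>x. (v \<bullet> (x - c)) * r0 x - r1 x))"
proof (rule gen_closed[OF P])
  show "pexp D c u (\<lambda>x. (v \<bullet> (x - c)) * p x) \<in> C0 D"
    by (intro pexp_in_C0 D u polyb_mult polyb_inner_centered p)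
  show "pexp D c u (\<lambda>x. (v \<bullet> (x - c)) * r0 x - r1 x) \<in> C0 D"
    by (intro pexp_in_C0 D u polyb_diff polyb_mult polyb_inner_centered r)
  fix e :: real assume e: "0 < e"
  obtain d0 where d0: "0 < d0" "\<And>s. \<bar>s\<bar> < d0 \<Longrightarrow> pd (u + s *\<^sub>R v)" using pd_perturb[OF u v] by blast
  from exp_perturb_uniform[OF u p polyb_const polyb_const e, of 0 0 v c] obtain d1 where d1: "0 < d1"
    "\<And>s x. 0 < s \<Longrightarrow> s < d1 \<Longrightarrow> psd x \<Longrightarrow> \<bar>p x * exp (- ((u + s *\<^sub>R v) \<bullet> (x - c))) - p x * exp (- (u \<bullet> (x - c)))
       - s * ((0 - (v \<bullet> (x - c)) * p x) * exp (- (u \<bullet> (x - c))))\<bar> \<le> e * s" by auto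
  from exp_perturb_uniform[OF u r e, of v c] obtain d2 where d2: "0 < d2"
    "\<And>s x. 0 < s \<Longrightarrow> s < d2 \<Longrightarrow> psd x \<Longrightarrow>
     \<bar>(r0 x + s * r1 x + s\<^sup>2 * r2 x) * exp (- ((u + s *\<^sub>R v) \<bullet> (x - c))) - r0 x * exp (- (u \<bullet> (x - c)))
       - s * ((r1 x - (v \<bullet> (x - c)) * r0 x) * exp (- (u \<bullet> (x - c))))\<bar> \<le> e * s" by blast
  define s where "s = min d0 (min d1 d2) / 2"
  have s: "0 < s" "s < d0" "s < d1" "s < d2" using d0(1) d1(1) d2(1) by (auto simp: s_def)
  have ps: "pd (u + s *\<^sub>R v)" using d0(2)[of s] s by simp
  have div: "\<bar>(- Z) - ((-1 / s) * X + (1 / s) * Y)\<bar> \<le> e" if "\<bar>X - Y - s * Z\<bar> \<le> e * s" for X Y Z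
  proof -
    have "(- Z) - ((-1 / s) * X + (1 / s) * Y) = (X - Y - s * Z) / s" using s by (simp add: field_simps)
    then show ?thesis using that s by (simp add: pos_divide_le_eq)
  qed
  \<comment> \<open>Minus the difference quotient in \<open>s\<close>: differentiating the exponent
    produces -(v \<bullet> (x - c)), and the sign is undone here.\<close>
  let ?F = "\<lambda>x. (-1 / s) * pexp D c (u + s *\<^sub>R v) p x + (1 / s) * pexp D c u p x"
  let ?H = "\<lambda>x. (-1 / s) * pexp D c (u + s *\<^sub>R v) (\<lambda>x. r0 x + s * r1 x + s\<^sup>2 * r2 x) x + (1 / s) * pexp D c u r0 x"
  have "gen D P (pexp D c u p) (pexp D c u r0)" using g[of 0] u by simp
  from gen_lincomb[OF P this gen_zero[OF P], of "1 / s"]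
  have "gen D P (\<lambda>x. (1 / s) * pexp D c u p x) (\<lambda>x. (1 / s) * pexp D c u r0 x)" by simp
  from gen_lincomb[OF P g[OF ps] this] have "gen D P ?F ?H" .
  moreover have "\<bar>pexp D c u (\<lambda>x. (v \<bullet> (x - c)) * p x) x - ?F x\<bar> \<le> e" if x: "x \<in> D" for x
  proof -
    have "psd x" using D x by auto
    from div[OF d1(2)[OF s(1,3) this]] show ?thesis using x by (simp add: pexp_def)
  qed
  moreover have "\<bar>pexp D c u (\<lambda>x. (v \<bullet> (x - c)) * r0 x - r1 x) x - ?H x\<bar> \<le> e" if x: "x \<in> D" for x
  proof -
    have "psd x" using D x by auto
    from div[OF d2(2)[OF s(1,4) this]] show ?thesis using x by (simp add: pexp_def algebra_simps)
  qed
  ultimately show "\<exists>F' H'. gen D P F' H' \<and> (\<forall>x\<in>D. \<bar>pexp D c u (\<lambda>x. (v \<bullet> (x - c)) * p x) x - F' x\<bar> \<le> e) \<and>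
      (\<forall>x\<in>D. \<bar>pexp D c u (\<lambda>x. (v \<bullet> (x - c)) * r0 x - r1 x) x - H' x\<bar> \<le> e)" by blast
qed

text \<open>For a product of linear forms \<open>v \<bullet> (x - c)\<close> the generator is obtained from the symbol, which
  is quadratic in \<open>u\<close>, by the Leibniz rule: only derivatives of order at most two occur.\<close>

primrec lprod :: "real^'n^'n \<Rightarrow> (real^'n^'n) list \<Rightarrow> real^'n^'n \<Rightarrow> real" where
  "lprod c [] x = 1"
| "lprod c (v # vs) x = (v \<bullet> (x - c)) * lprod c vs x"

text \<open>The Leibniz sum over all ways to replace one linear factor v by
  \<open>symbol1 \<alpha> u v\<close>.\<close>

primrec lprod1 :: "real \<Rightarrow> real^'n^'n \<Rightarrow> real^'n^'n \<Rightarrow> (real^'n^'n) list \<Rightarrow> real^'n^'n \<Rightarrow> real" where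
  "lprod1 \<alpha> c u [] x = 0"
| "lprod1 \<alpha> c u (v # vs) x = symbol1 \<alpha> u v x * lprod c vs x + (v \<bullet> (x - c)) * lprod1 \<alpha> c u vs x"

text \<open>The derivative of \<open>lprod1\<close> in \<open>u\<close> in direction
  \<open>v\<close>.\<close>

primrec lprod11 :: "real^'n^'n \<Rightarrow> real^'n^'n \<Rightarrow> (real^'n^'n) list \<Rightarrow> real^'n^'n \<Rightarrow> real" where
  "lprod11 c v [] x = 0"
| "lprod11 c v (w # ws) x = symbol2 v w x * lprod c ws x + (w \<bullet> (x - c)) * lprod11 c v ws x"

text \<open>The sum over pairs of factors, each pair replaced by its \<open>symbol2\<close>.\<close>

primrec lprod2 :: "real^'n^'n \<Rightarrow> (real^'n^'n) list \<Rightarrow> real^'n^'n \<Rightarrow> real" where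
  "lprod2 c [] x = 0"
| "lprod2 c (v # vs) x = lprod11 c v vs x + (v \<bullet> (x - c)) * lprod2 c vs x"

text \<open>Each factor v \<bullet> (x - c) is minus a derivative in \<open>u\<close>, which makes
  first-order terms negative and second-order terms positive.\<close>

definition lprod_gen :: "real \<Rightarrow> real^'n^'n \<Rightarrow> real^'n^'n \<Rightarrow> (real^'n^'n) list \<Rightarrow> real^'n^'n \<Rightarrow> real" where
  "lprod_gen \<alpha> c u vs x = symbol0 \<alpha> u x * lprod c vs x - lprod1 \<alpha> c u vs x + lprod2 c vs x"

lemma polyb_symbols: "polyb (symbol0 \<alpha> u)" "polyb (symbol1 \<alpha> u v)" "polyb (symbol2 v w)"
  unfolding symbol0_def symbol1_def symbol2_def
  by (intro polyb_add polyb_mult polyb_const polyb_inner)+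

lemma polyb_lprod: "polyb (lprod c vs)"
  by (induction vs) (simp_all add: polyb_const polyb_mult polyb_inner_centered)

lemma polyb_lprod1: "polyb (lprod1 \<alpha> c u vs)"
  by (induction vs) (simp_all add: polyb_const polyb_add polyb_mult polyb_inner_centered polyb_symbols polyb_lprod)

lemma polyb_lprod11: "polyb (lprod11 c v vs)"
  by (induction vs) (simp_all add: polyb_const polyb_add polyb_mult polyb_inner_centered polyb_symbols polyb_lprod)

lemma polyb_lprod2: "polyb (lprod2 c vs)"
  by (induction vs) (simp_all add: polyb_const polyb_add polyb_mult polyb_inner_centered polyb_lprod11)

lemma polyb_lprod_gen: "polyb (lprod_gen \<alpha> c u vs)"
  unfolding lprod_gen_def
  by (intro polyb_add polyb_diff polyb_mult polyb_symbols polyb_lprod polyb_lprod1 polyb_lprod2)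

lemma lprod1_expand: "lprod1 \<alpha> c (u + s *\<^sub>R v) vs x = lprod1 \<alpha> c u vs x + s * lprod11 c v vs x"
  by (induction vs) (simp_all add: symbol1_expand algebra_simps)

text \<open>Each linear factor is one differentiation in the parameter, so the induction keeps
  \<open>u\<close> arbitrary. The generator polynomial along u + s v is exactly quadratic in s, as
  \<open>gen_differentiate\<close> requires.\<close>

lemma wishart_gen_lprod:
  assumes D: "D \<subseteq> Collect psd" and W: "wishart_semigroup D \<alpha> P"
  shows "pd u \<Longrightarrow> \<forall>v\<in>set vs. transpose v = v \<Longrightarrow>
    gen D P (pexp D c u (lprod c vs)) (pexp D c u (lprod_gen \<alpha> c u vs))"
proof (induction vs arbitrary: u)
  case Nil
  have "lprod c [] = (\<lambda>x. 1)" "lprod_gen \<alpha> c u [] = symbol0 \<alpha> u" by (auto simp: lprod_gen_def fun_eq_iff)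
  then show ?case using wishart_gen_exp[OF D W Nil(1)] by simp
next
  case (Cons v vs)
  have P: "pos_sc_contraction_semigroup D P" using W by (simp add: wishart_semigroup_def)
  let ?r1 = "\<lambda>x. symbol1 \<alpha> u v x * lprod c vs x - lprod11 c v vs x"
  let ?r2 = "\<lambda>x. 2 * ((v ** v) \<bullet> x) * lprod c vs x"
  have "gen D P (pexp D c u (\<lambda>x. (v \<bullet> (x - c)) * lprod c vs x))
      (pexp D c u (\<lambda>x. (v \<bullet> (x - c)) * lprod_gen \<alpha> c u vs x - ?r1 x))"
  proof (rule gen_differentiate[OF D P Cons.prems(1), where ?r2.0 = ?r2])
    show "transpose v = v" using Cons.prems by simp
    show "polyb (lprod c vs)" by (rule polyb_lprod)
    show "polyb (lprod_gen \<alpha> c u vs)" by (rule polyb_lprod_gen)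
    show "polyb ?r1" by (intro polyb_diff polyb_mult polyb_symbols polyb_lprod polyb_lprod11)
    show "polyb ?r2" by (intro polyb_mult polyb_const polyb_inner polyb_lprod)
    fix s assume s: "pd (u + s *\<^sub>R v)"
    have "lprod_gen \<alpha> c (u + s *\<^sub>R v) vs = (\<lambda>x. lprod_gen \<alpha> c u vs x + s * ?r1 x + s\<^sup>2 * ?r2 x)"
      by (simp add: lprod_gen_def fun_eq_iff symbol0_expand lprod1_expand algebra_simps)
    then show "gen D P (pexp D c (u + s *\<^sub>R v) (lprod c vs))
        (pexp D c (u + s *\<^sub>R v) (\<lambda>x. lprod_gen \<alpha> c u vs x + s * ?r1 x + s\<^sup>2 * ?r2 x))"
      using Cons.IH[OF s] Cons.prems(2) by simp
  qed
  moreover have "(\<lambda>x. (v \<bullet> (x - c)) * lprod c vs x) = lprod c (v # vs)" by (simp add: fun_eq_iff)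
  moreover have "(\<lambda>x. (v \<bullet> (x - c)) * lprod_gen \<alpha> c u vs x - ?r1 x) = lprod_gen \<alpha> c u (v # vs)"
    by (simp add: fun_eq_iff lprod_gen_def algebra_simps)
  ultimately show ?case by simp
qed

text \<open>At \<open>c\<close> only terms without a leftover linear factor survive. Derivatives
  consume at most two factors, so from three on one factor always remains.\<close>

lemma lprod_gen_center:
  "lprod_gen \<alpha> c u [v] c = - symbol1 \<alpha> u v c"
  "lprod_gen \<alpha> c u [v, w] c = symbol2 v w c"
  "lprod_gen \<alpha> c u (v1 # v2 # v3 # vs) c = 0"
  by (simp_all add: lprod_gen_def)

section \<open>Necessity\<close>

definition coordproj :: "'n set \<Rightarrow> real^'n^'n" where
  "coordproj K = (\<Sum>a\<in>K. outer (axis a 1))"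

lemma coordproj_mult: "coordproj K *v v = (\<Sum>a\<in>K. v $ a *\<^sub>R axis a 1)"
  by (simp add: coordproj_def sum_mult_vec outer_mult_vec inner_axis')

lemma coordproj_mult_nth: "(coordproj K *v v) $ a = (if a \<in> K then v $ a else 0)"
proof -
  have "(coordproj K *v v) $ a = (\<Sum>b\<in>K. v $ b * axis b 1 $ a)" by (simp add: coordproj_mult)
  also have "\<dots> = (\<Sum>b\<in>K. if a = b then v $ b else 0)" by (rule sum.cong) (auto simp: axis_def)
  finally show ?thesis by simp
qed

lemma coordproj_nth: "coordproj K $ a $ b = (if a = b \<and> a \<in> K then 1 else 0)"
proof -
  have "coordproj K $ a $ b = (coordproj K *v axis b 1) $ a" by (rule matrix_mult_axis_nth[symmetric])
  also have "\<dots> = (if a \<in> K then axis b 1 $ a else 0)" by (rule coordproj_mult_nth)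
  finally show ?thesis by (simp add: axis_def)
qed

lemma psd_coordproj: "psd (coordproj K)"
  unfolding coordproj_def by (intro psd_sum psd_outer)

lemma coordproj_idem: "coordproj K *v (coordproj K *v v) = coordproj K *v v"
  by (simp add: vec_eq_iff coordproj_mult_nth)

lemma norm_coordproj_mult_le: "norm (coordproj K *v v) \<le> norm v"
  by (rule norm_le_componentwise_cart) (simp add: coordproj_mult_nth)

lemma coordproj_in_Dpk: "card (K :: 'n::finite set) \<le> k \<Longrightarrow> (coordproj K :: real^'n^'n) \<in> Dpk k"
  using rank_sum_outer_le[of K "\<lambda>a. axis a 1"] psd_coordproj[of K]
  by (simp add: Dpk_def coordproj_def)

text \<open>Represents an entry of a symmetric matrix by a symmetric direction, since
  differentiation in u must stay among symmetric matrices.\<close>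

definition symel :: "'n \<Rightarrow> 'n \<Rightarrow> real^'n^'n" where
  "symel a b = (1 / 2) *\<^sub>R (axis a (axis b 1) + axis b (axis a 1))"

lemma transpose_symel [simp]: "transpose (symel a b) = symel a b"
  by (auto simp: symel_def transpose_def vec_eq_iff axis_def)

lemma symel_inner: "transpose x = x \<Longrightarrow> symel a b \<bullet> x = x $ a $ b"
  using sym_nth[of x b a] by (simp add: symel_def inner_add_left inner_axis')

text \<open>The polynomial \<open>z\<^sup>T x z\<close> with \<open>z = e\<^sub>m - \<pi> x e\<^sub>m\<close>, where \<open>\<pi>\<close> is the projection to the
  coordinates in \<open>K\<close>, is nonnegative on the cone and agrees to second order at \<open>x = \<pi>\<close> with the
  principal minor of \<open>x\<close> on \<open>K \<union> {m}\<close>.\<close>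

definition probe :: "'n set \<Rightarrow> 'n \<Rightarrow> real^'n^'n \<Rightarrow> real" where
  "probe K m x = (let z = axis m 1 - coordproj K *v (x *v axis m 1) in z \<bullet> (x *v z))"

lemma probe_nonneg: "psd x \<Longrightarrow> 0 \<le> probe K m x"
  unfolding probe_def Let_def by (rule psdD)

text \<open>The projection has no entries in row or column \<open>m\<close>, and on \<open>K\<close>
  the matrix \<open>x\<close> is the identity plus \<open>h\<close>. The identity part of the cubic
  term returns one sum of squares, so its coefficient changes from -2 to -1.\<close>

lemma probe_expand:
  fixes x :: "real^'n^'n"
  assumes sx: "transpose x = x" and m: "m \<notin> K"
  defines "h \<equiv> x - coordproj K"
  shows "probe K m x = h $ m $ m - (\<Sum>a\<in>K. (h $ a $ m)\<^sup>2) + (\<Sum>a\<in>K. \<Sum>b\<in>K. h $ a $ m * (h $ a $ b * h $ b $ m))"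
proof -
  let ?e = "axis m 1 :: real^'n"
  define b where "b = coordproj K *v (x *v ?e)"
  have b: "b = (\<Sum>a\<in>K. x $ a $ m *\<^sub>R axis a 1)" by (simp add: b_def coordproj_mult matrix_mult_axis_nth)
  have be: "b \<bullet> (x *v ?e) = (\<Sum>a\<in>K. (x $ a $ m)\<^sup>2)"
    by (simp add: b inner_sum_left inner_axis_mult_axis power2_eq_square)
  have ba: "axis a 1 \<bullet> (x *v b) = (\<Sum>c\<in>K. x $ a $ c * x $ c $ m)" for a
  proof -
    have "axis a 1 \<bullet> (x *v b) = b \<bullet> (x *v axis a 1)" by (rule sym_inner[OF sx])
    also have "\<dots> = (\<Sum>c\<in>K. x $ c $ m * x $ c $ a)" by (simp add: b inner_sum_left inner_axis_mult_axis)
    also have "\<dots> = (\<Sum>c\<in>K. x $ a $ c * x $ c $ m)"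
      by (rule sum.cong) (auto simp: sym_nth[OF sx, of a] mult.commute)
    finally show ?thesis .
  qed
  have bb: "b \<bullet> (x *v b) = (\<Sum>a\<in>K. x $ a $ m * (\<Sum>c\<in>K. x $ a $ c * x $ c $ m))"
    by (subst b) (simp add: inner_sum_left ba)
  have "probe K m x = x $ m $ m - 2 * (b \<bullet> (x *v ?e)) + b \<bullet> (x *v b)"
    using sym_inner[OF sx, of ?e b]
    by (simp add: probe_def Let_def b_def[symmetric] inner_diff_left inner_diff_right
        matrix_vector_mult_diff_distrib inner_axis_mult_axis)
  also have "\<dots> = x $ m $ m - 2 * (\<Sum>a\<in>K. (x $ a $ m)\<^sup>2) + (\<Sum>a\<in>K. x $ a $ m * (\<Sum>c\<in>K. x $ a $ c * x $ c $ m))"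
    unfolding be bb ..
  also have "(\<Sum>a\<in>K. x $ a $ m * (\<Sum>c\<in>K. x $ a $ c * x $ c $ m))
      = (\<Sum>a\<in>K. (x $ a $ m)\<^sup>2 + (\<Sum>c\<in>K. h $ a $ m * (h $ a $ c * h $ c $ m)))"
  proof (rule sum.cong)
    fix a assume a: "a \<in> K"
    have hm: "h $ c $ m = x $ c $ m" if "c \<in> K" for c using that m by (auto simp: h_def coordproj_nth)
    have "(\<Sum>c\<in>K. x $ a $ c * x $ c $ m) = (\<Sum>c\<in>K. (if a = c then x $ c $ m else 0) + h $ a $ c * h $ c $ m)"
      using a hm by (intro sum.cong) (auto simp: h_def coordproj_nth algebra_simps)
    also have "\<dots> = x $ a $ m + (\<Sum>c\<in>K. h $ a $ c * h $ c $ m)" using a by (simp add: sum.distrib)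
    finally show "x $ a $ m * (\<Sum>c\<in>K. x $ a $ c * x $ c $ m)
        = (x $ a $ m)\<^sup>2 + (\<Sum>c\<in>K. h $ a $ m * (h $ a $ c * h $ c $ m))"
      using hm[OF a] by (simp add: distrib_left power2_eq_square sum_distrib_left)
  qed simp
  also have "(\<Sum>a\<in>K. (x $ a $ m)\<^sup>2) = (\<Sum>a\<in>K. (h $ a $ m)\<^sup>2)"
    using m by (intro sum.cong) (auto simp: h_def coordproj_nth)
  also have "(\<Sum>a\<in>K. (x $ a $ m)\<^sup>2 + (\<Sum>c\<in>K. h $ a $ m * (h $ a $ c * h $ c $ m)))
     = (\<Sum>a\<in>K. (h $ a $ m)\<^sup>2) + (\<Sum>a\<in>K. \<Sum>c\<in>K. h $ a $ m * (h $ a $ c * h $ c $ m))"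
    unfolding sum.distrib using m
    by (intro arg_cong2[of _ _ _ _ "(+)"] sum.cong refl) (auto simp: h_def coordproj_nth)
  also have "x $ m $ m = h $ m $ m" using m by (simp add: h_def coordproj_nth)
  finally show ?thesis by simp
qed

text \<open>The weight would add four times the (m, m) entry of the projection, which is 0. The
  square of \<open>symel a m\<close> is a quarter of E_aa + E_mm for the matrix units E; only E_aa
  meets the projection, and \<open>symbol2\<close> restores the factor 4.\<close>

lemma symbol_values:
  fixes m :: "'n::finite"
  assumes m: "m \<notin> K"
  shows "symbol1 \<alpha> (mat 1) (symel m m) (coordproj K) = - \<alpha>"
    and "a \<in> K \<Longrightarrow> symbol2 (symel a m) (symel a m) (coordproj K) = 1"
proof -
  have sc: "transpose (coordproj K) = (coordproj K :: real^'n^'n)" by (rule psdD(1)[OF psd_coordproj])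
  have t: "trace (symel m m) = 1"
    unfolding trace_eq_inner inner_commute[of "mat 1"] by (subst symel_inner[OF transpose_mat]) (simp add: mat_def)
  show "symbol1 \<alpha> (mat 1) (symel m m) (coordproj K) = - \<alpha>"
    unfolding symbol1_def t matrix_mul_lid matrix_mul_rid inner_add_left symel_inner[OF sc]
    using m by (simp add: coordproj_nth)
  assume a: "a \<in> K"
  let ?v = "symel a m"
  have "(?v ** ?v) \<bullet> outer (axis c 1) = (if a = c then 1 / 4 else 0)" if c: "c \<in> K" for c
  proof -
    have ve: "(?v *v axis c 1) $ j = (if a = c \<and> j = m then 1 / 2 else 0)" for j
      using a c m unfolding matrix_mult_axis_nth by (auto simp: symel_def axis_def)
    have "(?v ** ?v) \<bullet> outer (axis c 1) = axis c 1 \<bullet> (?v *v (?v *v axis c 1))"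
      by (simp add: inner_outer matrix_vector_mul_assoc)
    also have "\<dots> = (?v *v axis c 1) \<bullet> (?v *v axis c 1)"
      by (rule sym_inner[OF transpose_symel])
    also have "\<dots> = (\<Sum>j\<in>UNIV. if m = j then (if a = c then 1 / 4 else 0) else 0)"
      unfolding inner_vec_def by (rule sum.cong) (auto simp: ve)
    finally show ?thesis by simp
  qed
  then have "(?v ** ?v) \<bullet> coordproj K = (\<Sum>c\<in>K. if a = c then 1 / 4 else 0)"
    unfolding coordproj_def inner_sum_right by (rule sum.cong[OF refl])
  then show "symbol2 ?v ?v (coordproj K) = 1" unfolding symbol2_def inner_add_left using a by simp
qed

lemma wishart_gen_probe:
  fixes D :: "(real^'n^'n) set"
  assumes D: "D \<subseteq> Collect psd" and W: "wishart_semigroup D \<alpha> P" and c: "coordproj K \<in> D" and m: "m \<notin> K"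
  obtains F H where "gen D P F H" "\<And>x. x \<in> D \<Longrightarrow> F x = probe K m x * exp (- (mat 1 \<bullet> (x - coordproj K)))"
    "H (coordproj K) = \<alpha> - real (card K)"
proof -
  have P: "pos_sc_contraction_semigroup D P" using W by (simp add: wishart_semigroup_def)
  let ?c = "coordproj K :: real^'n^'n"
  let ?f = "\<lambda>vs. pexp D ?c (mat 1) (lprod ?c vs)"
  let ?g = "\<lambda>vs. pexp D ?c (mat 1) (lprod_gen \<alpha> ?c (mat 1) vs)"
  have g: "gen D P (?f vs) (?g vs)" if "\<forall>v\<in>set vs. transpose v = v" for vs
    by (rule wishart_gen_lprod[OF D W pd_mat_1 that])
  \<comment> \<open>The terms mirror \<open>probe_expand\<close>. At the projection the linear term
    yields \<alpha>, each square -1, and the cubic terms 0.\<close>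
  define F where "F x = (-1) * (\<Sum>a\<in>K. ?f [symel a m, symel a m] x) +
    (1 * ?f [symel m m] x + (\<Sum>a\<in>K. \<Sum>b\<in>K. ?f [symel a m, symel a b, symel b m] x))" for x
  define H where "H x = (-1) * (\<Sum>a\<in>K. ?g [symel a m, symel a m] x) +
    (1 * ?g [symel m m] x + (\<Sum>a\<in>K. \<Sum>b\<in>K. ?g [symel a m, symel a b, symel b m] x))" for x
  have "gen D P F H"
    unfolding F_def H_def by (intro gen_lincomb[OF P] gen_sum[OF P] g) auto
  moreover have "F x = probe K m x * exp (- (mat 1 \<bullet> (x - ?c)))" if x: "x \<in> D" for x
  proof -
    have sx: "transpose x = x" using D x psdD(1) by auto
    then have "transpose (x - ?c) = x - ?c" by (simp add: transpose_diff psdD(1)[OF psd_coordproj])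
    note L = symel_inner[OF this]
    define h where "h = x - ?c"
    define E where "E = exp (- (mat 1 \<bullet> h))"
    have f: "?f vs x = lprod ?c vs x * E" for vs using x by (simp add: pexp_def E_def h_def)
    have l: "lprod ?c [symel m m] x = h $ m $ m"
      "lprod ?c [symel a m, symel a m] x = (h $ a $ m)\<^sup>2"
      "lprod ?c [symel a m, symel a b, symel b m] x = h $ a $ m * (h $ a $ b * h $ b $ m)" for a b
      unfolding lprod.simps h_def[symmetric] L[folded h_def] by (simp_all add: power2_eq_square)
    show ?thesis
      unfolding F_def f l probe_expand[OF sx m] h_def[symmetric] E_def[symmetric] sum_distrib_right[symmetric]
      by (simp add: algebra_simps)
  qed
  moreover have "H ?c = \<alpha> - real (card K)"
  proof -
    have 1: "?g vs ?c = lprod_gen \<alpha> ?c (mat 1) vs ?c" for vs using c by (simp add: pexp_def)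
    show ?thesis unfolding H_def 1 lprod_gen_center symbol_values(1)[OF m]
      using symbol_values(2)[OF m] by simp
  qed
  ultimately show thesis using that by blast
qed

text \<open>The fourth power of the Frobenius norm is a sum of products of four centred entries, and
  so many linear factors leave nothing at \<open>c\<close>. The function serves to dominate the
  probe.\<close>

lemma wishart_gen_quartic:
  fixes D :: "(real^'n^'n) set"
  assumes D: "D \<subseteq> Collect psd" and W: "wishart_semigroup D \<alpha> P" and c: "c \<in> D"
  obtains F H where "gen D P F H" "\<And>x. x \<in> D \<Longrightarrow> F x = norm (x - c) ^ 4 * exp (- (mat 1 \<bullet> (x - c)))" "H c = 0"
proof -
  have P: "pos_sc_contraction_semigroup D P" using W by (simp add: wishart_semigroup_def)
  let ?f = "\<lambda>vs. pexp D c (mat 1) (lprod c vs)"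
  let ?g = "\<lambda>vs. pexp D c (mat 1) (lprod_gen \<alpha> c (mat 1) vs)"
  have g: "gen D P (?f vs) (?g vs)" if "\<forall>v\<in>set vs. transpose v = v" for vs
    by (rule wishart_gen_lprod[OF D W pd_mat_1 that])
  define F where "F x = (\<Sum>i\<in>UNIV. \<Sum>j\<in>UNIV. \<Sum>k\<in>UNIV. \<Sum>l\<in>UNIV. ?f [symel i j, symel i j, symel k l, symel k l] x)" for x
  define H where "H x = (\<Sum>i\<in>UNIV. \<Sum>j\<in>UNIV. \<Sum>k\<in>UNIV. \<Sum>l\<in>UNIV. ?g [symel i j, symel i j, symel k l, symel k l] x)" for x
  have "gen D P F H"
    unfolding F_def H_def by (intro gen_sum[OF P] g) auto
  moreover have "F x = norm (x - c) ^ 4 * exp (- (mat 1 \<bullet> (x - c)))" if x: "x \<in> D" for x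
  proof -
    have "transpose x = x" "transpose c = c" using D x c psdD(1) by auto
    then have "transpose (x - c) = x - c" by (simp add: transpose_diff)
    note L = symel_inner[OF this]
    define h where "h = x - c"
    have "norm h ^ 4 = ((norm h)\<^sup>2)\<^sup>2" by simp
    also have "(norm h)\<^sup>2 = (\<Sum>i\<in>UNIV. \<Sum>j\<in>UNIV. (h $ i $ j)\<^sup>2)"
      unfolding power2_norm_eq_inner by (simp add: inner_vec_def power2_eq_square)
    also have "(\<Sum>i\<in>UNIV. \<Sum>j\<in>UNIV. (h $ i $ j)\<^sup>2)\<^sup>2 =
        (\<Sum>i\<in>UNIV. \<Sum>j\<in>UNIV. \<Sum>k\<in>UNIV. \<Sum>l\<in>UNIV. (h $ i $ j)\<^sup>2 * (h $ k $ l)\<^sup>2)"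
      unfolding power2_eq_square[of "sum _ _"] by (simp only: sum_distrib_right) (simp only: sum_distrib_left)
    finally have q: "norm h ^ 4 = (\<Sum>i\<in>UNIV. \<Sum>j\<in>UNIV. \<Sum>k\<in>UNIV. \<Sum>l\<in>UNIV. (h $ i $ j)\<^sup>2 * (h $ k $ l)\<^sup>2)" .
    define E where "E = exp (- (mat 1 \<bullet> h))"
    have f: "?f vs x = lprod c vs x * E" for vs using x by (simp add: pexp_def E_def h_def)
    have l: "lprod c [symel i j, symel i j, symel k l, symel k l] x = (h $ i $ j)\<^sup>2 * (h $ k $ l)\<^sup>2" for i j k l
      unfolding lprod.simps h_def[symmetric] L[folded h_def] by (simp add: power2_eq_square)
    show ?thesis
      unfolding F_def f l h_def[symmetric] E_def[symmetric] sum_distrib_right[symmetric] q ..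
  qed
  moreover have "H c = 0"
  proof -
    have "?g vs c = lprod_gen \<alpha> c (mat 1) vs c" for vs using c by (simp add: pexp_def)
    then show ?thesis unfolding H_def by (simp only: lprod_gen_center sum.neutral_const)
  qed
  ultimately show thesis using that by blast
qed

lemma wishart_drift_ge:
  fixes D :: "(real^'n^'n) set"
  assumes D: "D \<subseteq> Collect psd" and W: "wishart_semigroup D \<alpha> P" and c: "coordproj K \<in> D" and m: "m \<notin> K"
  shows "real (card K) \<le> \<alpha>"
proof -
  have P: "pos_sc_contraction_semigroup D P" using W by (simp add: wishart_semigroup_def)
  from wishart_gen_probe[OF D W c m] obtain F H where g: "gen D P F H"
    and F: "\<And>x. x \<in> D \<Longrightarrow> F x = probe K m x * exp (- (mat 1 \<bullet> (x - coordproj K)))"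
    and H: "H (coordproj K) = \<alpha> - real (card K)" by blast
  have "0 \<le> H (coordproj K)"
  proof (rule gen_positive_minimum[OF P g _ c])
    show "0 \<le> F x" if "x \<in> D" for x unfolding F[OF that]
      using probe_nonneg[of x K m] D that by (intro mult_nonneg_nonneg) auto
    show "F (coordproj K) = 0"
      unfolding F[OF c] probe_expand[OF psdD(1)[OF psd_coordproj] m] by simp
  qed
  then show ?thesis by (simp add: H)
qed

section \<open>The upper bound for the drift below full rank\<close>

lemma rank_kernel_vector:
  fixes x :: "real^'n^'n"
  assumes "rank x \<le> card K" "m \<notin> K"
  obtains v where "v \<noteq> 0" "x *v v = 0" "coordproj K *v v + (v $ m) *\<^sub>R axis m 1 = v"
proof -
  let ?S = "(\<lambda>a. axis a 1 :: real^'n) ` insert m K"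
  have ij: "inj_on (\<lambda>a. axis a 1 :: real^'n) A" for A
    by (auto simp: inj_on_def axis_eq_axis)
  have "independent ?S"
    by (rule independent_mono[OF independent_Basis]) (auto simp: Basis_vec_def)
  then have "dim ?S = card ?S" by (rule dim_eq_card_independent)
  also have "\<dots> = card K + 1" using ij assms(2) by (subst card_image) auto
  finally have dS: "dim ?S = card K + 1" .
  \<comment> \<open>The span has dimension card K + 1, more than the rank of \<open>x\<close>, so it
    meets the kernel. Support in \<open>insert m K\<close> is what the last clause of the conclusion
    expresses.\<close>
  have "\<not> inj_on ((*v) x) (span ?S)"
  proof
    assume "inj_on ((*v) x) (span ?S)"
    then have "dim ((*v) x ` ?S) = dim ?S" by (intro dim_image_eq) auto
    moreover have "dim ((*v) x ` ?S) \<le> dim (range ((*v) x))" by (intro dim_subset) auto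
    ultimately show False using dS assms(1) by (simp add: rank_dim_range)
  qed
  then obtain v1 v2 where v: "v1 \<in> span ?S" "v2 \<in> span ?S" "v1 \<noteq> v2" "x *v v1 = x *v v2"
    unfolding inj_on_def by blast
  let ?T = "{v. coordproj K *v v + (v $ m) *\<^sub>R axis m 1 = (v :: real^'n)}"
  have "subspace ?T"
    by (auto simp: subspace_def matrix_vector_right_distrib matrix_vector_mult_scaleR algebra_simps
        simp flip: scaleR_add_right scaleR_scaleR)
  moreover have "?S \<subseteq> ?T"
  proof
    fix y assume "y \<in> ?S"
    then obtain a where a: "a \<in> insert m K" "y = axis a 1" by blast
    have "(coordproj K *v y + (y $ m) *\<^sub>R axis m 1) $ j = y $ j" for j
      using a assms(2) by (auto simp: coordproj_mult_nth axis_def)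
    then show "y \<in> ?T" by (simp add: vec_eq_iff)
  qed
  ultimately have "span ?S \<subseteq> ?T" by (intro span_minimal)
  moreover have "v1 - v2 \<in> span ?S" using v by (intro span_diff)
  ultimately have "v1 - v2 \<in> ?T" by blast
  moreover have "x *v (v1 - v2) = 0" using v by (simp add: matrix_vector_mult_diff_distrib)
  ultimately show thesis using v(3) by (intro that[of "v1 - v2"]) auto
qed

lemma abs_quadratic_form_le: "\<bar>v \<bullet> (x *v v)\<bar> \<le> norm (x :: real^'n^'n) * (norm v)\<^sup>2"
  using Cauchy_Schwarz_ineq2[of x "outer v"] by (simp add: inner_outer norm_outer)

lemma norm_matrix_vector_le: "norm (x *v v) \<le> norm (x :: real^'n^'n) * norm v"
proof -
  have "(norm (x *v v))\<^sup>2 = (\<Sum>i\<in>UNIV. (x $ i \<bullet> v)\<^sup>2)"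
    unfolding power2_norm_eq_inner inner_vec_def[of "x *v v"]
    by (simp add: matrix_vector_mul_component power2_eq_square)
  also have "\<dots> \<le> (\<Sum>i\<in>UNIV. (norm (x $ i))\<^sup>2 * (norm v)\<^sup>2)"
    unfolding power_mult_distrib[symmetric]
    by (intro sum_mono) (metis Cauchy_Schwarz_ineq2 abs_ge_zero power2_abs power_mono)
  also have "\<dots> = (norm x * norm v)\<^sup>2"
    by (simp add: sum_distrib_right[symmetric] power_mult_distrib norm_vec_def[of x] L2_set_def sum_nonneg)
  finally show ?thesis by (simp add: power2_le_iff_abs_le)
qed

text \<open>On matrices of rank at most \<open>card K\<close> the minor vanishes, so the probe is of fourth order.\<close>

lemma probe_le_quartic:
  fixes x :: "real^'n^'n"
  assumes px: "psd x" and rx: "rank x \<le> card K" and m: "m \<notin> K"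
  defines "c \<equiv> coordproj K"
  shows "probe K m x \<le> (20 * norm c + 10) * norm (x - c) ^ 4"
proof -
  define h where "h = x - c"
  define \<eta> where "\<eta> = norm h"
  have \<eta>0: "0 \<le> \<eta>" by (simp add: \<eta>_def)
  let ?e = "axis m 1 :: real^'n"
  have sx: "transpose x = x" using px by (rule psdD)
  have xh: "x *v v = c *v v + h *v v" for v by (simp add: h_def matrix_vector_mult_add_rdistrib[symmetric])
  have ce: "c *v ?e = 0" using m by (simp add: c_def vec_eq_iff coordproj_mult_nth axis_def)
  have nx: "norm x \<le> norm c + \<eta>"
    using norm_triangle_ineq[of c h] by (simp add: h_def \<eta>_def)
  define b where "b = c *v (x *v ?e)"
  have "b = c *v (h *v ?e)" by (simp add: b_def xh ce)
  then have "norm b \<le> norm (h *v ?e)" unfolding c_def using norm_coordproj_mult_le by metis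
  also have "\<dots> \<le> \<eta>" using norm_matrix_vector_le[of h ?e] by (simp add: \<eta>_def norm_axis_1)
  finally have nb: "norm b \<le> \<eta>" .
  define z where "z = ?e - b"
  have pr: "probe K m x = z \<bullet> (x *v z)" by (simp add: probe_def z_def b_def c_def Let_def)
  show ?thesis
  proof (cases "\<eta> < 1 / 2")
    case False
    then have \<eta>: "1 \<le> 2 * \<eta>" by simp
    \<comment> \<open>Away from the projection no cancellation is required: lower powers of \<eta>
      are dominated by its fourth power because \<eta> >= 1/2.\<close>
    have p4: "\<eta> ^ i \<le> 2 ^ (4 - i) * \<eta> ^ 4" if "i \<le> 4" for i
    proof -
      have "\<eta> ^ i * 1 \<le> \<eta> ^ i * (2 * \<eta>) ^ (4 - i)" using \<eta> \<eta>0 by (intro mult_left_mono one_le_power) auto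
      also have "\<dots> = 2 ^ (4 - i) * \<eta> ^ 4" using that by (simp add: power_mult_distrib power_add[symmetric])
      finally show ?thesis by simp
    qed
    have "z \<bullet> z = 1 - 2 * (?e \<bullet> b) + b \<bullet> b"
      by (simp add: z_def inner_diff_left inner_diff_right inner_commute inner_axis_axis)
    moreover have "?e \<bullet> b = 0" using m by (simp add: b_def c_def inner_axis' coordproj_mult_nth)
    ultimately have "(norm z)\<^sup>2 = 1 + (norm b)\<^sup>2" by (simp add: power2_norm_eq_inner)
    also have "\<dots> \<le> 1 + \<eta>\<^sup>2" using nb by (simp add: power_mono)
    finally have nz: "(norm z)\<^sup>2 \<le> 1 + \<eta>\<^sup>2" .
    have "probe K m x \<le> norm x * (norm z)\<^sup>2" using abs_quadratic_form_le[of z x] pr by linarith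
    also have "\<dots> \<le> (norm c + \<eta>) * (1 + \<eta>\<^sup>2)" using nx nz \<eta>0 by (intro mult_mono) auto
    also have "\<dots> = norm c * \<eta> ^ 0 + norm c * \<eta> ^ 2 + \<eta> ^ 1 + \<eta> ^ 3"
      by (simp add: algebra_simps power2_eq_square power3_eq_cube)
    \<comment> \<open>Origin of the constants of the statement: 20 = 16 + 4 and 10 = 8 + 2.\<close>
    also have "\<dots> \<le> norm c * (16 * \<eta> ^ 4) + norm c * (4 * \<eta> ^ 4) + 8 * \<eta> ^ 4 + 2 * \<eta> ^ 4"
      using p4[of 0] p4[of 1] p4[of 2] p4[of 3] by (intro add_mono mult_left_mono) auto
    finally show ?thesis by (simp add: h_def \<eta>_def algebra_simps)
  next
    case True
    obtain v where v: "v \<noteq> 0" "x *v v = 0" "c *v v + (v $ m) *\<^sub>R ?e = v"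
      using rank_kernel_vector[OF rx m] unfolding c_def by blast
    \<comment> \<open>Otherwise \<open>v\<close> lies in the range of the projection, where the form
      of \<open>x\<close> differs from the squared norm by a factor of at most \<eta> < 1 and cannot
      vanish.\<close>
    have vm: "v $ m \<noteq> 0"
    proof
      assume "v $ m = 0"
      then have cv: "c *v v = v" using v(3) by simp
      have "0 = v \<bullet> (x *v v)" using v(2) by simp
      also have "\<dots> = (norm v)\<^sup>2 + v \<bullet> (h *v v)" by (simp add: xh cv inner_add_right power2_norm_eq_inner)
      also have "\<dots> \<ge> (norm v)\<^sup>2 - \<eta> * (norm v)\<^sup>2"
        using abs_quadratic_form_le[of v h] by (simp add: \<eta>_def)
      finally have "(1 - \<eta>) * (norm v)\<^sup>2 \<le> 0" by (simp add: algebra_simps)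
      moreover have "0 < (1 - \<eta>) * (norm v)\<^sup>2" using True v(1) by (intro mult_pos_pos) auto
      ultimately show False by simp
    qed
    \<comment> \<open>Rescales the kernel vector to e_m - w with \<open>w\<close> supported in
      \<open>K\<close>; the probe vector \<open>z\<close> then differs from a kernel vector by b - w
      only.\<close>
    define w where "w = - (1 / v $ m) *\<^sub>R (c *v v)"
    have cw: "c *v w = w" by (simp only: w_def matrix_vector_mult_scaleR c_def coordproj_idem)
    have "?e - w = (1 / v $ m) *\<^sub>R (c *v v + (v $ m) *\<^sub>R ?e)"
      using vm by (simp add: w_def scaleR_add_right)
    then have ew: "?e - w = (1 / v $ m) *\<^sub>R v" by (simp only: v(3))
    then have xw: "x *v (?e - w) = 0" by (simp add: matrix_vector_mult_scaleR v(2))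
    then have xew: "x *v ?e = x *v w" by (simp add: matrix_vector_mult_diff_distrib)
    \<comment> \<open>\<open>w\<close> solves w = b - c (h w), so \<open>b\<close> is its first
      approximation. Since \<open>w\<close> itself has size of order \<eta>, the error b - w has
      order \<eta>^2.\<close>
    have "b = c *v (x *v w)" unfolding b_def xew ..
    also have "\<dots> = w + c *v (h *v w)" by (simp only: xh matrix_vector_right_distrib cw)
    finally have bw: "b - w = c *v (h *v w)" by simp
    have nbw: "norm (b - w) \<le> \<eta> * norm w"
      unfolding bw c_def using norm_coordproj_mult_le norm_matrix_vector_le[of h w] \<eta>_def order_trans by blast
    also have "\<dots> \<le> 1 / 2 * norm w" using True by (intro mult_right_mono) auto
    finally have "norm w \<le> 2 * norm b"
      using norm_triangle_ineq2[of w b] by (simp add: norm_minus_commute)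
    then have nw: "norm w \<le> 2 * \<eta>" using nb by simp
    have "norm (b - w) \<le> \<eta> * (2 * \<eta>)" using nbw nw \<eta>0 by (meson mult_left_mono order_trans)
    then have "(norm (b - w))\<^sup>2 \<le> (\<eta> * (2 * \<eta>))\<^sup>2" by (intro power_mono) auto
    then have n2: "(norm (b - w))\<^sup>2 \<le> 4 * \<eta> ^ 4" by (simp add: power2_eq_square power4_eq_xxxx ac_simps)
    have zz: "z = (?e - w) - (b - w)" by (simp add: z_def)
    \<comment> \<open>The kernel part drops out on both sides by symmetry, leaving the form at b -
      w, which is of order \<eta>^4.\<close>
    have "z \<bullet> (x *v z) = (b - w) \<bullet> (x *v (b - w))"
    proof -
      have "x *v z = - (x *v (b - w))"
        unfolding zz matrix_vector_mult_diff_distrib[of x "?e - w" "b - w"] xw by simp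
      moreover have "(?e - w) \<bullet> (x *v (b - w)) = 0"
        using sym_inner[OF sx, of "?e - w" "b - w"] by (simp add: xw)
      ultimately show ?thesis
        unfolding zz inner_diff_left[of "?e - w" "b - w"] by (simp only: inner_minus_right)
    qed
    also have "\<dots> \<le> norm x * (norm (b - w))\<^sup>2" using abs_quadratic_form_le[of "b - w" x] by linarith
    also have "\<dots> \<le> (norm c + 1) * (4 * \<eta> ^ 4)" using nx n2 True \<eta>0 by (intro mult_mono) auto
    also have "\<dots> \<le> (20 * norm c + 10) * \<eta> ^ 4"
    proof -
      have "(norm c + 1) * (4 * \<eta> ^ 4) = (4 * norm c + 4) * \<eta> ^ 4" by (simp add: algebra_simps)
      also have "\<dots> \<le> (20 * norm c + 10) * \<eta> ^ 4" using \<eta>0 by (intro mult_right_mono) auto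
      finally show ?thesis .
    qed
    finally show ?thesis by (simp add: pr h_def \<eta>_def)
  qed
qed

lemma wishart_drift_le:
  assumes W: "wishart_semigroup (Dpk k :: (real^'n^'n) set) \<alpha> P" and k: "k < CARD('n)"
  shows "\<alpha> \<le> real k"
proof -
  let ?D = "Dpk k :: (real^'n^'n) set"
  have D: "?D \<subseteq> Collect psd" by (auto simp: Dpk_def)
  have P: "pos_sc_contraction_semigroup ?D P" using W by (simp add: wishart_semigroup_def)
  obtain K :: "'n set" where K: "card K = k" using obtain_card_UNIV[OF less_imp_le[OF k]] .
  then obtain m where m: "m \<notin> K" using k by (metis UNIV_eq_I less_irrefl)
  let ?c = "coordproj K :: real^'n^'n"
  have c: "?c \<in> ?D" using K by (intro coordproj_in_Dpk) simp
  from wishart_gen_probe[OF D W c m] obtain F H where g: "gen ?D P F H"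
    and F: "\<And>x. x \<in> ?D \<Longrightarrow> F x = probe K m x * exp (- (mat 1 \<bullet> (x - ?c)))"
    and H: "H ?c = \<alpha> - real (card K)" by blast
  from wishart_gen_quartic[OF D W c] obtain F' H' where g': "gen ?D P F' H'"
    and F': "\<And>x. x \<in> ?D \<Longrightarrow> F' x = norm (x - ?c) ^ 4 * exp (- (mat 1 \<bullet> (x - ?c)))"
    and H': "H' ?c = 0" by blast
  let ?C = "20 * norm ?c + 10"
  have G: "gen ?D P (\<lambda>x. (-1) * F x + (?C * F' x + 0)) (\<lambda>x. (-1) * H x + (?C * H' x + 0))"
    by (intro gen_lincomb[OF P] g g' gen_zero[OF P])
  have "0 \<le> (-1) * H ?c + (?C * H' ?c + 0)"
  proof (rule gen_positive_minimum[OF P G _ c])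
    show "0 \<le> (-1) * F x + (?C * F' x + 0)" if x: "x \<in> ?D" for x
    proof -
      have "probe K m x \<le> ?C * norm (x - ?c) ^ 4"
        using x K by (intro probe_le_quartic m) (auto simp: Dpk_def)
      from mult_right_mono[OF this, of "exp (- (mat 1 \<bullet> (x - ?c)))"] show ?thesis
        by (simp add: F[OF x] F'[OF x] mult.assoc)
    qed
    show "(-1) * F ?c + (?C * F' ?c + 0) = 0"
      unfolding F[OF c] F'[OF c] probe_expand[OF psdD(1)[OF psd_coordproj] m] by simp
  qed
  then show ?thesis using K by (simp add: H H')
qed

theorem mainTheorem9:
  fixes k :: nat and \<alpha> :: real
  assumes "1 \<le> k" and "k \<le> CARD('n::finite)" and "0 \<le> \<alpha>"
  shows "(\<exists>P. wishart_semigroup (Dpk k :: (real^'n^'n) set) \<alpha> P) \<longleftrightarrow>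
         ((k < CARD('n) \<longrightarrow> \<alpha> = real k) \<and>
          (k = CARD('n) \<longrightarrow> \<alpha> \<ge> real (CARD('n)) - 1))"
proof
  let ?D = "Dpk k :: (real^'n^'n) set"
  have D: "?D \<subseteq> Collect psd" by (auto simp: Dpk_def)
  assume "\<exists>P. wishart_semigroup ?D \<alpha> P"
  then obtain P where P: "wishart_semigroup ?D \<alpha> P" by blast
  \<comment> \<open>An index outside \<open>K\<close> must exist, hence j < CARD('n), and the
    projection must lie in the state space, hence j <= k. Below full rank j = k is used, in full
    rank j = CARD('n) - 1.\<close>
  have lower: "real j \<le> \<alpha>" if j: "j \<le> k" "j < CARD('n)" for j
  proof -
    obtain K :: "'n set" where K: "card K = j" using obtain_card_UNIV[OF less_imp_le[OF j(2)]] .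
    then obtain m where "m \<notin> K" using j(2) by (metis UNIV_eq_I less_irrefl)
    from wishart_drift_ge[OF D P coordproj_in_Dpk this] K j(1) show ?thesis by simp
  qed
  show "(k < CARD('n) \<longrightarrow> \<alpha> = real k) \<and> (k = CARD('n) \<longrightarrow> \<alpha> \<ge> real (CARD('n)) - 1)"
  proof (intro conjI impI)
    assume k: "k < CARD('n)"
    then show "\<alpha> = real k" using lower[of k] wishart_drift_le[OF P k] by simp
  next
    assume "k = CARD('n)"
    then show "\<alpha> \<ge> real (CARD('n)) - 1" using lower[of "CARD('n) - 1"] assms(1) by (simp add: of_nat_diff)
  qed
next
  assume *: "(k < CARD('n) \<longrightarrow> \<alpha> = real k) \<and> (k = CARD('n) \<longrightarrow> \<alpha> \<ge> real (CARD('n)) - 1)"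
  show "\<exists>P. wishart_semigroup (Dpk k :: (real^'n^'n) set) \<alpha> P"
  proof (cases "k = CARD('n)")
    case True
    then show ?thesis using * wishart_exists_full_rank by blast
  next
    case False
    then have "\<alpha> = real k" using * assms(2) by simp
    then show ?thesis using wishart_exists_low_rank[OF assms(2)] by simp
  qed
qed

end
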